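(* Under the standing hypotheses (H1)–(H6) below, suppose $\tau$ is in the limit-circle case at $a$ and in the limit-point case at $b$, and let $w_1,w_2\in T_{\max}$ satisfy $W(w_1,w_2^\ast)(a)=1$ and $W(w_1,w_1^\ast)(a)=W(w_2,w_2^\ast)(a)=0$, with $BC_a^1(f)=W(f,w_2^\ast)(a)$, $BC_a^2(f)=W(w_1^\ast,f)(a)$ for $f\in T_{\max}$. Then a linear relation $S$ is a self-adjoint restriction of $T_{\max}$ if and only if $$S=\{f\in T_{\max}\,:\,BC_a^1(f)\cos\varphi_\alpha-BC_a^2(f)\sin\varphi_\alpha=0\}$$ for some $\varphi_\alpha\in[0,\pi)$. The analogous statement holds if $\tau$ is in the limit-circle case at $b$ and in the limit-point case at $a$.
   Context: Let $-\infty\le a<b\le\infty$ and $\varrho,\varsigma,\chi$ locally finite Borel measures on $(a,b)$ with: (H1) $\varrho$ positive; (H2) $\chi$ real-valued; (H3) $\varsigma$ real-valued with $\operatorname{supp}\varsigma=(a,b)$; (H4) $\varsigma(\{x\})\chi(\{x\})=\varsigma(\{x\})\varrho(\{x\})=0$ for all $x$; (H5) for every gap $(\alpha,\beta)$ of $\operatorname{supp}\varrho$ (open interval in the complement with $\alpha,\beta\in\operatorname{supp}\varrho$) and every $f\in\mathfrak{D}_\tau$ with $f(\alpha-)=f(\beta+)=0$ one has $f=0$ on $(\alpha,\beta)$; (H6) $\operatorname{supp}\varrho$ has more than one point. Notation: $\int_c^x h\,d\mu=\int_{[c,x)}h\,d\mu$ ($x>c$), $0$ ($x=c$), $-\int_{[x,c)}h\,d\mu$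 ($x<c$); $AC_{loc}((a,b);\mu)$: functions $f(x)=f(c)+\int_c^x h\,d\mu$, $h=\frac{df}{d\mu}\in L^1_{loc}$. $\mathfrak{D}_\tau$: $f\in AC_{loc}((a,b);\varsigma)$ for which there is $F\in AC_{loc}((a,b);\varrho)$ with $F=-\frac{df}{d\varsigma}+\int_c^{\cdot}f\,d\chi$ $|\varsigma|$-a.e.; $\tau f:=\frac{dF}{d\varrho}$, $f^{[1]}:=\int_c^{\cdot}f\,d\chi-F$, $W(f,g)=fg^{[1]}-f^{[1]}g$. In $L^2((a,b);\varrho)$: $T_{\max}=\{(f,\tau f): f\in\mathfrak{D}_\tau,\ f,\tau f\in L^2\}$, elements identified with functions in $\mathfrak{D}_\tau$; $f^\ast$ is complex conjugation. For $f,g\in T_{\max}$ the limit $W(f,g)(a)=\lim_{x\downarrow a}W(f,g)(x)$ exists. $\tau$ is l.c. at an endpoint if for all $z\in\mathbb{C}$ all solutions of $\tau u=zu$ are square-integrable w.r.t. $\varrho$ near that endpoint, and l.p. otherwise. A self-adjoint restriction of $T_{\max}$ is a linear relation $S\subseteq T_{\max}$ with $S=S^\ast$ (adjoint in $L^2((a,b);\varrho)$). *)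

theory Defs
  imports "HOL-Analysis.Analysis"
begin

text \<open>Measures on the interval (a,b).  A real-valued (signed) locally finite Borel
measure is represented by its Jordan decomposition: a pair of positive locally finite
Borel measures which are mutually singular on (a,b).\<close>

type_synonym smeasure = "real measure \<times> real measure"
type_synonym rel = "((real \<Rightarrow> complex) \<times> (real \<Rightarrow> complex)) set"

definition ivl :: "ereal \<Rightarrow> ereal \<Rightarrow> real set" where
  "ivl a b = {x. a < ereal x \<and> ereal x < b}"

definition loc_finite :: "real set \<Rightarrow> real measure \<Rightarrow> bool" where
  "loc_finite I M \<longleftrightarrow> sets M = sets borel \<and>
     (\<forall>K. compact K \<and> K \<subseteq> I \<longrightarrow> emeasure M K < \<infinity>)"

definition real_lf_measure :: "real set \<Rightarrow> smeasure \<Rightarrow> bool" where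
  "real_lf_measure I \<mu> \<longleftrightarrow> loc_finite I (fst \<mu>) \<and> loc_finite I (snd \<mu>) \<and>
     (\<exists>A\<in>sets borel. emeasure (fst \<mu>) (I - A) = 0 \<and> emeasure (snd \<mu>) (I \<inter> A) = 0)"

definition pos_measure :: "real measure \<Rightarrow> smeasure" where
  "pos_measure M = (M, null_measure M)"

definition smeas_pt :: "smeasure \<Rightarrow> real \<Rightarrow> real" where
  "smeas_pt \<mu> x = measure (fst \<mu>) {x} - measure (snd \<mu>) {x}"

definition ssupp :: "real set \<Rightarrow> smeasure \<Rightarrow> real set" where
  "ssupp I \<mu> = {x\<in>I. \<forall>e>0. emeasure (fst \<mu>) (ball x e \<inter> I) + emeasure (snd \<mu>) (ball x e \<inter> I) \<noteq> 0}"

definition slint :: "smeasure \<Rightarrow> real set \<Rightarrow> (real \<Rightarrow> complex) \<Rightarrow> complex" where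
  "slint \<mu> A h = (LINT x:A|fst \<mu>. h x) - (LINT x:A|snd \<mu>. h x)"

definition sint :: "smeasure \<Rightarrow> real \<Rightarrow> real \<Rightarrow> (real \<Rightarrow> complex) \<Rightarrow> complex" where
  "sint \<mu> c x h = (if c < x then slint \<mu> {c..<x} h else if x = c then 0 else - slint \<mu> {x..<c} h)"

definition loc_int :: "real set \<Rightarrow> smeasure \<Rightarrow> (real \<Rightarrow> complex) \<Rightarrow> bool" where
  "loc_int I \<mu> h \<longleftrightarrow> (\<forall>s\<in>I. \<forall>t\<in>I. set_integrable (fst \<mu>) {s..t} h \<and> set_integrable (snd \<mu>) {s..t} h)"

definition AC_dens :: "real set \<Rightarrow> smeasure \<Rightarrow> real \<Rightarrow> (real \<Rightarrow> complex) \<Rightarrow> (real \<Rightarrow> complex) \<Rightarrow> bool" where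
  "AC_dens I \<mu> c f h \<longleftrightarrow> loc_int I \<mu> h \<and> (\<forall>x\<in>I. f x = f c + sint \<mu> c x h)"

definition sAE :: "real set \<Rightarrow> smeasure \<Rightarrow> (real \<Rightarrow> bool) \<Rightarrow> bool" where
  "sAE I \<mu> P \<longleftrightarrow> (AE x in fst \<mu>. x \<in> I \<longrightarrow> P x) \<and> (AE x in snd \<mu>. x \<in> I \<longrightarrow> P x)"

definition qd_datum :: "real set \<Rightarrow> real measure \<Rightarrow> smeasure \<Rightarrow> smeasure \<Rightarrow> real
    \<Rightarrow> (real \<Rightarrow> complex) \<Rightarrow> (real \<Rightarrow> complex) \<Rightarrow> bool" where
  "qd_datum I rho sig chi c f F \<longleftrightarrow>
     (\<exists>h. AC_dens I sig c f h \<and> (\<exists>g. AC_dens I (pos_measure rho) c F g) \<and>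
          sAE I sig (\<lambda>x. F x = - h x + sint chi c x f))"

definition in_Dtau :: "real set \<Rightarrow> real measure \<Rightarrow> smeasure \<Rightarrow> smeasure \<Rightarrow> real
    \<Rightarrow> (real \<Rightarrow> complex) \<Rightarrow> bool" where
  "in_Dtau I rho sig chi c f \<longleftrightarrow> (\<exists>F. qd_datum I rho sig chi c f F)"

definition tau_rel :: "real set \<Rightarrow> real measure \<Rightarrow> smeasure \<Rightarrow> smeasure \<Rightarrow> real
    \<Rightarrow> (real \<Rightarrow> complex) \<Rightarrow> (real \<Rightarrow> complex) \<Rightarrow> bool" where
  "tau_rel I rho sig chi c f g \<longleftrightarrow>
     (\<exists>F. qd_datum I rho sig chi c f F \<and> AC_dens I (pos_measure rho) c F g)"

definition qderiv :: "real set \<Rightarrow> real measure \<Rightarrow> smeasure \<Rightarrow> smeasure \<Rightarrow> real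
    \<Rightarrow> (real \<Rightarrow> complex) \<Rightarrow> real \<Rightarrow> complex" where
  "qderiv I rho sig chi c f = (\<lambda>x. sint chi c x f - (SOME F. qd_datum I rho sig chi c f F) x)"

definition wronsk :: "real set \<Rightarrow> real measure \<Rightarrow> smeasure \<Rightarrow> smeasure \<Rightarrow> real
    \<Rightarrow> (real \<Rightarrow> complex) \<Rightarrow> (real \<Rightarrow> complex) \<Rightarrow> real \<Rightarrow> complex" where
  "wronsk I rho sig chi c f g = (\<lambda>x. f x * qderiv I rho sig chi c g x - qderiv I rho sig chi c f x * g x)"

definition left_end :: "ereal \<Rightarrow> real filter" where
  "left_end a = (if a = -\<infinity> then at_bot else at_right (real_of_ereal a))"

definition right_end :: "ereal \<Rightarrow> real filter" where
  "right_end b = (if b = \<infinity> then at_top else at_left (real_of_ereal b))"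

definition wr_end :: "real set \<Rightarrow> real measure \<Rightarrow> smeasure \<Rightarrow> smeasure \<Rightarrow> real \<Rightarrow> real filter
    \<Rightarrow> (real \<Rightarrow> complex) \<Rightarrow> (real \<Rightarrow> complex) \<Rightarrow> complex" where
  "wr_end I rho sig chi c Fe f g = Lim Fe (wronsk I rho sig chi c f g)"

text \<open>The Hilbert space \<open>L^2(I;\<rho>)\<close>, modelled by functions modulo \<rho>-a.e. equality on I.\<close>
definition L2 :: "real set \<Rightarrow> real measure \<Rightarrow> (real \<Rightarrow> complex) \<Rightarrow> bool" where
  "L2 I rho f \<longleftrightarrow> set_borel_measurable rho I f \<and> set_integrable rho I (\<lambda>x. (cmod (f x))\<^sup>2)"

definition linner :: "real set \<Rightarrow> real measure \<Rightarrow> (real \<Rightarrow> complex) \<Rightarrow> (real \<Rightarrow> complex) \<Rightarrow> complex" where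
  "linner I rho f g = (LINT x:I|rho. f x * cnj (g x))"

definition aeq :: "real set \<Rightarrow> real measure \<Rightarrow> (real \<Rightarrow> complex) \<Rightarrow> (real \<Rightarrow> complex) \<Rightarrow> bool" where
  "aeq I rho f g \<longleftrightarrow> (AE x in rho. x \<in> I \<longrightarrow> f x = g x)"

text \<open>All pairs of L2-functions equivalent (a.e.) to a pair in R, i.e. the subset of
\<open>L^2 \<times> L^2\<close> determined by R.\<close>
definition sat :: "real set \<Rightarrow> real measure \<Rightarrow> rel \<Rightarrow> rel" where
  "sat I rho R = {(f, g). L2 I rho f \<and> L2 I rho g \<and>
      (\<exists>(f', g')\<in>R. aeq I rho f f' \<and> aeq I rho g g')}"

definition linear_rel :: "real set \<Rightarrow> real measure \<Rightarrow> rel \<Rightarrow> bool" where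
  "linear_rel I rho S \<longleftrightarrow> sat I rho S = S \<and> ((\<lambda>x. 0), (\<lambda>x. 0)) \<in> S \<and>
     (\<forall>(f, g)\<in>S. \<forall>(u, v)\<in>S. ((\<lambda>x. f x + u x), (\<lambda>x. g x + v x)) \<in> S) \<and>
     (\<forall>l::complex. \<forall>(f, g)\<in>S. ((\<lambda>x. l * f x), (\<lambda>x. l * g x)) \<in> S)"

definition adj :: "real set \<Rightarrow> real measure \<Rightarrow> rel \<Rightarrow> rel" where
  "adj I rho S = {(f, g). L2 I rho f \<and> L2 I rho g \<and>
      (\<forall>(u, v)\<in>S. linner I rho g u = linner I rho f v)}"

text \<open>Representatives (functions in \<open>D_\<tau>\<close>) of elements of \<open>T_max\<close>, and \<open>T_max\<close> itself.\<close>
definition Tmax_raw :: "real set \<Rightarrow> real measure \<Rightarrow> smeasure \<Rightarrow> smeasure \<Rightarrow> real \<Rightarrow> rel" where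
  "Tmax_raw I rho sig chi c = {(f, g). L2 I rho f \<and> L2 I rho g \<and> tau_rel I rho sig chi c f g}"

definition Tmax :: "real set \<Rightarrow> real measure \<Rightarrow> smeasure \<Rightarrow> smeasure \<Rightarrow> real \<Rightarrow> rel" where
  "Tmax I rho sig chi c = sat I rho (Tmax_raw I rho sig chi c)"

definition in_Tmax :: "real set \<Rightarrow> real measure \<Rightarrow> smeasure \<Rightarrow> smeasure \<Rightarrow> real
    \<Rightarrow> (real \<Rightarrow> complex) \<Rightarrow> bool" where
  "in_Tmax I rho sig chi c w \<longleftrightarrow> (\<exists>g. (w, g) \<in> Tmax_raw I rho sig chi c)"

definition lc_left :: "real set \<Rightarrow> real measure \<Rightarrow> smeasure \<Rightarrow> smeasure \<Rightarrow> real \<Rightarrow> bool" where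
  "lc_left I rho sig chi c \<longleftrightarrow> (\<forall>(z::complex) u. tau_rel I rho sig chi c u (\<lambda>x. z * u x) \<longrightarrow>
      (\<exists>d\<in>I. set_integrable rho {x\<in>I. x < d} (\<lambda>x. (cmod (u x))\<^sup>2)))"

definition lc_right :: "real set \<Rightarrow> real measure \<Rightarrow> smeasure \<Rightarrow> smeasure \<Rightarrow> real \<Rightarrow> bool" where
  "lc_right I rho sig chi c \<longleftrightarrow> (\<forall>(z::complex) u. tau_rel I rho sig chi c u (\<lambda>x. z * u x) \<longrightarrow>
      (\<exists>d\<in>I. set_integrable rho {x\<in>I. d < x} (\<lambda>x. (cmod (u x))\<^sup>2)))"

definition bc_rel :: "real set \<Rightarrow> real measure \<Rightarrow> smeasure \<Rightarrow> smeasure \<Rightarrow> real \<Rightarrow> real filter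
    \<Rightarrow> (real \<Rightarrow> complex) \<Rightarrow> (real \<Rightarrow> complex) \<Rightarrow> real \<Rightarrow> rel" where
  "bc_rel I rho sig chi c Fe w1 w2 phi = sat I rho
     {(f, g) \<in> Tmax_raw I rho sig chi c.
        wr_end I rho sig chi c Fe f (\<lambda>x. cnj (w2 x)) * complex_of_real (cos phi)
        - wr_end I rho sig chi c Fe (\<lambda>x. cnj (w1 x)) f * complex_of_real (sin phi) = 0}"

definition sl_hyps :: "ereal \<Rightarrow> ereal \<Rightarrow> real measure \<Rightarrow> smeasure \<Rightarrow> smeasure \<Rightarrow> real \<Rightarrow> bool" where
  "sl_hyps a b rho sig chi c \<longleftrightarrow> (let I = ivl a b in
     a < b \<and> c \<in> I \<and>
     loc_finite I rho \<and>
     real_lf_measure I chi \<and>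
     real_lf_measure I sig \<and> ssupp I sig = I \<and>
     (\<forall>x\<in>I. smeas_pt sig x * smeas_pt chi x = 0 \<and> smeas_pt sig x * measure rho {x} = 0) \<and>
     (\<forall>\<alpha> \<beta> f. \<alpha> \<in> ssupp I (pos_measure rho) \<and> \<beta> \<in> ssupp I (pos_measure rho) \<and> \<alpha> < \<beta> \<and>
        {\<alpha><..<\<beta>} \<inter> ssupp I (pos_measure rho) = {} \<and>
        in_Dtau I rho sig chi c f \<and> (f \<longlongrightarrow> 0) (at_left \<alpha>) \<and> (f \<longlongrightarrow> 0) (at_right \<beta>)
        \<longrightarrow> (\<forall>x\<in>{\<alpha><..<\<beta>}. f x = 0)) \<and>
     (\<exists>x y. x \<in> ssupp I (pos_measure rho) \<and> y \<in> ssupp I (pos_measure rho) \<and> x \<noteq> y))"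

end

theory Submission
  imports Defs
begin

text \<open>Write \<open>\<tau>f = g\<close> as a first-order system for \<open>f\<close> and \<open>p = f\<^sup>[\<^sup>1\<^sup>]\<close>. Since \<open>\<sigma>\<close> has no atom in common with
\<open>\<chi>\<close> or \<open>\<rho>\<close>, integration by parts yields the Lagrange identity without correction terms, and Picard
iteration solves the system. At the limit-point end the boundary Wronskian vanishes: if \<open>W(f,u)\<close> had a
nonzero limit there, \<open>w W(f,u) = f W(w,u) - u W(w,f)\<close> and a Gronwall argument would make every solution \<open>w\<close>
of every \<open>\<tau>w = zw\<close> square-integrable. Hence Green's formula only involves the other end, where by the
Pluecker identity it is the form \<open>BC\<^sup>1(f) BC\<^sup>2(h)\<^sup>* - BC\<^sup>2(f) BC\<^sup>1(h)\<^sup>*\<close> on the boundary values. Self-adjoint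
restrictions correspond to the subspaces of \<open>\<complex>\<^sup>2\<close> equal to their own complement for this form, which are the
lines spanned by \<open>(sin \<phi>, cos \<phi>)\<close>; that the adjoint of such a restriction lies in the maximal relation
follows by testing with compactly supported solutions.\<close>

text \<open>Boundary values belong to functions in the domain of \<open>\<tau>\<close>, whereas a
  relation in the Hilbert space only knows classes modulo \<open>rho\<close>-null sets. Every
  relation is therefore described by the pairs in it that satisfy the equation literally, and
  \<open>sat\<close> closes up afterwards; the linear algebra on boundary values never leaves these
  representatives. Their quasi-derivative is picked by a choice operator, so its uniqueness has to
  come before any use of a Wronskian. The limit-point hypothesis denies square-integrability for
  some \<open>z\<close> and some solution only. This is why the bound that contradicts a nonzero
  boundary Wronskian is derived for arbitrary \<open>z\<close>, with weights that contain
  \<open>z\<close>. The test functions for the adjoint come from solvability: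
  \<open>\<tau>u = k\<close> has a compactly supported solution once the compactly supported
  \<open>k\<close> is orthogonal to two independent solutions of \<open>\<tau>u = 0\<close>. The
  membership question is thereby reduced to functionals that vanish on the common kernel of two
  others.\<close>

section \<open>Fubini on a triangle and integration by parts\<close>

text \<open>A finite measure has only countably many atoms, so the atoms of \<open>M\<close> form a
  countable union of \<open>N\<close>-null singletons.\<close>

lemma AE_measure_singleton_eq_0:
  fixes M N :: "real measure"
  assumes "finite_measure M" and sets: "sets M = sets borel" "sets N = sets borel"
    and na: "\<And>x. measure M {x} = 0 \<or> emeasure N {x} = 0"
  shows "AE x in N. measure M {x} = 0"
proof -
  have c: "countable {x. measure M {x} \<noteq> 0}"
    using finite_measure.countable_support[OF assms(1)] .
  have "(\<Union>x\<in>{x. measure M {x} \<noteq> 0}. {x}) \<in> null_sets N"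
    using na sets by (intro null_sets_UN' c) (auto simp: null_sets_def)
  then have "{x. measure M {x} \<noteq> 0} \<in> null_sets N" by simp
  then show ?thesis
    by (rule AE_I') auto
qed

text \<open>Fubini for the product, cut along the diagonal. Strict inequalities in both inner
  integrals make the formula symmetric; the absence of common atoms pays for the diagonal, which
  would otherwise belong to one of the two triangles.\<close>

lemma triangle_product_finite:
  fixes M N :: "real measure" and f g :: "real \<Rightarrow> complex"
  assumes fin: "finite_measure M" "finite_measure N"
    and [measurable_cong]: "sets M = sets borel" "sets N = sets borel"
    and f: "integrable M f" and g: "integrable N g"
    and na: "\<And>x. measure M {x} = 0 \<or> emeasure N {x} = 0"
  shows "(LINT x|M. f x) * (LINT y|N. g y) =
    (LINT x|M. f x * (LINT y:{..<x}|N. g y)) + (LINT y|N. (LINT x:{..<y}|M. f x) * g y)"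
proof -
  interpret M: finite_measure M by fact
  interpret N: finite_measure N by fact
  interpret P: pair_sigma_finite M N ..
  note [measurable] = borel_measurable_integrable[OF f] borel_measurable_integrable[OF g]
  define H where "H = (\<lambda>(x::real, y::real). f x * g y)"
  have H: "integrable (M \<Otimes>\<^sub>M N) H"
  proof (rule P.Fubini_integrable)
    show "H \<in> borel_measurable (M \<Otimes>\<^sub>M N)" unfolding H_def by measurable
    show "integrable M (\<lambda>x. LINT y|N. norm (H (x, y)))"
      using f by (simp add: H_def norm_mult)
    show "AE x in M. integrable N (\<lambda>y. H (x, y))"
      using g by (simp add: H_def)
  qed
  have s1: "{p \<in> space (M \<Otimes>\<^sub>M N). snd p < fst p} \<in> sets (M \<Otimes>\<^sub>M N)" by measurable
  have s2: "{p \<in> space (M \<Otimes>\<^sub>M N). fst p \<le> snd p} \<in> sets (M \<Otimes>\<^sub>M N)" by measurable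
  have sp: "space M = UNIV" "space N = UNIV"
    using assms(3,4) by (metis sets_eq_imp_space_eq space_borel)+
  define H1 where "H1 = (\<lambda>p. indicat_real {p. snd p < fst p} p *\<^sub>R H p)"
  define H2 where "H2 = (\<lambda>p. indicat_real {p. fst p \<le> snd p} p *\<^sub>R H p)"
  have H1: "integrable (M \<Otimes>\<^sub>M N) (\<lambda>(x,y). H1 (x,y))" unfolding case_prod_eta unfolding H1_def
    using s1 by (intro integrable_mult_indicator H) (auto simp: space_pair_measure sp)
  have H2: "integrable (M \<Otimes>\<^sub>M N) (\<lambda>(x,y). H2 (x,y))" unfolding case_prod_eta unfolding H2_def
    using s2 by (intro integrable_mult_indicator H) (auto simp: space_pair_measure sp)
  have "(LINT x|M. f x) * (LINT y|N. g y) = (LINT x|M. LINT y|N. H (x, y))"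
    by (simp add: H_def)
  also have "\<dots> = integral\<^sup>L (M \<Otimes>\<^sub>M N) H" by (rule P.integral_fst'[OF H])
  also have "\<dots> = integral\<^sup>L (M \<Otimes>\<^sub>M N) (\<lambda>p. H1 p + H2 p)"
    by (intro Bochner_Integration.integral_cong) (auto simp: H1_def H2_def indicator_def)
  also have "\<dots> = integral\<^sup>L (M \<Otimes>\<^sub>M N) (\<lambda>(x,y). H1 (x,y)) + integral\<^sup>L (M \<Otimes>\<^sub>M N) (\<lambda>(x,y). H2 (x,y))"
    using Bochner_Integration.integral_add[OF H1 H2] by (simp add: case_prod_eta)
  also have "integral\<^sup>L (M \<Otimes>\<^sub>M N) (\<lambda>(x,y). H1 (x,y)) = (LINT x|M. LINT y|N. H1 (x, y))"
    by (rule P.integral_fst[OF H1, symmetric])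
  also have "\<dots> = (LINT x|M. f x * (LINT y:{..<x}|N. g y))"
  proof (rule Bochner_Integration.integral_cong[OF refl])
    fix x
    have "(LINT y|N. H1 (x, y)) = (LINT y|N. f x * (indicator {..<x} y *\<^sub>R g y))"
      by (intro Bochner_Integration.integral_cong) (auto simp: H1_def H_def indicator_def)
    then show "(LINT y|N. H1 (x, y)) = f x * (LINT y:{..<x}|N. g y)"
      by (simp only: set_lebesgue_integral_def integral_mult_right_zero)
  qed
  also have "integral\<^sup>L (M \<Otimes>\<^sub>M N) (\<lambda>(x,y). H2 (x,y)) = (LINT y|N. LINT x|M. H2 (x, y))"
    by (rule P.integral_snd[OF H2, symmetric])
  also have "\<dots> = (LINT y|N. (LINT x:{..<y}|M. f x) * g y)"
  proof (rule Bochner_Integration.integral_cong_AE)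
    show "(\<lambda>y. LINT x|M. H2 (x, y)) \<in> borel_measurable N"
      unfolding H2_def H_def by measurable
    show "(\<lambda>y. (LINT x:{..<y}|M. f x) * g y) \<in> borel_measurable N"
    proof -
      have "(\<lambda>y. (LINT x|M. (if x < y then f x else 0)) * g y) \<in> borel_measurable N" by measurable
      also have "(\<lambda>y. (LINT x|M. (if x < y then f x else 0)) * g y) = (\<lambda>y. (LINT x:{..<y}|M. f x) * g y)"
        unfolding set_lebesgue_integral_def
        by (intro ext arg_cong2[where f="(*)"] Bochner_Integration.integral_cong) auto
      finally show ?thesis .
    qed
    \<comment> \<open>For \<open>N\<close>-almost every \<open>y\<close> the point \<open>y\<close>
      carries no \<open>M\<close>-mass, so the closed triangle gives the same inner integral as the
      open one.\<close>
    have "AE y in N. measure M {y} = 0"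
      using AE_measure_singleton_eq_0[OF fin(1) assms(3,4) na] .
    then show "AE y in N. (LINT x|M. H2 (x, y)) = (LINT x:{..<y}|M. f x) * g y"
    proof eventually_elim
      case (elim y)
      then have e: "emeasure M {y} = 0" by (simp add: M.emeasure_eq_measure)
      have "{y} \<in> null_sets M" using e assms(3) by (auto simp: null_sets_def)
      then have "AE x in M. x \<notin> {y}" by (rule AE_not_in)
      then have ae: "AE x in M. H2 (x, y) = (indicator {..<y} x *\<^sub>R f x) * g y"
        by eventually_elim (auto simp: H2_def H_def indicator_def)
      have "(LINT x|M. H2 (x, y)) = (LINT x|M. (indicator {..<y} x *\<^sub>R f x) * g y)"
      proof (rule Bochner_Integration.integral_cong_AE[OF _ _ ae])
        have "(\<lambda>x. indicat_real {..y} x *\<^sub>R (f x * g y)) \<in> borel_measurable M" by measurable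
        also have "(\<lambda>x. indicat_real {..y} x *\<^sub>R (f x * g y)) = (\<lambda>x. H2 (x, y))"
          by (auto simp: H2_def H_def indicator_def)
        finally show "(\<lambda>x. H2 (x, y)) \<in> borel_measurable M" .
      qed measurable
      then show ?case by (simp only: set_lebesgue_integral_def integral_mult_left_zero)
    qed
  qed
  finally show ?thesis .
qed

text \<open>The measures of the problem are only locally finite, while Fubini is applied to finite
  ones. Cutting down by a density keeps the whole line as the underlying space, so no subspace
  measures appear.\<close>

lemma set_integral_density_indicator:
  fixes f :: "real \<Rightarrow> complex"
  assumes [measurable_cong]: "sets M = sets borel" and [measurable]: "A \<in> sets borel" "B \<in> sets borel"
    and fm: "set_borel_measurable borel A f" and sub: "B \<subseteq> A"
  shows "set_lebesgue_integral (density M (\<lambda>x. ennreal (indicator A x))) B f = set_lebesgue_integral M B f"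
    and "set_integrable (density M (\<lambda>x. ennreal (indicator A x))) B f = set_integrable M B f"
proof -
  have "(\<lambda>x. indicat_real B x *\<^sub>R (indicat_real A x *\<^sub>R f x)) \<in> borel_measurable borel"
    using fm unfolding set_borel_measurable_def by measurable
  also have "(\<lambda>x. indicat_real B x *\<^sub>R (indicat_real A x *\<^sub>R f x)) = (\<lambda>x. indicat_real B x *\<^sub>R f x)"
    using sub by (auto simp: fun_eq_iff indicator_def)
  finally have [measurable]: "(\<lambda>x. indicat_real B x *\<^sub>R f x) \<in> borel_measurable M"
    by (simp add: measurable_cong_sets[OF assms(1) refl])
  have e: "(indicat_real A x * indicat_real B x) *\<^sub>R f x = indicat_real B x *\<^sub>R f x" for x
    using sub by (auto simp: indicator_def)
  show "set_lebesgue_integral (density M (\<lambda>x. ennreal (indicator A x))) B f = set_lebesgue_integral M B f"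
    unfolding set_lebesgue_integral_def by (subst integral_density) (simp_all add: e)
  show "set_integrable (density M (\<lambda>x. ennreal (indicator A x))) B f = set_integrable M B f"
    unfolding set_integrable_def by (subst integrable_density) (simp_all add: e)
qed

lemma finite_measure_density_indicator:
  assumes "sets M = sets borel" "A \<in> sets borel" "emeasure M A < \<infinity>"
  shows "finite_measure (density M (\<lambda>x. ennreal (indicator A x)))"
proof (rule finite_measureI)
  have sp: "space M = UNIV" using assms(1) by (metis sets_eq_imp_space_eq space_borel)
  have "emeasure (density M (\<lambda>x. ennreal (indicator A x))) UNIV = emeasure M A"
    using assms by (subst emeasure_density) (auto simp: ennreal_indicator sp)
  then show "emeasure (density M (\<lambda>x. ennreal (indicator A x))) (space (density M (\<lambda>x. ennreal (indicator A x)))) \<noteq> \<infinity>"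
    using assms sp by simp
qed

text \<open>Measurability of an integral in its parameter is available for sigma-finite measures,
  hence the detour through the cut-down measure \<open>M'\<close>.\<close>

lemma set_integral_primitive_measurable:
  fixes f :: "real \<Rightarrow> complex"
  assumes [measurable_cong]: "sets M = sets borel"
    and fin: "emeasure M {x..<y} < \<infinity>" and f: "set_borel_measurable borel {x..<y} f"
  shows "set_borel_measurable borel {x..y} (\<lambda>t. LINT s:{x..<t}|M. f s)"
proof -
  define M' where "M' = density M (\<lambda>s. ennreal (indicator {x..<y} s))"
  interpret finite_measure M' unfolding M'_def
    by (rule finite_measure_density_indicator) (use fin assms(1) in auto)
  have [measurable_cong]: "sets M' = sets borel" by (simp add: M'_def assms(1))
  have [measurable]: "(\<lambda>s. indicat_real {x..<y} s *\<^sub>R f s) \<in> borel_measurable M'"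
    using f by (simp add: set_borel_measurable_def measurable_cong_sets[OF \<open>sets M' = sets borel\<close> refl])
  have "(\<lambda>t. LINT s|M'. (if s < t then indicat_real {x..<y} s *\<^sub>R f s else 0)) \<in> borel_measurable borel"
    by measurable
  also have "(\<lambda>t. LINT s|M'. (if s < t then indicat_real {x..<y} s *\<^sub>R f s else 0)) =
      (\<lambda>t. LINT s|M'. indicat_real {..<t} s *\<^sub>R (indicat_real {x..<y} s *\<^sub>R f s))"
    by (intro ext Bochner_Integration.integral_cong) auto
  finally have m: "(\<lambda>t. LINT s|M'. indicat_real {..<t} s *\<^sub>R (indicat_real {x..<y} s *\<^sub>R f s)) \<in> borel_measurable borel" .
  have e: "(LINT s|M'. indicat_real {..<t} s *\<^sub>R (indicat_real {x..<y} s *\<^sub>R f s)) = (LINT s:{x..<t}|M. f s)"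
    if t: "t \<in> {x..y}" for t
  proof -
    have "(LINT s|M'. indicat_real {..<t} s *\<^sub>R (indicat_real {x..<y} s *\<^sub>R f s)) = (LINT s:{x..<t}|M'. f s)"
      unfolding set_lebesgue_integral_def using t
      by (intro Bochner_Integration.integral_cong) (auto simp: indicator_def)
    also have "\<dots> = (LINT s:{x..<t}|M. f s)" unfolding M'_def
      using t by (intro set_integral_density_indicator f assms(1)) auto
    finally show ?thesis .
  qed
  have "(\<lambda>t. indicat_real {x..y} t *\<^sub>R (LINT s|M'. indicat_real {..<t} s *\<^sub>R (indicat_real {x..<y} s *\<^sub>R f s))) \<in> borel_measurable borel"
    using m by measurable
  also have "(\<lambda>t. indicat_real {x..y} t *\<^sub>R (LINT s|M'. indicat_real {..<t} s *\<^sub>R (indicat_real {x..<y} s *\<^sub>R f s)))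
      = (\<lambda>t. indicat_real {x..y} t *\<^sub>R (LINT s:{x..<t}|M. f s))"
    using e by (auto simp: fun_eq_iff indicator_def)
  finally show ?thesis by (simp add: set_borel_measurable_def)
qed

text \<open>Integration by parts; with left-closed intervals and left-continuous primitives no
boundary corrections occur as long as the two measures have no common atoms.\<close>
lemma triangle_product_interval:
  fixes M N :: "real measure" and f g :: "real \<Rightarrow> complex"
  assumes sM: "sets M = sets borel" and sN: "sets N = sets borel"
    and fin: "emeasure M {x..<y} < \<infinity>" "emeasure N {x..<y} < \<infinity>"
    and f: "set_integrable M {x..<y} f" and g: "set_integrable N {x..<y} g"
    and na: "\<And>t. t \<in> {x..<y} \<Longrightarrow> measure M {t} = 0 \<or> measure N {t} = 0"
  shows "(LINT s:{x..<y}|M. f s) * (LINT s:{x..<y}|N. g s) =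
    (LINT s:{x..<y}|M. f s * (LINT t:{x..<s}|N. g t)) + (LINT t:{x..<y}|N. (LINT s:{x..<t}|M. f s) * g t)"
proof -
  define A where "A = {x..<y}"
  define M' where "M' = density M (\<lambda>s. ennreal (indicator A s))"
  define N' where "N' = density N (\<lambda>s. ennreal (indicator A s))"
  have A[measurable]: "A \<in> sets borel" by (simp add: A_def)
  have fm: "set_borel_measurable borel A f" and gm: "set_borel_measurable borel A g"
    using f g sM sN unfolding A_def set_integrable_def set_borel_measurable_def
    by (auto dest!: borel_measurable_integrable simp: measurable_cong_sets[OF sM refl] measurable_cong_sets[OF sN refl])
  define f' g' where "f' = (\<lambda>s. indicat_real A s *\<^sub>R f s)" and "g' = (\<lambda>s. indicat_real A s *\<^sub>R g s)"
  have fin': "finite_measure M'" "finite_measure N'"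
    unfolding M'_def N'_def by (intro finite_measure_density_indicator; use fin sM sN A A_def in simp)+
  have s': "sets M' = sets borel" "sets N' = sets borel" by (simp_all add: M'_def N'_def sM sN)
  have f': "integrable M' f'" and g': "integrable N' g'"
    using set_integral_density_indicator(2)[OF sM A A fm] set_integral_density_indicator(2)[OF sN A A gm] f g
    unfolding f'_def g'_def M'_def N'_def A_def set_integrable_def by auto
  have cong: "integral\<^sup>L (density K (\<lambda>s. ennreal (indicator A s))) (\<lambda>s. indicat_real A s *\<^sub>R h s) = (LINT s:A|K. h s)"
    if "sets K = sets borel" "set_borel_measurable borel A h" for K and h :: "real \<Rightarrow> complex"
    using set_integral_density_indicator(1)[OF that(1) A A that(2)] by (simp add: set_lebesgue_integral_def)
  have in1: "(LINT t:{..<s}|N'. g' t) = (LINT t:{x..<s}|N. g t)" if "s \<in> A" for s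
  proof -
    have "(LINT t:{..<s}|N'. g' t) = (LINT t:{x..<s}|N'. g t)"
      using that unfolding set_lebesgue_integral_def g'_def A_def
      by (intro Bochner_Integration.integral_cong) (auto simp: indicator_def)
    also have "\<dots> = (LINT t:{x..<s}|N. g t)" unfolding N'_def
      using that by (intro set_integral_density_indicator sN A gm) (auto simp: A_def)
    finally show ?thesis .
  qed
  have in2: "(LINT t:{..<s}|M'. f' t) = (LINT t:{x..<s}|M. f t)" if "s \<in> A" for s
  proof -
    have "(LINT t:{..<s}|M'. f' t) = (LINT t:{x..<s}|M'. f t)"
      using that unfolding set_lebesgue_integral_def f'_def A_def
      by (intro Bochner_Integration.integral_cong) (auto simp: indicator_def)
    also have "\<dots> = (LINT t:{x..<s}|M. f t)" unfolding M'_def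
      using that by (intro set_integral_density_indicator sM A fm) (auto simp: A_def)
    finally show ?thesis .
  qed
  have mN: "set_borel_measurable borel A (\<lambda>s. LINT t:{x..<s}|N. g t)"
    and mM: "set_borel_measurable borel A (\<lambda>s. LINT t:{x..<s}|M. f t)"
    by (rule set_borel_measurable_subset[OF set_integral_primitive_measurable[OF sN fin(2)]]
             set_borel_measurable_subset[OF set_integral_primitive_measurable[OF sM fin(1)]],
        use fm gm A_def in auto)+
  \<comment> \<open>Cutting down creates no atoms: point masses are kept inside \<open>A\<close> and
    vanish outside.\<close>
  have na': "measure M' {t} = 0 \<or> emeasure N' {t} = 0" for t
  proof (cases "t \<in> A")
    case True
    have "measure M' {t} = measure M {t}" "measure N' {t} = measure N {t}"
      using True sM sN A unfolding M'_def N'_def measure_def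
      by (subst emeasure_density; auto simp: ennreal_indicator nn_integral_cmult_indicator indicator_inter_arith[symmetric])+
    then show ?thesis using na[of t] True fin'(2) by (auto simp: A_def finite_measure.emeasure_eq_measure)
  next
    case False
    then have "emeasure N' {t} = 0"
      using sN A unfolding N'_def by (subst emeasure_density) (auto simp: ennreal_indicator indicator_inter_arith[symmetric])
    then show ?thesis ..
  qed
  have pm: "set_borel_measurable borel A (\<lambda>s. h s * k s)"
    if "set_borel_measurable borel A h" "set_borel_measurable borel A k" for h k :: "real \<Rightarrow> complex"
  proof -
    have "(\<lambda>s. (indicat_real A s *\<^sub>R h s) * (indicat_real A s *\<^sub>R k s)) \<in> borel_measurable borel"
      using that unfolding set_borel_measurable_def by measurable
    also have "(\<lambda>s. (indicat_real A s *\<^sub>R h s) * (indicat_real A s *\<^sub>R k s)) = (\<lambda>s. indicat_real A s *\<^sub>R (h s * k s))"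
      by (auto simp: indicator_def fun_eq_iff)
    finally show ?thesis by (simp add: set_borel_measurable_def)
  qed
  have "(LINT s:A|M. f s) * (LINT s:A|N. g s) = (LINT x|M'. f' x) * (LINT y|N'. g' y)"
    unfolding f'_def g'_def M'_def N'_def using cong[OF sM fm] cong[OF sN gm] by simp
  also have "\<dots> = (LINT x|M'. f' x * (LINT y:{..<x}|N'. g' y)) + (LINT y|N'. (LINT x:{..<y}|M'. f' x) * g' y)"
    by (rule triangle_product_finite[OF fin' s' f' g' na'])
  also have "(LINT x|M'. f' x * (LINT y:{..<x}|N'. g' y)) = (LINT s|M'. indicat_real A s *\<^sub>R (f s * (LINT t:{x..<s}|N. g t)))"
    using in1 by (intro Bochner_Integration.integral_cong) (auto simp: f'_def indicator_def)
  also have "\<dots> = (LINT s:A|M. f s * (LINT t:{x..<s}|N. g t))"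
    unfolding M'_def by (rule cong[OF sM pm[OF fm mN]])
  also have "(LINT y|N'. (LINT x:{..<y}|M'. f' x) * g' y) = (LINT s|N'. indicat_real A s *\<^sub>R ((LINT t:{x..<s}|M. f t) * g s))"
    using in2 by (intro Bochner_Integration.integral_cong) (auto simp: g'_def indicator_def)
  also have "\<dots> = (LINT s:A|N. (LINT t:{x..<s}|M. f t) * g s)"
    unfolding N'_def by (rule cong[OF sN pm[OF mM gm]])
  finally show ?thesis by (simp add: A_def)
qed

section \<open>Picard iteration for finite measures\<close>

text \<open>The mass of the ordered chains \<open>s \<le> t1 < ... < tn < x\<close>, each point
  being integrated against the sum of all \<open>\<mu> i\<close>. Up to a constant it majorizes the
  \<open>n\<close>-th increment of the Picard iteration.\<close>

primrec iter_int :: "('i \<Rightarrow> real measure) \<Rightarrow> 'i set \<Rightarrow> real \<Rightarrow> nat \<Rightarrow> real \<Rightarrow> ennreal" where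
  "iter_int \<mu> F s 0 x = 1"
| "iter_int \<mu> F s (Suc n) x = (\<Sum>i\<in>F. \<integral>\<^sup>+t. iter_int \<mu> F s n t * indicator {s..<x} t \<partial>\<mu> i)"

lemma borel_measurable_nn_primitive:
  fixes M :: "real measure"
  assumes "finite_measure M" and [measurable_cong]: "sets M = sets borel"
    and [measurable]: "f \<in> borel_measurable borel"
  shows "(\<lambda>x. \<integral>\<^sup>+t. f t * indicator {s..<x} t \<partial>M) \<in> borel_measurable borel"
proof -
  interpret finite_measure M by fact
  have "(\<lambda>x. \<integral>\<^sup>+t. (if s \<le> t \<and> t < x then f t else 0) \<partial>M) \<in> borel_measurable borel"
    by measurable
  also have "(\<lambda>x. \<integral>\<^sup>+t. (if s \<le> t \<and> t < x then f t else 0) \<partial>M) = (\<lambda>x. \<integral>\<^sup>+t. f t * indicator {s..<x} t \<partial>M)"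
    by (intro ext nn_integral_cong) (auto simp: indicator_def)
  finally show ?thesis .
qed

text \<open>The two iterated integrals live on the disjoint parts \<open>r < t\<close> and
  \<open>t < r\<close> of a square. Only the diagonal is missing, so common atoms cost nothing but
  equality.\<close>

lemma nn_triangle_product_le:
  fixes M N :: "real measure"
  assumes fin: "finite_measure M" "finite_measure N"
    and [measurable_cong]: "sets M = sets borel" "sets N = sets borel"
    and [measurable]: "f \<in> borel_measurable borel"
  shows "(\<integral>\<^sup>+t. f t * (\<integral>\<^sup>+r. indicator {s..<t} r \<partial>M) * indicator {s..<x} t \<partial>N)
      + (\<integral>\<^sup>+r. (\<integral>\<^sup>+t. f t * indicator {s..<r} t \<partial>N) * indicator {s..<x} r \<partial>M)
    \<le> (\<integral>\<^sup>+r. indicator {s..<x} r \<partial>M) * (\<integral>\<^sup>+t. f t * indicator {s..<x} t \<partial>N)"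
proof -
  interpret M: finite_measure M by fact
  interpret N: finite_measure N by fact
  interpret P: pair_sigma_finite N M ..
  define J where "J = (\<lambda>t r. if s \<le> t \<and> t < r \<and> r < x then f t else 0)"
  define L where "L = (\<lambda>t r. if s \<le> r \<and> r < t \<and> t < x then f t else 0)"
  have [measurable]: "case_prod J \<in> borel_measurable (borel \<Otimes>\<^sub>M borel)"
    "case_prod L \<in> borel_measurable (borel \<Otimes>\<^sub>M borel)"
    unfolding J_def L_def by measurable
  have "(\<integral>\<^sup>+r. (\<integral>\<^sup>+t. f t * indicator {s..<r} t \<partial>N) * indicator {s..<x} r \<partial>M) = (\<integral>\<^sup>+r. \<integral>\<^sup>+t. J t r \<partial>N \<partial>M)"
  proof (rule nn_integral_cong)
    fix r
    have "(\<integral>\<^sup>+t. f t * indicator {s..<r} t \<partial>N) * indicator {s..<x} r = (\<integral>\<^sup>+t. f t * indicator {s..<r} t * indicator {s..<x} r \<partial>N)"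
      by (rule nn_integral_multc[symmetric]) measurable
    also have "\<dots> = (\<integral>\<^sup>+t. J t r \<partial>N)"
      by (intro nn_integral_cong) (auto simp: J_def indicator_def)
    finally show "(\<integral>\<^sup>+t. f t * indicator {s..<r} t \<partial>N) * indicator {s..<x} r = (\<integral>\<^sup>+t. J t r \<partial>N)" .
  qed
  also have "\<dots> = (\<integral>\<^sup>+t. \<integral>\<^sup>+r. J t r \<partial>M \<partial>N)"
    by (rule P.Fubini') measurable
  finally have 1: "(\<integral>\<^sup>+r. (\<integral>\<^sup>+t. f t * indicator {s..<r} t \<partial>N) * indicator {s..<x} r \<partial>M) = (\<integral>\<^sup>+t. \<integral>\<^sup>+r. J t r \<partial>M \<partial>N)" .
  have 2: "(\<integral>\<^sup>+t. f t * (\<integral>\<^sup>+r. indicator {s..<t} r \<partial>M) * indicator {s..<x} t \<partial>N) = (\<integral>\<^sup>+t. \<integral>\<^sup>+r. L t r \<partial>M \<partial>N)"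
  proof (rule nn_integral_cong)
    fix t
    have "f t * (\<integral>\<^sup>+r. indicator {s..<t} r \<partial>M) * indicator {s..<x} t = (\<integral>\<^sup>+r. f t * indicator {s..<t} r * indicator {s..<x} t \<partial>M)"
      by (subst nn_integral_cmult[symmetric], measurable, subst nn_integral_multc[symmetric], measurable)
    also have "\<dots> = (\<integral>\<^sup>+r. L t r \<partial>M)"
      by (intro nn_integral_cong) (auto simp: L_def indicator_def)
    finally show "f t * (\<integral>\<^sup>+r. indicator {s..<t} r \<partial>M) * indicator {s..<x} t = (\<integral>\<^sup>+r. L t r \<partial>M)" .
  qed
  have "(\<integral>\<^sup>+t. \<integral>\<^sup>+r. L t r \<partial>M \<partial>N) + (\<integral>\<^sup>+t. \<integral>\<^sup>+r. J t r \<partial>M \<partial>N) = (\<integral>\<^sup>+t. (\<integral>\<^sup>+r. L t r \<partial>M) + (\<integral>\<^sup>+r. J t r \<partial>M) \<partial>N)"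
    by (rule nn_integral_add[symmetric]) measurable
  also have "\<dots> = (\<integral>\<^sup>+t. (\<integral>\<^sup>+r. L t r + J t r \<partial>M) \<partial>N)"
    by (intro nn_integral_cong nn_integral_add[symmetric]) measurable
  also have "\<dots> \<le> (\<integral>\<^sup>+t. (\<integral>\<^sup>+r. f t * indicator {s..<x} t * indicator {s..<x} r \<partial>M) \<partial>N)"
    by (intro nn_integral_mono) (auto simp: L_def J_def indicator_def)
  also have "\<dots> = (\<integral>\<^sup>+r. indicator {s..<x} r \<partial>M) * (\<integral>\<^sup>+t. f t * indicator {s..<x} t \<partial>N)"
    by (simp add: nn_integral_cmult nn_integral_multc mult.commute)
  finally show ?thesis using 1 2 by simp
qed

locale finite_measure_family =
  fixes \<mu> :: "'i \<Rightarrow> real measure" and F :: "'i set" and s :: real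
  assumes finF: "finite F" and fin: "\<And>i. i \<in> F \<Longrightarrow> finite_measure (\<mu> i)"
    and sets: "\<And>i. i \<in> F \<Longrightarrow> sets (\<mu> i) = sets borel"
begin

abbreviation "e \<equiv> iter_int \<mu> F s"

lemma iter_int_measurable: "e n \<in> borel_measurable borel"
proof (induction n)
  case 0
  then show ?case by (simp add: fun_eq_iff cong: measurable_cong)
next
  case (Suc n)
  have "(\<lambda>x. \<Sum>i\<in>F. \<integral>\<^sup>+t. e n t * indicator {s..<x} t \<partial>\<mu> i) \<in> borel_measurable borel"
    by (intro borel_measurable_sum borel_measurable_nn_primitive fin sets Suc)
  then show ?case by (simp cong: measurable_cong)
qed

text \<open>A free point can be inserted into an ordered chain of \<open>n\<close> points at
  \<open>n + 1\<close> places, and each place yields an ordered chain of \<open>n + 1\<close>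
  points. Coincidences at atoms account for the inequality.\<close>

lemma iter_int_step: "of_nat (Suc n) * e (Suc n) x \<le> e 1 x * e n x"
proof (induction n arbitrary: x)
  case 0
  then show ?case by simp
next
  case (Suc n)
  note [measurable] = iter_int_measurable
  have i1: "e 1 t = (\<Sum>i\<in>F. \<integral>\<^sup>+r. indicator {s..<t} r \<partial>\<mu> i)" for t by simp
  have "of_nat (Suc n) * e (Suc (Suc n)) x = (\<Sum>j\<in>F. \<integral>\<^sup>+t. of_nat (Suc n) * (e (Suc n) t * indicator {s..<x} t) \<partial>\<mu> j)"
    unfolding iter_int.simps(2)[of \<mu> F s "Suc n"] sum_distrib_left
  proof (rule sum.cong[OF refl])
    fix j assume j: "j \<in> F"
    have [measurable_cong]: "sets (\<mu> j) = sets borel" using sets[OF j] .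
    show "of_nat (Suc n) * (\<integral>\<^sup>+t. e (Suc n) t * indicator {s..<x} t \<partial>\<mu> j) = (\<integral>\<^sup>+t. of_nat (Suc n) * (e (Suc n) t * indicator {s..<x} t) \<partial>\<mu> j)"
      by (rule nn_integral_cmult[symmetric]) measurable
  qed
  also have "\<dots> \<le> (\<Sum>j\<in>F. \<integral>\<^sup>+t. e n t * e 1 t * indicator {s..<x} t \<partial>\<mu> j)"
  proof (intro sum_mono nn_integral_mono)
    fix t
    show "of_nat (Suc n) * (e (Suc n) t * indicator {s..<x} t) \<le> e n t * e 1 t * indicator {s..<x} t"
      using mult_right_mono[OF Suc[of t], of "indicator {s..<x} t"] by (simp add: ac_simps)
  qed
  also have "\<dots> = (\<Sum>j\<in>F. \<Sum>i\<in>F. \<integral>\<^sup>+t. e n t * (\<integral>\<^sup>+r. indicator {s..<t} r \<partial>\<mu> i) * indicator {s..<x} t \<partial>\<mu> j)"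
  proof (rule sum.cong[OF refl])
    fix j assume j: "j \<in> F"
    have [measurable_cong]: "sets (\<mu> j) = sets borel" using sets[OF j] .
    have m: "(\<lambda>t. \<integral>\<^sup>+r. indicator {s..<t} r \<partial>\<mu> i) \<in> borel_measurable borel" if "i \<in> F" for i
      using borel_measurable_nn_primitive[OF fin[OF that] sets[OF that], of "\<lambda>_. 1" s] by simp
    have "(\<integral>\<^sup>+t. e n t * e 1 t * indicator {s..<x} t \<partial>\<mu> j) = (\<integral>\<^sup>+t. (\<Sum>i\<in>F. e n t * (\<integral>\<^sup>+r. indicator {s..<t} r \<partial>\<mu> i) * indicator {s..<x} t) \<partial>\<mu> j)"
      unfolding i1 by (simp only: sum_distrib_left sum_distrib_right)
    also have "\<dots> = (\<Sum>i\<in>F. \<integral>\<^sup>+t. e n t * (\<integral>\<^sup>+r. indicator {s..<t} r \<partial>\<mu> i) * indicator {s..<x} t \<partial>\<mu> j)"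
    proof (rule nn_integral_sum)
      fix i assume "i \<in> F"
      note [measurable] = m[OF this]
      show "(\<lambda>t. e n t * (\<integral>\<^sup>+r. indicator {s..<t} r \<partial>\<mu> i) * indicator {s..<x} t) \<in> borel_measurable (\<mu> j)"
        by measurable
    qed
    finally show "(\<integral>\<^sup>+t. e n t * e 1 t * indicator {s..<x} t \<partial>\<mu> j) = (\<Sum>i\<in>F. \<integral>\<^sup>+t. e n t * (\<integral>\<^sup>+r. indicator {s..<t} r \<partial>\<mu> i) * indicator {s..<x} t \<partial>\<mu> j)" .
  qed
  finally have A: "of_nat (Suc n) * e (Suc (Suc n)) x \<le> (\<Sum>j\<in>F. \<Sum>i\<in>F. \<integral>\<^sup>+t. e n t * (\<integral>\<^sup>+r. indicator {s..<t} r \<partial>\<mu> i) * indicator {s..<x} t \<partial>\<mu> j)" .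
  have B: "e (Suc (Suc n)) x = (\<Sum>j\<in>F. \<Sum>i\<in>F. \<integral>\<^sup>+r. (\<integral>\<^sup>+t. e n t * indicator {s..<r} t \<partial>\<mu> j) * indicator {s..<x} r \<partial>\<mu> i)"
  proof -
    have "e (Suc (Suc n)) x = (\<Sum>i\<in>F. \<integral>\<^sup>+r. (\<Sum>j\<in>F. (\<integral>\<^sup>+t. e n t * indicator {s..<r} t \<partial>\<mu> j) * indicator {s..<x} r) \<partial>\<mu> i)"
      by (simp add: sum_distrib_right)
    also have "\<dots> = (\<Sum>i\<in>F. \<Sum>j\<in>F. \<integral>\<^sup>+r. (\<integral>\<^sup>+t. e n t * indicator {s..<r} t \<partial>\<mu> j) * indicator {s..<x} r \<partial>\<mu> i)"
    proof (intro sum.cong refl nn_integral_sum)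
      fix i j assume "i \<in> F" and j: "j \<in> F"
      have [measurable_cong]: "sets (\<mu> i) = sets borel" using sets[OF \<open>i \<in> F\<close>] .
      have [measurable]: "(\<lambda>r. \<integral>\<^sup>+t. e n t * indicator {s..<r} t \<partial>\<mu> j) \<in> borel_measurable borel"
        by (intro borel_measurable_nn_primitive fin sets j) measurable
      show "(\<lambda>r. (\<integral>\<^sup>+t. e n t * indicator {s..<r} t \<partial>\<mu> j) * indicator {s..<x} r) \<in> borel_measurable (\<mu> i)"
        by measurable
    qed
    also have "\<dots> = (\<Sum>j\<in>F. \<Sum>i\<in>F. \<integral>\<^sup>+r. (\<integral>\<^sup>+t. e n t * indicator {s..<r} t \<partial>\<mu> j) * indicator {s..<x} r \<partial>\<mu> i)"
      by (rule sum.swap)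
    finally show ?thesis .
  qed
  \<comment> \<open>One copy is kept in the form \<open>B\<close>, where the free point is the
    outermost one; the other \<open>Suc n\<close> copies are bounded by \<open>A\<close>, where it
    lies below the outermost point of the chain. These are the two triangles of
    \<open>nn_triangle_product_le\<close>.\<close>
  have "of_nat (Suc (Suc n)) * e (Suc (Suc n)) x = of_nat (Suc n) * e (Suc (Suc n)) x + e (Suc (Suc n)) x"
    by (simp add: distrib_right del: iter_int.simps)
  also have "\<dots> \<le> (\<Sum>j\<in>F. \<Sum>i\<in>F. (\<integral>\<^sup>+t. e n t * (\<integral>\<^sup>+r. indicator {s..<t} r \<partial>\<mu> i) * indicator {s..<x} t \<partial>\<mu> j)
      + (\<integral>\<^sup>+r. (\<integral>\<^sup>+t. e n t * indicator {s..<r} t \<partial>\<mu> j) * indicator {s..<x} r \<partial>\<mu> i))"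
    using add_mono[OF A order.refl[of "e (Suc (Suc n)) x"]] B by (simp only: sum.distrib)
  also have "\<dots> \<le> (\<Sum>j\<in>F. \<Sum>i\<in>F. (\<integral>\<^sup>+r. indicator {s..<x} r \<partial>\<mu> i) * (\<integral>\<^sup>+t. e n t * indicator {s..<x} t \<partial>\<mu> j))"
    by (intro sum_mono nn_triangle_product_le fin sets iter_int_measurable)
  also have "\<dots> = e 1 x * e (Suc n) x"
    unfolding i1 iter_int.simps(2)[of \<mu> F s n] sum_product by (rule sum.swap)
  finally show ?case .
qed

text \<open>Each use of \<open>iter_int_step\<close> contributes a factor \<open>T\<close>, the
  total mass of the family, and a division by \<open>Suc n\<close>, which builds up the
  factorial.\<close>

lemma iter_int_le: "\<exists>T\<ge>0. \<forall>n x. e n x \<le> ennreal (T ^ n / fact n)"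
proof -
  define T where "T = (\<Sum>i\<in>F. measure (\<mu> i) (space (\<mu> i)))"
  have e1: "e 1 x \<le> ennreal T" for x
  proof -
    have "e 1 x = (\<Sum>i\<in>F. emeasure (\<mu> i) {s..<x})"
      using sets by simp
    also have "\<dots> \<le> (\<Sum>i\<in>F. ennreal (measure (\<mu> i) (space (\<mu> i))))"
      by (intro sum_mono) (metis emeasure_space finite_measure.emeasure_eq_measure fin)
    finally show ?thesis by (simp add: T_def)
  qed
  have T: "T \<ge> 0" unfolding T_def by (simp add: sum_nonneg)
  have "e n x \<le> ennreal (T ^ n / fact n)" for n x
  proof (induction n)
    case 0
    then show ?case by simp
  next
    case (Suc n)
    have "of_nat (Suc n) * e (Suc n) x \<le> ennreal T * ennreal (T ^ n / fact n)"
      using iter_int_step[of n x] e1[of x] Suc mult_mono[OF e1[of x] Suc] by (meson order.trans zero_le)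
    also have "\<dots> = ennreal (real (Suc n)) * ennreal (T ^ Suc n / fact (Suc n))"
      using T by (simp add: ennreal_mult[symmetric] del: of_nat_Suc)
    finally have "ennreal (real (Suc n)) * e (Suc n) x \<le> ennreal (real (Suc n)) * ennreal (T ^ Suc n / fact (Suc n))"
      by (simp add: ennreal_of_nat_eq_real_of_nat)
    then show ?case
      by (subst (asm) ennreal_mult_le_mult_iff) auto
  qed
  with T show ?thesis by blast
qed

end

definition fin_pair :: "smeasure \<Rightarrow> bool" where
  "fin_pair \<mu> \<longleftrightarrow> finite_measure (fst \<mu>) \<and> finite_measure (snd \<mu>) \<and>
     sets (fst \<mu>) = sets borel \<and> sets (snd \<mu>) = sets borel"

text \<open>The class in which the Picard iteration runs: it is stable under primitives and
  integrable against every finite measure, so no integrability has to be carried along.\<close>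

definition bd_meas :: "(real \<Rightarrow> complex) \<Rightarrow> bool" where
  "bd_meas f \<longleftrightarrow> f \<in> borel_measurable borel \<and> bounded (range f)"

lemma bd_measI: "f \<in> borel_measurable borel \<Longrightarrow> (\<And>x. cmod (f x) \<le> B) \<Longrightarrow> bd_meas f"
  by (auto simp: bd_meas_def bounded_iff)

lemma bd_meas_bound: "bd_meas f \<Longrightarrow> \<exists>B\<ge>0. \<forall>x. cmod (f x) \<le> B"
  unfolding bd_meas_def bounded_iff by (meson norm_ge_zero order.trans rangeI)

lemma bd_meas_add: "bd_meas f \<Longrightarrow> bd_meas g \<Longrightarrow> bd_meas (\<lambda>x. f x + g x)"
  unfolding bd_meas_def by (auto intro!: bounded_plus_comp[of f UNIV g, simplified])

lemma bd_meas_diff: "bd_meas f \<Longrightarrow> bd_meas g \<Longrightarrow> bd_meas (\<lambda>x. f x - g x)"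
  unfolding bd_meas_def by (auto intro!: bounded_minus_comp[of f UNIV g, simplified])

lemma bd_meas_const: "bd_meas (\<lambda>x. k)"
  by (rule bd_measI[of _ "cmod k"]) auto

lemma bd_meas_set_integrable:
  assumes "finite_measure M" "sets M = sets borel" "bd_meas f" "A \<in> sets borel"
  shows "set_integrable M A f"
proof -
  interpret finite_measure M by fact
  obtain B where B: "\<And>x. cmod (f x) \<le> B" using bd_meas_bound[OF assms(3)] by auto
  have "integrable M f"
    by (rule integrable_const_bound[of _ B])
       (use assms B in \<open>auto simp: bd_meas_def measurable_cong_sets[OF assms(2) refl]\<close>)
  then show ?thesis
    unfolding set_integrable_def using assms by (intro integrable_mult_indicator) auto
qed

lemma slint_bd_diff:
  assumes "fin_pair \<mu>" "bd_meas f" "bd_meas g" "A \<in> sets borel"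
  shows "slint \<mu> A f - slint \<mu> A g = slint \<mu> A (\<lambda>x. f x - g x)"
  using assms unfolding slint_def fin_pair_def
  by (auto simp: bd_meas_set_integrable)

lemma slint_primitive_bd_meas:
  assumes "fin_pair \<mu>" "bd_meas f"
  shows "bd_meas (\<lambda>x. slint \<mu> {s..<x} f)"
proof -
  interpret M1: finite_measure "fst \<mu>" using assms by (simp add: fin_pair_def)
  interpret M2: finite_measure "snd \<mu>" using assms by (simp add: fin_pair_def)
  have sets[measurable_cong]: "sets (fst \<mu>) = sets borel" "sets (snd \<mu>) = sets borel"
    using assms by (simp_all add: fin_pair_def)
  obtain B where B: "B \<ge> 0" "\<And>x. cmod (f x) \<le> B" using bd_meas_bound[OF assms(2)] by auto
  have f[measurable]: "f \<in> borel_measurable (fst \<mu>)" "f \<in> borel_measurable (snd \<mu>)"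
    using assms(2) unfolding bd_meas_def by (simp_all add: measurable_cong_sets[OF sets(1) refl] measurable_cong_sets[OF sets(2) refl])
  have "(\<lambda>x. (LINT t|fst \<mu>. (if s \<le> t \<and> t < x then f t else 0)) - (LINT t|snd \<mu>. (if s \<le> t \<and> t < x then f t else 0))) \<in> borel_measurable borel"
    by measurable
  also have "(\<lambda>x. (LINT t|fst \<mu>. (if s \<le> t \<and> t < x then f t else 0)) - (LINT t|snd \<mu>. (if s \<le> t \<and> t < x then f t else 0))) = (\<lambda>x. slint \<mu> {s..<x} f)"
    unfolding slint_def set_lebesgue_integral_def
    by (intro ext arg_cong2[where f="(-)"] Bochner_Integration.integral_cong) (auto simp: indicator_def)
  finally have m: "(\<lambda>x. slint \<mu> {s..<x} f) \<in> borel_measurable borel" .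
  have b: "cmod (LINT t:{s..<x}|M. f t) \<le> B * measure M (space M)" if "finite_measure M" "sets M = sets borel" for M x
  proof -
    interpret finite_measure M by fact
    have i: "integrable M (\<lambda>t. indicat_real {s..<x} t *\<^sub>R f t)"
      using bd_meas_set_integrable[OF that assms(2), of "{s..<x}"] by (simp add: set_integrable_def)
    have "cmod (LINT t:{s..<x}|M. f t) \<le> (LINT t|M. norm (indicat_real {s..<x} t *\<^sub>R f t))"
      unfolding set_lebesgue_integral_def by (rule integral_norm_bound)
    also have "\<dots> \<le> (LINT t|M. B)"
      by (rule integral_mono[OF integrable_norm[OF i]]) (use B in \<open>auto simp: indicator_def\<close>)
    finally show ?thesis by (simp add: mult.commute)
  qed
  show ?thesis
  proof (rule bd_measI[OF m])
    fix x
    show "cmod (slint \<mu> {s..<x} f) \<le> B * measure (fst \<mu>) (space (fst \<mu>)) + B * measure (snd \<mu>) (space (snd \<mu>))"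
      unfolding slint_def
      using b[of "fst \<mu>" x] b[of "snd \<mu>" x] assms(1) norm_triangle_ineq4 unfolding fin_pair_def
      by (smt (verit, best))
  qed
qed

lemma slint_bd_limit:
  assumes "fin_pair \<mu>" "\<And>n. bd_meas (f n)" "\<And>n x. cmod (f n x) \<le> B" "\<And>x. (\<lambda>n. f n x) \<longlonglongrightarrow> g x" "A \<in> sets borel"
  shows "(\<lambda>n. slint \<mu> A (f n)) \<longlonglongrightarrow> slint \<mu> A g"
proof -
  have "(\<lambda>n. LINT x:A|M. f n x) \<longlonglongrightarrow> (LINT x:A|M. g x)" if M: "finite_measure M" "sets M = sets borel" for M
  proof -
    interpret finite_measure M by fact
    note [measurable_cong] = M(2)
    have [measurable]: "A \<in> sets M" using assms M by simp
    have m[measurable]: "\<And>n. f n \<in> borel_measurable borel" using assms(2) by (simp add: bd_meas_def)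
    have [measurable]: "g \<in> borel_measurable borel"
      by (rule borel_measurable_LIMSEQ_metric[OF m assms(4)])
    show ?thesis unfolding set_lebesgue_integral_def
    proof (rule integral_dominated_convergence[where w = "\<lambda>_. B"])
      have "B \<ge> 0" using assms(3)[of 0 0] by (meson norm_ge_zero order.trans)
      then show "\<And>i. AE x in M. norm (indicat_real A x *\<^sub>R f i x) \<le> B"
        using assms(3) by (auto simp: indicator_def)
      show "AE x in M. (\<lambda>i. indicat_real A x *\<^sub>R f i x) \<longlonglongrightarrow> indicat_real A x *\<^sub>R g x"
        by (intro AE_I2 tendsto_intros assms(4))
    qed auto
  qed
  then show ?thesis
    unfolding slint_def using assms(1) by (intro tendsto_diff) (auto simp: fin_pair_def)
qed

text \<open>The density of \<open>\<sigma>\<close> is the second unknown, so Picard's iteration needs no smallness or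
invertibility condition on the atoms: left-continuity makes every step explicit.\<close>
lemma volterra_solution_exists:
  assumes \<sigma>: "fin_pair \<sigma>" and \<kappa>: "fin_pair \<kappa>" and G: "bd_meas G"
  shows "\<exists>u p. bd_meas u \<and> bd_meas p \<and>
    (\<forall>x. u x = \<alpha> + slint \<sigma> {s..<x} p) \<and> (\<forall>x. p x = G x + slint \<kappa> {s..<x} u)"
proof -
  \<comment> \<open>Both parts of both pairs enter one family, so that a single chain of iterated
    integrals majorizes the two unknowns at once.\<close>
  define \<mu> where "\<mu> = (\<lambda>i::nat. [fst \<sigma>, snd \<sigma>, fst \<kappa>, snd \<kappa>] ! i)"
  have I4: "{..<4} = {0, 1, 2, 3::nat}" by auto
  interpret finite_measure_family \<mu> "{..<4}" s
    using \<sigma> \<kappa> unfolding finite_measure_family_def I4 by (auto simp: \<mu>_def fin_pair_def)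
  have e_Suc: "e (Suc n) x = (\<integral>\<^sup>+t. e n t * indicator {s..<x} t \<partial>fst \<sigma>) + (\<integral>\<^sup>+t. e n t * indicator {s..<x} t \<partial>snd \<sigma>)
     + (\<integral>\<^sup>+t. e n t * indicator {s..<x} t \<partial>fst \<kappa>) + (\<integral>\<^sup>+t. e n t * indicator {s..<x} t \<partial>snd \<kappa>)" for n x
    by (simp add: I4 \<mu>_def ac_simps)
  have bnd: "ennreal (cmod (slint \<nu> {s..<x} d)) \<le> ennreal K * e (Suc n) x"
    if \<nu>: "\<nu> = \<sigma> \<or> \<nu> = \<kappa>" and d: "bd_meas d" and le: "\<And>t. ennreal (cmod (d t)) \<le> ennreal K * e n t" for \<nu> d K n x
  proof -
    have fp: "fin_pair \<nu>" using \<nu> \<sigma> \<kappa> by auto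
    have 1: "ennreal (cmod (LINT t:{s..<x}|M. d t)) \<le> ennreal K * (\<integral>\<^sup>+t. e n t * indicator {s..<x} t \<partial>M)"
      if M: "finite_measure M" "sets M = sets borel" for M
    proof -
      note [measurable_cong] = M(2)
      note [measurable] = iter_int_measurable
      have i: "integrable M (\<lambda>t. indicat_real {s..<x} t *\<^sub>R d t)"
        using bd_meas_set_integrable[OF M d, of "{s..<x}"] by (simp add: set_integrable_def)
      have "ennreal (cmod (LINT t:{s..<x}|M. d t)) \<le> (\<integral>\<^sup>+t. ennreal (norm (indicat_real {s..<x} t *\<^sub>R d t)) \<partial>M)"
        unfolding set_lebesgue_integral_def by (rule integral_norm_bound_ennreal[OF i])
      also have "\<dots> \<le> (\<integral>\<^sup>+t. ennreal K * (e n t * indicator {s..<x} t) \<partial>M)"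
        using le by (intro nn_integral_mono) (auto simp: indicator_def)
      also have "\<dots> = ennreal K * (\<integral>\<^sup>+t. e n t * indicator {s..<x} t \<partial>M)"
        by (rule nn_integral_cmult) measurable
      finally show ?thesis .
    qed
    have "ennreal (cmod (slint \<nu> {s..<x} d)) \<le> ennreal (cmod (LINT t:{s..<x}|fst \<nu>. d t) + cmod (LINT t:{s..<x}|snd \<nu>. d t))"
      unfolding slint_def by (intro ennreal_leI norm_triangle_ineq4)
    also have "\<dots> = ennreal (cmod (LINT t:{s..<x}|fst \<nu>. d t)) + ennreal (cmod (LINT t:{s..<x}|snd \<nu>. d t))"
      by (intro ennreal_plus) auto
    also have "\<dots> \<le> ennreal K * (\<integral>\<^sup>+t. e n t * indicator {s..<x} t \<partial>fst \<nu>) + ennreal K * (\<integral>\<^sup>+t. e n t * indicator {s..<x} t \<partial>snd \<nu>)"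
      using fp by (intro add_mono 1) (auto simp: fin_pair_def)
    also have "\<dots> = ennreal K * ((\<integral>\<^sup>+t. e n t * indicator {s..<x} t \<partial>fst \<nu>) + (\<integral>\<^sup>+t. e n t * indicator {s..<x} t \<partial>snd \<nu>))"
      by (simp add: distrib_left)
    also have "\<dots> \<le> ennreal K * e (Suc n) x"
    proof (rule mult_left_mono)
      have le: "x + y \<le> x + y + z + w" "z + w \<le> x + y + z + w" for x y z w :: ennreal
        by (metis add.assoc add.commute le_iff_add)+
      show "(\<integral>\<^sup>+t. e n t * indicator {s..<x} t \<partial>fst \<nu>) + (\<integral>\<^sup>+t. e n t * indicator {s..<x} t \<partial>snd \<nu>) \<le> e (Suc n) x"
        unfolding e_Suc using \<nu> le by auto
    qed simp
    finally show ?thesis .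
  qed
  define Y where "Y = rec_nat (\<lambda>x. 0::complex, \<lambda>x. 0::complex)
     (\<lambda>n Z. (\<lambda>x. \<alpha> + slint \<sigma> {s..<x} (snd Z), \<lambda>x. G x + slint \<kappa> {s..<x} (fst Z)))"
  define u where "u = (\<lambda>n. fst (Y n))"
  define p where "p = (\<lambda>n. snd (Y n))"
  have u0: "u 0 = (\<lambda>x. 0)" and p0: "p 0 = (\<lambda>x. 0)" by (simp_all add: u_def p_def Y_def)
  have uS: "u (Suc n) x = \<alpha> + slint \<sigma> {s..<x} (p n)" and pS: "p (Suc n) x = G x + slint \<kappa> {s..<x} (u n)" for n x
    by (simp_all add: u_def p_def Y_def)
  have bm: "bd_meas (u n) \<and> bd_meas (p n)" for n
  proof (induction n)
    case 0
    then show ?case by (simp add: u0 p0 bd_meas_const)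
  next
    case (Suc n)
    have "u (Suc n) = (\<lambda>x. \<alpha> + slint \<sigma> {s..<x} (p n))" "p (Suc n) = (\<lambda>x. G x + slint \<kappa> {s..<x} (u n))"
      by (auto simp: uS pS)
    then show ?case
      using Suc by (auto intro!: bd_meas_add bd_meas_const G slint_primitive_bd_meas \<sigma> \<kappa>)
  qed
  obtain B where B: "B \<ge> 0" "\<And>x. cmod (G x) \<le> B" using bd_meas_bound[OF G] by auto
  \<comment> \<open>The iteration starts from zero, so its first increments are
    \<open>\<alpha>\<close> and \<open>G\<close>. The constant bounds both, which starts the
    induction with \<open>e 0 x = 1\<close>.\<close>
  define K where "K = max B (cmod \<alpha>)"
  have K: "K \<ge> 0" "\<And>x. cmod (G x) \<le> K" "cmod \<alpha> \<le> K"
    using B by (auto simp: K_def le_max_iff_disj)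
  have d: "ennreal (cmod (u (Suc n) x - u n x)) \<le> ennreal K * e n x \<and>
           ennreal (cmod (p (Suc n) x - p n x)) \<le> ennreal K * e n x" for n x
  proof (induction n arbitrary: x)
    case 0
    have z: "slint \<nu> A (\<lambda>x. 0) = 0" for \<nu> A by (simp add: slint_def)
    show ?case using K by (simp add: uS pS u0 p0 z ennreal_leI)
  next
    case (Suc n)
    have 1: "u (Suc (Suc n)) x - u (Suc n) x = slint \<sigma> {s..<x} (\<lambda>t. p (Suc n) t - p n t)"
      unfolding uS[of "Suc n"] uS[of n] using bm by (simp add: slint_bd_diff[OF \<sigma>])
    have 2: "p (Suc (Suc n)) x - p (Suc n) x = slint \<kappa> {s..<x} (\<lambda>t. u (Suc n) t - u n t)"
      unfolding pS[of "Suc n"] pS[of n] using bm by (simp add: slint_bd_diff[OF \<kappa>])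
    show ?case unfolding 1 2 using Suc bm by (intro conjI bnd bd_meas_diff) auto
  qed
  obtain T where T: "T \<ge> 0" "\<And>n x. e n x \<le> ennreal (T ^ n / fact n)" using iter_int_le by auto
  define c where "c = (\<lambda>n. K * (T ^ n / fact n))"
  have dc: "cmod (u (Suc n) x - u n x) \<le> c n" "cmod (p (Suc n) x - p n x) \<le> c n" for n x
  proof -
    have "ennreal K * e n x \<le> ennreal K * ennreal (T ^ n / fact n)"
      by (intro mult_left_mono T) auto
    also have "\<dots> = ennreal (c n)" unfolding c_def using K(1) T(1) by (intro ennreal_mult[symmetric]) auto
    finally have "ennreal K * e n x \<le> ennreal (c n)" .
    moreover have "c n \<ge> 0" using K T by (simp add: c_def)
    ultimately show "cmod (u (Suc n) x - u n x) \<le> c n" "cmod (p (Suc n) x - p n x) \<le> c n"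
      using d[of n x] by (meson ennreal_le_iff order.trans)+
  qed
  have sc: "summable c"
  proof -
    have "summable (\<lambda>n. T ^ n / fact n)" using summable_exp[of T] by (simp add: field_simps)
    then show ?thesis unfolding c_def by (rule summable_mult)
  qed
  have c0: "c n \<ge> 0" for n using K T by (simp add: c_def)
  \<comment> \<open>Telescoping against the terms of an exponential series. The bound
    \<open>suminf c\<close>, common to all iterates and all points, later dominates the passage to
    the limit under the integral.\<close>
  have conv: "(\<forall>n x. cmod (v n x) \<le> suminf c) \<and> (\<forall>x. \<exists>l. (\<lambda>n. v n x) \<longlonglongrightarrow> l)"
    if v0: "v 0 = (\<lambda>x. 0)" and dv: "\<And>n x. cmod (v (Suc n) x - v n x) \<le> c n" for v :: "nat \<Rightarrow> real \<Rightarrow> complex"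
  proof (intro conjI allI)
    fix n x
    have eq: "v n x = (\<Sum>k<n. v (Suc k) x - v k x)" for n x
      by (subst sum_lessThan_telescope) (simp add: v0)
    have "cmod (v n x) \<le> (\<Sum>k<n. c k)"
      by (subst eq) (intro sum_norm_le dv)
    also have "\<dots> \<le> suminf c" by (intro sum_le_suminf sc) (auto simp: c0)
    finally show "cmod (v n x) \<le> suminf c" .
    have "summable (\<lambda>k. v (Suc k) x - v k x)"
      by (rule summable_comparison_test'[OF sc, of 0]) (use dv in auto)
    then have "(\<lambda>n. \<Sum>k<n. v (Suc k) x - v k x) \<longlonglongrightarrow> suminf (\<lambda>k. v (Suc k) x - v k x)"
      by (rule summable_LIMSEQ)
    then show "\<exists>l. (\<lambda>n. v n x) \<longlonglongrightarrow> l" by (subst eq) blast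
  qed
  obtain U where U: "\<And>x. (\<lambda>n. u n x) \<longlonglongrightarrow> U x" using conv[OF u0 dc(1)] by metis
  obtain P where P: "\<And>x. (\<lambda>n. p n x) \<longlonglongrightarrow> P x" using conv[OF p0 dc(2)] by metis
  have ub: "cmod (u n x) \<le> suminf c" and pb: "cmod (p n x) \<le> suminf c" for n x
    using conv[OF u0 dc(1)] conv[OF p0 dc(2)] by auto
  have "bd_meas U"
  proof (rule bd_measI[of _ "suminf c"])
    show "U \<in> borel_measurable borel"
      by (rule borel_measurable_LIMSEQ_metric[OF _ U]) (use bm in \<open>auto simp: bd_meas_def\<close>)
    show "cmod (U x) \<le> suminf c" for x
      by (rule LIMSEQ_le_const2[OF tendsto_norm[OF U]]) (use ub in auto)
  qed
  moreover have "bd_meas P"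
  proof (rule bd_measI[of _ "suminf c"])
    show "P \<in> borel_measurable borel"
      by (rule borel_measurable_LIMSEQ_metric[OF _ P]) (use bm in \<open>auto simp: bd_meas_def\<close>)
    show "cmod (P x) \<le> suminf c" for x
      by (rule LIMSEQ_le_const2[OF tendsto_norm[OF P]]) (use pb in auto)
  qed
  moreover have "U x = \<alpha> + slint \<sigma> {s..<x} P" for x
  proof (rule LIMSEQ_unique[OF LIMSEQ_Suc[OF U]])
    show "(\<lambda>n. u (Suc n) x) \<longlonglongrightarrow> \<alpha> + slint \<sigma> {s..<x} P"
      unfolding uS by (intro tendsto_intros slint_bd_limit[OF \<sigma> _ pb P]) (use bm in auto)
  qed
  moreover have "P x = G x + slint \<kappa> {s..<x} U" for x
  proof (rule LIMSEQ_unique[OF LIMSEQ_Suc[OF P]])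
    show "(\<lambda>n. p (Suc n) x) \<longlonglongrightarrow> G x + slint \<kappa> {s..<x} U"
      unfolding pS by (intro tendsto_intros slint_bd_limit[OF \<kappa> _ ub U]) (use bm in auto)
  qed
  ultimately show ?thesis by blast
qed

section \<open>Integrals against pairs of measures\<close>

text \<open>Solutions matter only on the interval and are arbitrary elsewhere; the cut-off by an
  indicator transfers the facts on \<open>bd_meas\<close> to them.\<close>

definition bm_on :: "real set \<Rightarrow> (real \<Rightarrow> complex) \<Rightarrow> bool" where
  "bm_on A f \<longleftrightarrow> bd_meas (\<lambda>x. indicat_real A x *\<^sub>R f x)"

lemma bm_on_cong: "(\<And>x. x \<in> A \<Longrightarrow> f x = g x) \<Longrightarrow> bm_on A f \<longleftrightarrow> bm_on A g"
  unfolding bm_on_def by (rule arg_cong[where f=bd_meas]) (auto simp: indicator_def fun_eq_iff)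

lemma bm_on_subset: "bm_on A f \<Longrightarrow> B \<subseteq> A \<Longrightarrow> B \<in> sets borel \<Longrightarrow> bm_on B f"
proof -
  assume f: "bm_on A f" and B: "B \<subseteq> A" "B \<in> sets borel"
  have e: "(\<lambda>x. indicat_real B x *\<^sub>R (indicat_real A x *\<^sub>R f x)) = (\<lambda>x. indicat_real B x *\<^sub>R f x)"
    using B by (auto simp: indicator_def fun_eq_iff)
  obtain K where K: "K \<ge> 0" "\<And>x. cmod (indicat_real A x *\<^sub>R f x) \<le> K"
    using f bd_meas_bound unfolding bm_on_def by blast
  have [measurable]: "(\<lambda>x. indicat_real A x *\<^sub>R f x) \<in> borel_measurable borel"
    using f by (simp add: bm_on_def bd_meas_def)
  note [measurable] = B(2)
  have "(\<lambda>x. indicat_real B x *\<^sub>R (indicat_real A x *\<^sub>R f x)) \<in> borel_measurable borel" by measurable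
  then show "bm_on B f" unfolding bm_on_def e
  proof (rule bd_measI[of _ K])
    show "cmod (indicat_real B x *\<^sub>R f x) \<le> K" for x
      using K(1) K(2)[of x] B by (auto simp: indicator_def split: if_splits)
  qed
qed

lemma bm_on_mult:
  assumes f: "bm_on A f" and g: "bm_on A g"
  shows "bm_on A (\<lambda>x. f x * g x)"
proof -
  have e: "(\<lambda>x. indicat_real A x *\<^sub>R (f x * g x)) = (\<lambda>x. (indicat_real A x *\<^sub>R f x) * (indicat_real A x *\<^sub>R g x))"
    by (auto simp: indicator_def fun_eq_iff)
  obtain K where K: "K \<ge> 0" "\<And>x. cmod (indicat_real A x *\<^sub>R f x) \<le> K"
    using f bd_meas_bound unfolding bm_on_def by blast
  obtain L where L: "\<And>x. cmod (indicat_real A x *\<^sub>R g x) \<le> L"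
    using g bd_meas_bound unfolding bm_on_def by blast
  show ?thesis unfolding bm_on_def e
  proof (rule bd_measI[of _ "K * L"])
    show "(\<lambda>x. (indicat_real A x *\<^sub>R f x) * (indicat_real A x *\<^sub>R g x)) \<in> borel_measurable borel"
      by (rule borel_measurable_times[OF conjunct1[OF f[unfolded bm_on_def bd_meas_def]] conjunct1[OF g[unfolded bm_on_def bd_meas_def]]])
    show "cmod ((indicat_real A x *\<^sub>R f x) * (indicat_real A x *\<^sub>R g x)) \<le> K * L" for x
      unfolding norm_mult using K L by (intro mult_mono) auto
  qed
qed

lemma bm_on_add: "bm_on A f \<Longrightarrow> bm_on A g \<Longrightarrow> bm_on A (\<lambda>x. f x + g x)"
  using bd_meas_add[of "\<lambda>x. indicat_real A x *\<^sub>R f x" "\<lambda>x. indicat_real A x *\<^sub>R g x"]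
  unfolding bm_on_def by (simp add: scaleR_add_right)

lemma bm_on_diff: "bm_on A f \<Longrightarrow> bm_on A g \<Longrightarrow> bm_on A (\<lambda>x. f x - g x)"
  using bd_meas_diff[of "\<lambda>x. indicat_real A x *\<^sub>R f x" "\<lambda>x. indicat_real A x *\<^sub>R g x"]
  unfolding bm_on_def by (simp add: scaleR_diff_right)

lemma bm_on_const: "A \<in> sets borel \<Longrightarrow> bm_on A (\<lambda>x. k)"
  unfolding bm_on_def by (rule bd_measI[of _ "cmod k"]) (auto simp: indicator_def)

lemma bm_on_cnj: "bm_on A f \<Longrightarrow> bm_on A (\<lambda>x. cnj (f x))"
proof -
  assume f: "bm_on A f"
  obtain K where K: "K \<ge> 0" "\<And>x. cmod (indicat_real A x *\<^sub>R f x) \<le> K"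
    using f bd_meas_bound unfolding bm_on_def by blast
  have [measurable]: "(\<lambda>x. indicat_real A x *\<^sub>R f x) \<in> borel_measurable borel"
    using f by (simp add: bm_on_def bd_meas_def)
  have "(\<lambda>x. cnj (indicat_real A x *\<^sub>R f x)) \<in> borel_measurable borel"
    by (rule borel_measurable_continuous_on[OF _ \<open>_ \<in> borel_measurable borel\<close>]) (intro continuous_intros)
  moreover have "(\<lambda>x. cnj (indicat_real A x *\<^sub>R f x)) = (\<lambda>x. indicat_real A x *\<^sub>R cnj (f x))" by auto
  moreover have "cmod (indicat_real A x *\<^sub>R cnj (f x)) \<le> K" for x using K(2)[of x] by simp
  ultimately show ?thesis unfolding bm_on_def by (metis bd_measI)
qed

lemma bm_on_set_integrable:
  assumes "sets M = sets borel" "emeasure M A < \<infinity>" "A \<in> sets borel" "bm_on A f"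
  shows "set_integrable M A f"
proof -
  obtain K where K: "\<And>x. cmod (indicat_real A x *\<^sub>R f x) \<le> K"
    using assms bd_meas_bound unfolding bm_on_def by blast
  have "integrable M (\<lambda>x. indicat_real A x *\<^sub>R (indicat_real A x *\<^sub>R f x))"
  proof (rule integrableI_bounded_set_indicator[of _ _ _ K])
    show "(\<lambda>x. indicat_real A x *\<^sub>R f x) \<in> borel_measurable M"
      using assms(4) by (simp add: bm_on_def bd_meas_def measurable_cong_sets[OF assms(1) refl])
    show "AE x in M. x \<in> A \<longrightarrow> norm (indicat_real A x *\<^sub>R f x) \<le> K"
    proof (intro AE_I2 impI)
      fix x assume "x \<in> A"
      then show "norm (indicat_real A x *\<^sub>R f x) \<le> K" using K[of x] by simp
    qed
  qed (use assms in auto)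
  moreover have "(\<lambda>x. indicat_real A x *\<^sub>R (indicat_real A x *\<^sub>R f x)) = (\<lambda>x. indicat_real A x *\<^sub>R f x)"
    by (auto simp: indicator_def fun_eq_iff)
  ultimately show ?thesis by (simp add: set_integrable_def)
qed

lemma set_integrable_mult_bm:
  assumes "sets M = sets borel" "set_integrable M A f" "bm_on A g"
  shows "set_integrable M A (\<lambda>x. f x * g x)"
proof -
  obtain K where K: "K \<ge> 0" "\<And>x. cmod (indicat_real A x *\<^sub>R g x) \<le> K"
    using assms bd_meas_bound unfolding bm_on_def by blast
  have e: "(\<lambda>x. indicat_real A x *\<^sub>R (f x * g x)) = (\<lambda>x. (indicat_real A x *\<^sub>R f x) * (indicat_real A x *\<^sub>R g x))"
    by (auto simp: indicator_def fun_eq_iff)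
  show ?thesis unfolding set_integrable_def e
  proof (rule Bochner_Integration.integrable_bound)
    show "integrable M (\<lambda>x. K * norm (indicat_real A x *\<^sub>R f x))"
      using assms(2) unfolding set_integrable_def by (intro integrable_mult_right integrable_norm)
    have "(\<lambda>x. indicat_real A x *\<^sub>R g x) \<in> borel_measurable M"
      using assms(3) by (simp add: bm_on_def bd_meas_def measurable_cong_sets[OF assms(1) refl])
    then show "(\<lambda>x. indicat_real A x *\<^sub>R f x * indicat_real A x *\<^sub>R g x) \<in> borel_measurable M"
      using borel_measurable_integrable[OF assms(2)[unfolded set_integrable_def]] by measurable
    have "norm ((indicat_real A x *\<^sub>R f x) * (indicat_real A x *\<^sub>R g x)) \<le> norm (K * norm (indicat_real A x *\<^sub>R f x))" for x
    proof -
      have "norm (indicat_real A x *\<^sub>R f x) * norm (indicat_real A x *\<^sub>R g x) \<le> norm (indicat_real A x *\<^sub>R f x) * K"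
        using K by (intro mult_left_mono) auto
      then show ?thesis using K(1) by (cases "x \<in> A") (auto simp: norm_mult mult.commute abs_mult)
    qed
    then show "AE x in M. norm ((indicat_real A x *\<^sub>R f x) * (indicat_real A x *\<^sub>R g x)) \<le> norm (K * norm (indicat_real A x *\<^sub>R f x))"
      by blast
  qed
qed

definition sintg :: "smeasure \<Rightarrow> real set \<Rightarrow> (real \<Rightarrow> complex) \<Rightarrow> bool" where
  "sintg \<mu> A f \<longleftrightarrow> set_integrable (fst \<mu>) A f \<and> set_integrable (snd \<mu>) A f"

definition fin_on :: "real set \<Rightarrow> smeasure \<Rightarrow> bool" where
  "fin_on A \<mu> \<longleftrightarrow> sets (fst \<mu>) = sets borel \<and> sets (snd \<mu>) = sets borel \<and>
     emeasure (fst \<mu>) A < \<infinity> \<and> emeasure (snd \<mu>) A < \<infinity>"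

lemma sintg_bm: "fin_on A \<mu> \<Longrightarrow> A \<in> sets borel \<Longrightarrow> bm_on A f \<Longrightarrow> sintg \<mu> A f"
  unfolding fin_on_def sintg_def by (auto intro: bm_on_set_integrable)

lemma sintg_mult: "fin_on A \<mu> \<Longrightarrow> sintg \<mu> A f \<Longrightarrow> bm_on A g \<Longrightarrow> sintg \<mu> A (\<lambda>x. f x * g x)"
  unfolding fin_on_def sintg_def by (auto intro: set_integrable_mult_bm)

lemma sintg_mult': "fin_on A \<mu> \<Longrightarrow> sintg \<mu> A f \<Longrightarrow> bm_on A g \<Longrightarrow> sintg \<mu> A (\<lambda>x. g x * f x)"
  using sintg_mult by (simp add: mult.commute)

lemma sintg_subset: "sintg \<mu> A f \<Longrightarrow> fin_on A \<mu> \<Longrightarrow> B \<subseteq> A \<Longrightarrow> B \<in> sets borel \<Longrightarrow> sintg \<mu> B f"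
  unfolding sintg_def fin_on_def by (auto intro: set_integrable_subset)

lemma slint_add: "sintg \<mu> A f \<Longrightarrow> sintg \<mu> A g \<Longrightarrow> slint \<mu> A (\<lambda>x. f x + g x) = slint \<mu> A f + slint \<mu> A g"
  unfolding slint_def sintg_def by simp

lemma slint_diff: "sintg \<mu> A f \<Longrightarrow> sintg \<mu> A g \<Longrightarrow> slint \<mu> A (\<lambda>x. f x - g x) = slint \<mu> A f - slint \<mu> A g"
  unfolding slint_def sintg_def by simp

lemma slint_cmult: "slint \<mu> A (\<lambda>x. k * f x) = k * slint \<mu> A f"
  unfolding slint_def by (simp add: right_diff_distrib)

lemma slint_multc: "slint \<mu> A (\<lambda>x. f x * k) = slint \<mu> A f * k"
  unfolding slint_def by (simp add: left_diff_distrib)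

lemma slint_cnj: "slint \<mu> A (\<lambda>x. cnj (f x)) = cnj (slint \<mu> A f)"
proof -
  have "(LINT x:A|M. cnj (f x)) = cnj (LINT x:A|M. f x)" for M
  proof -
    have "(\<lambda>x. indicat_real A x *\<^sub>R cnj (f x)) = (\<lambda>x. cnj (indicat_real A x *\<^sub>R f x))" by auto
    then show ?thesis unfolding set_lebesgue_integral_def by (simp only: Bochner_Integration.integral_cnj)
  qed
  then show ?thesis by (simp add: slint_def)
qed

lemma slint_cong: "fin_on A \<mu> \<Longrightarrow> A \<in> sets borel \<Longrightarrow> (\<And>x. x \<in> A \<Longrightarrow> f x = g x) \<Longrightarrow> slint \<mu> A f = slint \<mu> A g"
  unfolding slint_def fin_on_def by (intro arg_cong2[where f="(-)"] set_lebesgue_integral_cong) auto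

lemma slint_append:
  assumes "sintg \<mu> {x..<z} f" "fin_on {x..<z} \<mu>" "x \<le> y" "y \<le> z"
  shows "slint \<mu> {x..<z} f = slint \<mu> {x..<y} f + slint \<mu> {y..<z} f"
proof -
  have e: "{x..<z} = {x..<y} \<union> {y..<z}" using assms by auto
  have "(LINT t:{x..<z}|M. f t) = (LINT t:{x..<y}|M. f t) + (LINT t:{y..<z}|M. f t)"
    if "sets M = sets borel" "set_integrable M {x..<z} f" for M
    unfolding e by (rule set_integral_Un) (use that assms in \<open>auto intro: set_integrable_subset\<close>)
  then show ?thesis using assms unfolding slint_def sintg_def fin_on_def by auto
qed

lemma slint_empty [simp]: "slint \<mu> {} f = 0"
  by (simp add: slint_def set_lebesgue_integral_def)

lemma slint_primitive_bm:
  assumes f: "sintg \<mu> {x..<y} f" and fin: "fin_on {x..<y} \<mu>"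
  shows "bm_on {x..y} (\<lambda>t. slint \<mu> {x..<t} f)"
proof -
  have "bm_on {x..y} (\<lambda>t. LINT r:{x..<t}|M. f r)"
    if M: "sets M = sets borel" "emeasure M {x..<y} < \<infinity>" "set_integrable M {x..<y} f" for M
    unfolding bm_on_def
  proof (rule bd_measI[of _ "LINT t:{x..<y}|M. norm (f t)"])
    have "set_borel_measurable borel {x..<y} f"
      using borel_measurable_integrable[OF M(3)[unfolded set_integrable_def]]
      by (simp add: set_borel_measurable_def measurable_cong_sets[OF M(1) refl])
    from set_integral_primitive_measurable[OF M(1,2) this]
    show "(\<lambda>t. indicat_real {x..y} t *\<^sub>R (LINT r:{x..<t}|M. f r)) \<in> borel_measurable borel"
      by (simp only: set_borel_measurable_def)
    fix t
    have "cmod (LINT r:{x..<t}|M. f r) \<le> (LINT t:{x..<y}|M. norm (f t))" if "t \<in> {x..y}"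
    proof -
      have i: "set_integrable M {x..<t} f" by (rule set_integrable_subset[OF M(3)]) (use that M in auto)
      have "cmod (LINT r:{x..<t}|M. f r) \<le> (LINT r:{x..<t}|M. norm (f r))"
        using set_integral_norm_bound[OF i] .
      also have "\<dots> \<le> (LINT t:{x..<y}|M. norm (f t))"
        unfolding set_lebesgue_integral_def
      proof (rule integral_mono)
        show "integrable M (\<lambda>r. indicat_real {x..<t} r *\<^sub>R norm (f r))"
          using set_integrable_norm[OF i] by (simp only: set_integrable_def)
        show "integrable M (\<lambda>r. indicat_real {x..<y} r *\<^sub>R norm (f r))"
          using set_integrable_norm[OF M(3)] by (simp only: set_integrable_def)
        show "indicat_real {x..<t} r *\<^sub>R norm (f r) \<le> indicat_real {x..<y} r *\<^sub>R norm (f r)" for r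
          using that by (simp add: indicator_def)
      qed
      finally show ?thesis .
    qed
    moreover have "0 \<le> (LINT t:{x..<y}|M. norm (f t))"
      unfolding set_lebesgue_integral_def by (rule Bochner_Integration.integral_nonneg) simp
    ultimately show "cmod (indicat_real {x..y} t *\<^sub>R (LINT r:{x..<t}|M. f r)) \<le> (LINT t:{x..<y}|M. norm (f t))"
      by (cases "t \<in> {x..y}") simp_all
  qed
  then show ?thesis
    unfolding slint_def using f fin unfolding fin_on_def sintg_def by (intro bm_on_diff) blast+
qed

lemma slint_pos_measure: "slint (pos_measure M) A h = (LINT x:A|M. h x)"
  by (simp add: slint_def pos_measure_def set_lebesgue_integral_def)

lemma sintg_pos_measure: "sintg (pos_measure M) A h \<longleftrightarrow> set_integrable M A h"
  by (auto simp: sintg_def pos_measure_def set_integrable_def dest: borel_measurable_integrable)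

text \<open>Expanding both differences leaves four products of positive measures, each covered by
  \<open>triangle_product_interval\<close>. This is why common atoms are excluded for every choice
  of one part from each pair.\<close>

lemma slint_parts:
  assumes fin: "fin_on {x..<y} \<mu>" "fin_on {x..<y} \<nu>"
    and f: "sintg \<mu> {x..<y} f" and g: "sintg \<nu> {x..<y} g"
    and na: "\<And>M N t. M \<in> {fst \<mu>, snd \<mu>} \<Longrightarrow> N \<in> {fst \<nu>, snd \<nu>} \<Longrightarrow> t \<in> {x..<y} \<Longrightarrow> measure M {t} = 0 \<or> measure N {t} = 0"
  shows "slint \<mu> {x..<y} f * slint \<nu> {x..<y} g =
    slint \<mu> {x..<y} (\<lambda>s. f s * slint \<nu> {x..<s} g) + slint \<nu> {x..<y} (\<lambda>t. slint \<mu> {x..<t} f * g t)"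
proof -
  define U V where "U = (\<lambda>M s. LINT t:{x..<s}|M. f t)" and "V = (\<lambda>N s. LINT t:{x..<s}|N. g t)"
  have sM: "sets M = sets borel" "emeasure M {x..<y} < \<infinity>" "set_integrable M {x..<y} f" if "M \<in> {fst \<mu>, snd \<mu>}" for M
    using fin f that by (auto simp: fin_on_def sintg_def)
  have sN: "sets N = sets borel" "emeasure N {x..<y} < \<infinity>" "set_integrable N {x..<y} g" if "N \<in> {fst \<nu>, snd \<nu>}" for N
    using fin g that by (auto simp: fin_on_def sintg_def)
  have prim: "bm_on {x..<y} (\<lambda>s. LINT t:{x..<s}|K. h t)"
    if "sets K = sets borel" "emeasure K {x..<y} < \<infinity>" "set_integrable K {x..<y} h" for K h
  proof -
    have "bm_on {x..y} (\<lambda>s. slint (pos_measure K) {x..<s} h)"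
      using that by (intro slint_primitive_bm) (simp_all add: sintg_pos_measure, simp add: fin_on_def pos_measure_def)
    then show ?thesis
      unfolding slint_pos_measure by (rule bm_on_subset) auto
  qed
  have p: "(LINT t:{x..<y}|M. f t) * (LINT t:{x..<y}|N. g t) = (LINT s:{x..<y}|M. f s * V N s) + (LINT s:{x..<y}|N. U M s * g s)"
    and i1: "set_integrable M {x..<y} (\<lambda>s. f s * V N s)"
    and i2: "set_integrable N {x..<y} (\<lambda>s. U M s * g s)"
    if M: "M \<in> {fst \<mu>, snd \<mu>}" and N: "N \<in> {fst \<nu>, snd \<nu>}" for M N
  proof -
    show "(LINT t:{x..<y}|M. f t) * (LINT t:{x..<y}|N. g t) = (LINT s:{x..<y}|M. f s * V N s) + (LINT s:{x..<y}|N. U M s * g s)"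
      unfolding U_def V_def
      by (rule triangle_product_interval[OF sM(1)[OF M] sN(1)[OF N] sM(2)[OF M] sN(2)[OF N] sM(3)[OF M] sN(3)[OF N] na[OF M N]])
    show "set_integrable M {x..<y} (\<lambda>s. f s * V N s)"
      unfolding V_def by (rule set_integrable_mult_bm[OF sM(1,3)[OF M] prim[OF sN[OF N]]])
    show "set_integrable N {x..<y} (\<lambda>s. U M s * g s)"
      unfolding U_def by (subst mult.commute) (rule set_integrable_mult_bm[OF sN(1,3)[OF N] prim[OF sM[OF M]]])
  qed
  have 1: "(LINT s:{x..<y}|M. f s * slint \<nu> {x..<s} g) = (LINT s:{x..<y}|M. f s * V (fst \<nu>) s) - (LINT s:{x..<y}|M. f s * V (snd \<nu>) s)"
    if M: "M \<in> {fst \<mu>, snd \<mu>}" for M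
  proof -
    have "slint \<nu> {x..<s} g = V (fst \<nu>) s - V (snd \<nu>) s" for s by (simp add: slint_def V_def)
    then show ?thesis
      using set_integral_diff(2)[OF i1[OF M, of "fst \<nu>"] i1[OF M, of "snd \<nu>"]]
      by (simp only: right_diff_distrib insert_iff simp_thms)
  qed
  have 2: "(LINT s:{x..<y}|N. slint \<mu> {x..<s} f * g s) = (LINT s:{x..<y}|N. U (fst \<mu>) s * g s) - (LINT s:{x..<y}|N. U (snd \<mu>) s * g s)"
    if N: "N \<in> {fst \<nu>, snd \<nu>}" for N
  proof -
    have "slint \<mu> {x..<s} f = U (fst \<mu>) s - U (snd \<mu>) s" for s by (simp add: slint_def U_def)
    then show ?thesis
      using set_integral_diff(2)[OF i2[OF _ N, of "fst \<mu>"] i2[OF _ N, of "snd \<mu>"]]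
      by (simp only: left_diff_distrib insert_iff simp_thms)
  qed
  have m1: "fst \<mu> \<in> {fst \<mu>, snd \<mu>}" and m2: "snd \<mu> \<in> {fst \<mu>, snd \<mu>}"
    and n1: "fst \<nu> \<in> {fst \<nu>, snd \<nu>}" and n2: "snd \<nu> \<in> {fst \<nu>, snd \<nu>}" by auto
  have D: "(A1 - A2) * (B1 - B2) = A1 * B1 - A1 * B2 - A2 * B1 + A2 * B2" for A1 A2 B1 B2 :: complex
    by (simp add: algebra_simps)
  have E: "(a + a') - (b + b') - (c + c') + (d + d') = ((a - b) - (c - d)) + ((a' - c') - (b' - d'))"
    for a b c d a' b' c' d' :: complex by simp
  show ?thesis
    unfolding slint_def[of \<mu> "{x..<y}"] slint_def[of \<nu> "{x..<y}"] D
    unfolding p[OF m1 n1] p[OF m1 n2] p[OF m2 n1] p[OF m2 n2] 1[OF m1] 1[OF m2] 2[OF n1] 2[OF n2]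
    by (rule E)
qed

section \<open>The differential equation as a first-order system\<close>

lemma loc_finite_interval:
  assumes "loc_finite I M" "{x..y} \<subseteq> I"
  shows "emeasure M {x..<y} < \<infinity>"
proof -
  have "emeasure M {x..<y} \<le> emeasure M {x..y}"
    by (rule emeasure_mono) (use assms in \<open>auto simp: loc_finite_def\<close>)
  also have "\<dots> < \<infinity>" using assms by (simp add: loc_finite_def)
  finally show ?thesis .
qed

lemma ivl_subset: "x \<in> ivl a b \<Longrightarrow> y \<in> ivl a b \<Longrightarrow> {x..y} \<subseteq> ivl a b"
  by (auto simp: ivl_def) (meson ereal_less_eq(3) less_le_trans le_less_trans)+

lemma open_ivl: "open (ivl a b)"
  unfolding ivl_def by (intro open_Collect_conj open_Collect_less continuous_intros)

lemma ivl_borel [measurable]: "ivl a b \<in> sets borel"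
  using open_ivl by (rule borel_open)

text \<open>Mutual singularity allows at most one part to charge a given point, so a vanishing
  difference of the two masses leaves none.\<close>

lemma real_lf_measure_atoms:
  assumes "real_lf_measure I \<mu>" "t \<in> I" "smeas_pt \<mu> t = 0" and I: "I \<in> sets borel"
  shows "measure (fst \<mu>) {t} = 0" "measure (snd \<mu>) {t} = 0"
proof -
  have sets: "sets (fst \<mu>) = sets borel" "sets (snd \<mu>) = sets borel"
    using assms(1) by (auto simp: real_lf_measure_def loc_finite_def)
  obtain A where A: "A \<in> sets borel" "emeasure (fst \<mu>) (I - A) = 0" "emeasure (snd \<mu>) (I \<inter> A) = 0"
    using assms(1) by (auto simp: real_lf_measure_def)
  have "measure (fst \<mu>) {t} = 0 \<or> measure (snd \<mu>) {t} = 0"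
  proof (cases "t \<in> A")
    case True
    have "emeasure (snd \<mu>) {t} \<le> emeasure (snd \<mu>) (I \<inter> A)"
      by (rule emeasure_mono) (use True A assms sets in auto)
    then show ?thesis using A by (simp add: measure_def)
  next
    case False
    have "emeasure (fst \<mu>) {t} \<le> emeasure (fst \<mu>) (I - A)"
      by (rule emeasure_mono) (use False A assms sets in auto)
    then show ?thesis using A by (simp add: measure_def)
  qed
  then show "measure (fst \<mu>) {t} = 0" "measure (snd \<mu>) {t} = 0"
    using assms(3) by (auto simp: smeas_pt_def)
qed

locale measure_sl =
  fixes a b :: ereal and rho :: "real measure" and sig chi :: smeasure and c :: real
  assumes hyps: "sl_hyps a b rho sig chi c"
begin

abbreviation I :: "real set" where "I \<equiv> ivl a b"

lemma rho_lf: "loc_finite I rho" and chi_lf: "real_lf_measure I chi" and sig_lf: "real_lf_measure I sig"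
  and c_in: "c \<in> I" and a_less_b: "a < b" and supp_sig: "ssupp I sig = I"
  using hyps by (auto simp: sl_hyps_def Let_def)

lemma sets_rho [measurable_cong]: "sets rho = sets borel"
  using rho_lf by (simp add: loc_finite_def)

lemma fin_on_sig: "{x..y} \<subseteq> I \<Longrightarrow> fin_on {x..<y} sig"
  using sig_lf loc_finite_interval unfolding fin_on_def real_lf_measure_def by (auto simp: loc_finite_def)

lemma fin_on_chi: "{x..y} \<subseteq> I \<Longrightarrow> fin_on {x..<y} chi"
  using chi_lf loc_finite_interval unfolding fin_on_def real_lf_measure_def by (auto simp: loc_finite_def)

lemma fin_on_rho: "{x..y} \<subseteq> I \<Longrightarrow> fin_on {x..<y} (pos_measure rho)"
  using rho_lf loc_finite_interval[of I rho x y] unfolding fin_on_def pos_measure_def by (auto simp: loc_finite_def)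

text \<open>Condition (H4) speaks of signed point masses; integration by parts needs it for the
  single parts of the Jordan decompositions.\<close>

lemma no_common_atoms:
  assumes "t \<in> I" "M \<in> {fst sig, snd sig}" "N \<in> {fst chi, snd chi} \<union> {fst (pos_measure rho), snd (pos_measure rho)}"
  shows "measure M {t} = 0 \<or> measure N {t} = 0"
proof -
  have h: "smeas_pt sig t * smeas_pt chi t = 0 \<and> smeas_pt sig t * measure rho {t} = 0"
    using hyps assms(1) by (auto simp: sl_hyps_def Let_def)
  show ?thesis
  proof (cases "smeas_pt sig t = 0")
    case True
    then show ?thesis using real_lf_measure_atoms[OF sig_lf assms(1) _ ivl_borel] assms(2) by auto
  next
    case False
    then have "smeas_pt chi t = 0" "measure rho {t} = 0" using h by auto
    then show ?thesis using real_lf_measure_atoms[OF chi_lf assms(1) _ ivl_borel] assms(3) by (auto simp: pos_measure_def)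
  qed
qed

text \<open>\<open>sol J f p g\<close>: on \<open>J\<close>, \<open>\<tau>f = g\<close> with quasi-derivative \<open>p\<close>.\<close>
definition sol :: "real set \<Rightarrow> (real \<Rightarrow> complex) \<Rightarrow> (real \<Rightarrow> complex) \<Rightarrow> (real \<Rightarrow> complex) \<Rightarrow> bool" where
  "sol J f p g \<longleftrightarrow> (\<forall>x\<in>J. \<forall>y\<in>J. x < y \<longrightarrow>
     bm_on {x..<y} f \<and> bm_on {x..<y} p \<and> set_integrable rho {x..<y} g \<and>
     f y - f x = slint sig {x..<y} p \<and>
     p y - p x = slint chi {x..<y} f - (LINT t:{x..<y}|rho. g t))"

lemma solD:
  assumes "sol J f p g" "x \<in> J" "y \<in> J" "x < y"
  shows "bm_on {x..<y} f" "bm_on {x..<y} p" "set_integrable rho {x..<y} g"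
    "f y - f x = slint sig {x..<y} p"
    "p y - p x = slint chi {x..<y} f - slint (pos_measure rho) {x..<y} g"
  using assms unfolding sol_def by (auto simp: slint_pos_measure)

lemma solD_le:
  assumes "sol J f p g" "x \<in> J" "y \<in> J" "x \<le> y"
  shows "f y - f x = slint sig {x..<y} p"
    "p y - p x = slint chi {x..<y} f - slint (pos_measure rho) {x..<y} g"
  using solD(4,5)[OF assms(1-3)] assms(4) by (cases "x = y"; simp)+

lemma sol_subset: "sol J f p g \<Longrightarrow> K \<subseteq> J \<Longrightarrow> sol K f p g"
  unfolding sol_def by blast

lemma sol_add:
  assumes J: "\<And>x y. x \<in> J \<Longrightarrow> y \<in> J \<Longrightarrow> {x..y} \<subseteq> I"
    and f: "sol J f p g" and u: "sol J u q v"
  shows "sol J (\<lambda>x. f x + u x) (\<lambda>x. p x + q x) (\<lambda>x. g x + v x)"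
  unfolding sol_def
proof (intro ballI impI)
  fix x y assume xy: "x \<in> J" "y \<in> J" "x < y"
  note F = solD[OF f xy] and U = solD[OF u xy]
  note fin = fin_on_sig[OF J[OF xy(1,2)]] fin_on_chi[OF J[OF xy(1,2)]]
  have "slint sig {x..<y} (\<lambda>x. p x + q x) = slint sig {x..<y} p + slint sig {x..<y} q"
    by (intro slint_add sintg_bm fin F U) auto
  moreover have "slint chi {x..<y} (\<lambda>x. f x + u x) = slint chi {x..<y} f + slint chi {x..<y} u"
    by (intro slint_add sintg_bm fin F U) auto
  ultimately show "bm_on {x..<y} (\<lambda>x. f x + u x) \<and> bm_on {x..<y} (\<lambda>x. p x + q x) \<and>
     set_integrable rho {x..<y} (\<lambda>x. g x + v x) \<and>
     f y + u y - (f x + u x) = slint sig {x..<y} (\<lambda>x. p x + q x) \<and>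
     p y + q y - (p x + q x) = slint chi {x..<y} (\<lambda>x. f x + u x) - (LINT t:{x..<y}|rho. g t + v t)"
    using F(3-5) U(3-5)
    by (simp add: bm_on_add F(1,2) U(1,2) slint_pos_measure) (simp add: algebra_simps)
qed

lemma sol_cmult:
  assumes J: "\<And>x y. x \<in> J \<Longrightarrow> y \<in> J \<Longrightarrow> {x..y} \<subseteq> I" and f: "sol J f p g"
  shows "sol J (\<lambda>x. k * f x) (\<lambda>x. k * p x) (\<lambda>x. k * g x)"
  unfolding sol_def
proof (intro ballI impI)
  fix x y assume xy: "x \<in> J" "y \<in> J" "x < y"
  note F = solD[OF f xy]
  show "bm_on {x..<y} (\<lambda>x. k * f x) \<and> bm_on {x..<y} (\<lambda>x. k * p x) \<and>
     set_integrable rho {x..<y} (\<lambda>x. k * g x) \<and>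
     k * f y - k * f x = slint sig {x..<y} (\<lambda>x. k * p x) \<and>
     k * p y - k * p x = slint chi {x..<y} (\<lambda>x. k * f x) - (LINT t:{x..<y}|rho. k * g t)"
    using F(3-5)
    by (simp add: bm_on_mult[OF bm_on_const] F(1,2) slint_pos_measure slint_cmult flip: right_diff_distrib)
qed

lemma sol_cnj:
  assumes J: "\<And>x y. x \<in> J \<Longrightarrow> y \<in> J \<Longrightarrow> {x..y} \<subseteq> I" and f: "sol J f p g"
  shows "sol J (\<lambda>x. cnj (f x)) (\<lambda>x. cnj (p x)) (\<lambda>x. cnj (g x))"
  unfolding sol_def
proof (intro ballI impI)
  fix x y assume xy: "x \<in> J" "y \<in> J" "x < y"
  note F = solD[OF f xy]
  have i: "set_integrable rho {x..<y} (\<lambda>x. cnj (g x))"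
  proof -
    have "(\<lambda>t. indicat_real {x..<y} t *\<^sub>R cnj (g t)) = (\<lambda>t. cnj (indicat_real {x..<y} t *\<^sub>R g t))" by auto
    then show ?thesis using F(3) unfolding set_integrable_def by (simp only: complex_integrable_cnj)
  qed
  have "cnj (f y) - cnj (f x) = slint sig {x..<y} (\<lambda>x. cnj (p x))"
    "cnj (p y) - cnj (p x) = slint chi {x..<y} (\<lambda>x. cnj (f x)) - slint (pos_measure rho) {x..<y} (\<lambda>t. cnj (g t))"
    unfolding slint_cnj F(4,5)[symmetric] complex_cnj_diff[symmetric] by simp_all
  then show "bm_on {x..<y} (\<lambda>x. cnj (f x)) \<and> bm_on {x..<y} (\<lambda>x. cnj (p x)) \<and>
     set_integrable rho {x..<y} (\<lambda>x. cnj (g x)) \<and>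
     cnj (f y) - cnj (f x) = slint sig {x..<y} (\<lambda>x. cnj (p x)) \<and>
     cnj (p y) - cnj (p x) = slint chi {x..<y} (\<lambda>x. cnj (f x)) - (LINT t:{x..<y}|rho. cnj (g t))"
    using i by (simp add: bm_on_cnj F(1,2) slint_pos_measure)
qed

text \<open>Here \<open>f\<close> is a primitive for \<open>sig\<close>, while \<open>q\<close> is
  one for \<open>chi\<close> and \<open>rho\<close>, so the increment of \<open>f q\<close> is an
  integration by parts across measures without common atoms.\<close>

lemma sol_parts:
  assumes f: "sol {x..y} f p g" and u: "sol {x..y} u q v" and xy: "x < y" "{x..y} \<subseteq> I"
  shows "f y * q y - f x * q x = slint sig {x..<y} (\<lambda>t. p t * q t) + slint chi {x..<y} (\<lambda>t. f t * u t)
      - slint (pos_measure rho) {x..<y} (\<lambda>t. f t * v t)"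
proof -
  have m: "x \<in> {x..y}" "y \<in> {x..y}" using xy by auto
  note F = solD[OF f m xy(1)] and U = solD[OF u m xy(1)]
  note fs = fin_on_sig[OF xy(2)] and fc = fin_on_chi[OF xy(2)] and fr = fin_on_rho[OF xy(2)]
  have B: "{x..<y} \<in> sets borel" by simp
  note ip = sintg_bm[OF fs B F(2)]
  note iu = sintg_bm[OF fc B U(1)]
  have iv: "sintg (pos_measure rho) {x..<y} v" using U(3) by (simp add: sintg_pos_measure)
  \<comment> \<open>The increment of \<open>q\<close> is split into its \<open>chi\<close> part and
    its \<open>rho\<close> part, because integration by parts handles one pair of measures at a
    time.\<close>
  define R S where "R = (\<lambda>s. slint chi {x..<s} u)" and "S = (\<lambda>s. slint (pos_measure rho) {x..<s} v)"
  have q: "q s - q x = R s - S s" if "s \<in> {x..y}" for s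
    using solD_le(2)[OF u m(1), of s] that by (simp add: R_def S_def)
  have fe: "f s - f x = slint sig {x..<s} p" if "s \<in> {x..y}" for s
    using solD_le(1)[OF f m(1), of s] that by simp
  have bR: "bm_on {x..<y} R"
    unfolding R_def by (rule bm_on_subset[OF slint_primitive_bm[OF iu fc]]) auto
  have bS: "bm_on {x..<y} S"
    unfolding S_def by (rule bm_on_subset[OF slint_primitive_bm[OF iv fr]]) auto
  have tI: "t \<in> I" if "t \<in> {x..<y}" for t using that xy by auto
  have 1: "slint sig {x..<y} p * R y = slint sig {x..<y} (\<lambda>s. p s * R s) + slint chi {x..<y} (\<lambda>t. slint sig {x..<t} p * u t)"
    unfolding R_def by (rule slint_parts[OF fs fc ip iu]) (use no_common_atoms tI in blast)
  have 2: "slint sig {x..<y} p * S y = slint sig {x..<y} (\<lambda>s. p s * S s) + slint (pos_measure rho) {x..<y} (\<lambda>t. slint sig {x..<t} p * v t)"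
    unfolding S_def by (rule slint_parts[OF fs fr ip iv]) (use no_common_atoms tI in blast)
  have 3: "slint sig {x..<y} (\<lambda>t. p t * q t) = slint sig {x..<y} (\<lambda>s. p s * R s) - slint sig {x..<y} (\<lambda>s. p s * S s) + slint sig {x..<y} p * q x"
  proof -
    have "slint sig {x..<y} (\<lambda>t. p t * q t) = slint sig {x..<y} (\<lambda>t. (p t * R t - p t * S t) + p t * q x)"
    proof (rule slint_cong[OF fs B])
      fix t assume "t \<in> {x..<y}"
      then have qt: "q t = R t - S t + q x" using q[of t] by (simp add: algebra_simps)
      show "p t * q t = (p t * R t - p t * S t) + p t * q x"
        unfolding qt by (simp add: algebra_simps)
    qed
    also have "\<dots> = slint sig {x..<y} (\<lambda>s. p s * R s) - slint sig {x..<y} (\<lambda>s. p s * S s) + slint sig {x..<y} p * q x"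
      by (subst slint_add, (intro sintg_bm[OF fs B] bm_on_diff bm_on_mult F bR bS bm_on_const B)+,
          subst slint_diff, (intro sintg_bm[OF fs B] bm_on_mult F bR bS)+) (simp add: slint_multc)
    finally show ?thesis .
  qed
  have 4: "slint chi {x..<y} (\<lambda>t. slint sig {x..<t} p * u t) = slint chi {x..<y} (\<lambda>t. f t * u t) - f x * slint chi {x..<y} u"
  proof -
    have "slint chi {x..<y} (\<lambda>t. slint sig {x..<t} p * u t) = slint chi {x..<y} (\<lambda>t. f t * u t - f x * u t)"
      by (rule slint_cong[OF fc B]) (use fe in \<open>auto simp: left_diff_distrib[symmetric]\<close>)
    also have "\<dots> = slint chi {x..<y} (\<lambda>t. f t * u t) - f x * slint chi {x..<y} u"
      by (subst slint_diff, (intro sintg_bm[OF fc B] bm_on_mult F U bm_on_const B)+) (simp add: slint_cmult)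
    finally show ?thesis .
  qed
  have 5: "slint (pos_measure rho) {x..<y} (\<lambda>t. slint sig {x..<t} p * v t) = slint (pos_measure rho) {x..<y} (\<lambda>t. f t * v t) - f x * slint (pos_measure rho) {x..<y} v"
  proof -
    have "slint (pos_measure rho) {x..<y} (\<lambda>t. slint sig {x..<t} p * v t) = slint (pos_measure rho) {x..<y} (\<lambda>t. f t * v t - f x * v t)"
      by (rule slint_cong[OF fr B]) (use fe in \<open>auto simp: left_diff_distrib[symmetric]\<close>)
    also have "\<dots> = slint (pos_measure rho) {x..<y} (\<lambda>t. f t * v t) - f x * slint (pos_measure rho) {x..<y} v"
      by (subst slint_diff, (intro sintg_mult'[OF fr iv] F bm_on_const B)+) (simp add: slint_cmult)
    finally show ?thesis .
  qed
  have q': "q y = q x + R y - S y" using q[OF m(2)] by (simp add: algebra_simps)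
  have f': "f y = f x + slint sig {x..<y} p" using fe[OF m(2)] by (simp add: algebra_simps)
  have RS: "R y = slint chi {x..<y} u" "S y = slint (pos_measure rho) {x..<y} v" by (simp_all add: R_def S_def)
  have "f y * q y - f x * q x = slint sig {x..<y} p * q x + slint sig {x..<y} p * R y - slint sig {x..<y} p * S y
      + f x * R y - f x * S y"
    unfolding f' q' by (simp add: algebra_simps)
  also have "\<dots> = slint sig {x..<y} (\<lambda>t. p t * q t) + slint chi {x..<y} (\<lambda>t. f t * u t)
      - slint (pos_measure rho) {x..<y} (\<lambda>t. f t * v t)"
    unfolding 1 2 3 4 5 unfolding RS by simp
  finally show ?thesis .
qed

text \<open>The \<open>sig\<close> and \<open>chi\<close> integrals in \<open>sol_parts\<close> are
  symmetric in the two solutions and cancel in the antisymmetric combination. Only the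
  \<open>rho\<close> terms survive.\<close>

lemma lagrange_identity:
  assumes f: "sol J f p g" and u: "sol J u q v" and xy: "x \<le> y" "{x..y} \<subseteq> I" "{x..y} \<subseteq> J"
  shows "(f y * q y - p y * u y) - (f x * q x - p x * u x) = (LINT t:{x..<y}|rho. g t * u t - f t * v t)"
    and "set_integrable rho {x..<y} (\<lambda>t. g t * u t - f t * v t)"
proof -
  have "(f y * q y - p y * u y) - (f x * q x - p x * u x) = (LINT t:{x..<y}|rho. g t * u t - f t * v t) \<and>
    set_integrable rho {x..<y} (\<lambda>t. g t * u t - f t * v t)"
  proof (cases "x = y")
    case True
    then show ?thesis by (simp add: set_integrable_def set_lebesgue_integral_def)
  next
    case False
    then have l: "x < y" using xy by auto
    note f' = sol_subset[OF f xy(3)] and u' = sol_subset[OF u xy(3)]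
    have m: "x \<in> {x..y}" "y \<in> {x..y}" using l by auto
    note F = solD[OF f' m l] and U = solD[OF u' m l]
    have 1: "sintg (pos_measure rho) {x..<y} (\<lambda>t. u t * g t)"
      by (rule sintg_mult'[OF fin_on_rho[OF xy(2)]]) (use F U in \<open>auto simp: sintg_pos_measure\<close>)
    have 2: "sintg (pos_measure rho) {x..<y} (\<lambda>t. f t * v t)"
      by (rule sintg_mult'[OF fin_on_rho[OF xy(2)]]) (use F U in \<open>auto simp: sintg_pos_measure\<close>)
    have "(f y * q y - f x * q x) - (u y * p y - u x * p x) = slint (pos_measure rho) {x..<y} (\<lambda>t. u t * g t) - slint (pos_measure rho) {x..<y} (\<lambda>t. f t * v t)"
      unfolding sol_parts[OF f' u' l xy(2)] sol_parts[OF u' f' l xy(2)] by (simp add: mult.commute)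
    also have "\<dots> = slint (pos_measure rho) {x..<y} (\<lambda>t. u t * g t - f t * v t)"
      by (rule slint_diff[OF 1 2, symmetric])
    finally show ?thesis
      using 1 2 by (simp add: sintg_pos_measure slint_pos_measure algebra_simps)
  qed
  then show "(f y * q y - p y * u y) - (f x * q x - p x * u x) = (LINT t:{x..<y}|rho. g t * u t - f t * v t)"
    and "set_integrable rho {x..<y} (\<lambda>t. g t * u t - f t * v t)" by blast+
qed

end

section \<open>Initial value problems\<close>

lemma bd_meas_bm_on: "bd_meas u \<Longrightarrow> A \<in> sets borel \<Longrightarrow> bm_on A u"
  by (rule bm_on_subset[of UNIV]) (simp_all add: bm_on_def)

text \<open>Makes a pair that is finite only on \<open>A\<close> finite, so that the Picard theorem
  applies, without changing integrals inside \<open>A\<close>.\<close>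

definition restr :: "smeasure \<Rightarrow> real set \<Rightarrow> smeasure" where
  "restr \<mu> A = (density (fst \<mu>) (\<lambda>x. ennreal (indicator A x)), density (snd \<mu>) (\<lambda>x. ennreal (indicator A x)))"

lemma restr_fin_pair: "fin_on A \<mu> \<Longrightarrow> A \<in> sets borel \<Longrightarrow> fin_pair (restr \<mu> A)"
  unfolding fin_pair_def restr_def fin_on_def fst_conv snd_conv sets_density
  by (intro conjI finite_measure_density_indicator) auto

lemma slint_restr:
  assumes "fin_on A \<mu>" "A \<in> sets borel" "B \<in> sets borel" "B \<subseteq> A" "bm_on A f"
  shows "slint (restr \<mu> A) B f = slint \<mu> B f"
proof -
  have fm: "set_borel_measurable borel A f"
    using assms(5) by (simp add: bm_on_def bd_meas_def set_borel_measurable_def)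
  show ?thesis
    unfolding slint_def restr_def fst_conv snd_conv
    using set_integral_density_indicator(1)[OF _ assms(2,3) fm assms(4)] assms(1)
    by (simp add: fin_on_def)
qed

text \<open>The last two assumptions are a homogeneous linear system for \<open>(f, p)\<close>, and
  the first one says that its determinant is 1.\<close>

lemma zero_if_wronskians_zero:
  fixes f p :: complex
  assumes "u1 * q2 - q1 * u2 = 1" "f * q1 - p * u1 = 0" "f * q2 - p * u2 = 0"
  shows "f = 0" "p = 0"
  using assms by algebra+

context measure_sl
begin

lemma sol_cong:
  assumes J: "\<And>x y. x \<in> J \<Longrightarrow> y \<in> J \<Longrightarrow> {x..y} \<subseteq> J \<inter> I"
    and e: "\<And>x. x \<in> J \<Longrightarrow> f x = f' x" "\<And>x. x \<in> J \<Longrightarrow> p x = p' x" and s: "sol J f p g"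
  shows "sol J f' p' g"
  unfolding sol_def
proof (intro ballI impI)
  fix x y assume xy: "x \<in> J" "y \<in> J" "x < y"
  note S = solD[OF s xy] and JJ = J[OF xy(1,2)]
  have sub: "{x..y} \<subseteq> I" "t \<in> J" if "t \<in> {x..<y}" for t using JJ that by auto
  have sub': "{x..y} \<subseteq> I" using JJ by auto
  have B: "{x..<y} \<in> sets borel" by simp
  have "slint sig {x..<y} p = slint sig {x..<y} p'"
    by (rule slint_cong[OF fin_on_sig[OF sub'] B]) (use e sub in auto)
  moreover have "slint chi {x..<y} f = slint chi {x..<y} f'"
    by (rule slint_cong[OF fin_on_chi[OF sub'] B]) (use e sub in auto)
  moreover have "bm_on {x..<y} f'" using S(1) bm_on_cong[of "{x..<y}" f f'] e sub by auto
  moreover have "bm_on {x..<y} p'" using S(2) bm_on_cong[of "{x..<y}" p p'] e sub by auto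
  ultimately show "bm_on {x..<y} f' \<and> bm_on {x..<y} p' \<and> set_integrable rho {x..<y} g \<and>
     f' y - f' x = slint sig {x..<y} p' \<and> p' y - p' x = slint chi {x..<y} f' - (LINT t:{x..<y}|rho. g t)"
    using S(3-5) e xy by (simp add: slint_pos_measure)
qed

text \<open>The iteration integrates over \<open>[s, x)\<close> and so reaches only points to the
  right of the initial one. \<open>sol_exists_compact\<close> removes this asymmetry.\<close>

lemma sol_exists_from_left:
  assumes st: "s \<le> t" "{s..t} \<subseteq> I" and g: "set_integrable rho {s..<t} g"
  shows "\<exists>f p. sol {s..t} f p g \<and> f s = \<alpha> \<and> p s = \<beta>"
proof (cases "s = t")
  case True
  then have "sol {s..t} (\<lambda>_. \<alpha>) (\<lambda>_. \<beta>) g" by (simp add: sol_def)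
  then show ?thesis by blast
next
  case False
  define A where "A = {s..<t}"
  have B: "A \<in> sets borel" by (simp add: A_def)
  have fs: "fin_on A sig" and fc: "fin_on A chi" and fr: "fin_on A (pos_measure rho)"
    unfolding A_def by (intro fin_on_sig fin_on_chi fin_on_rho st)+
  have ig: "sintg (pos_measure rho) {s..<t} g" using g by (simp add: sintg_pos_measure)
  \<comment> \<open>The inhomogeneity is absorbed in the free term. The indicator keeps it bounded
    beyond \<open>t\<close>, where nothing is known about integrals of \<open>g\<close>.\<close>
  define G where "G = (\<lambda>x. \<beta> - indicat_real {s..t} x *\<^sub>R slint (pos_measure rho) {s..<x} g)"
  have "bd_meas G"
    unfolding G_def using slint_primitive_bm[OF ig fr[unfolded A_def]]
    by (intro bd_meas_diff bd_meas_const) (simp add: bm_on_def)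
  from volterra_solution_exists[OF restr_fin_pair[OF fs B] restr_fin_pair[OF fc B] this, of \<alpha> s]
  obtain u p where u: "bd_meas u" and p: "bd_meas p"
    and ue: "\<And>x. u x = \<alpha> + slint (restr sig A) {s..<x} p"
    and pe: "\<And>x. p x = G x + slint (restr chi A) {s..<x} u" by blast
  have ux: "u x = \<alpha> + slint sig {s..<x} p" and px: "p x = \<beta> - slint (pos_measure rho) {s..<x} g + slint chi {s..<x} u"
    if "x \<in> {s..t}" for x
  proof -
    have sub: "{s..<x} \<subseteq> A" using that by (auto simp: A_def)
    show "u x = \<alpha> + slint sig {s..<x} p"
      unfolding ue[of x] by (subst slint_restr[OF fs B _ sub bd_meas_bm_on[OF p B]]) auto
    show "p x = \<beta> - slint (pos_measure rho) {s..<x} g + slint chi {s..<x} u"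
      unfolding pe[of x] using that
      by (subst slint_restr[OF fc B _ sub bd_meas_bm_on[OF u B]]) (auto simp: G_def)
  qed
  have "sol {s..t} u p g" unfolding sol_def
  proof (intro ballI impI)
    fix x y assume xy: "x \<in> {s..t}" "y \<in> {s..t}" "x < y"
    have sy: "{s..<y} \<subseteq> A" "{s..y} \<subseteq> I" "{x..<y} \<subseteq> {s..<t}" using xy st by (auto simp: A_def)
    have 1: "slint sig {s..<y} p = slint sig {s..<x} p + slint sig {x..<y} p"
      by (rule slint_append[OF sintg_bm[OF fin_on_sig[OF sy(2)] _ bd_meas_bm_on[OF p]] fin_on_sig[OF sy(2)]]) (use xy in auto)
    have 2: "slint chi {s..<y} u = slint chi {s..<x} u + slint chi {x..<y} u"
      by (rule slint_append[OF sintg_bm[OF fin_on_chi[OF sy(2)] _ bd_meas_bm_on[OF u]] fin_on_chi[OF sy(2)]]) (use xy in auto)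
    have 3: "slint (pos_measure rho) {s..<y} g = slint (pos_measure rho) {s..<x} g + slint (pos_measure rho) {x..<y} g"
      by (rule slint_append[OF sintg_subset[OF ig fr[unfolded A_def]] fin_on_rho[OF sy(2)]]) (use xy in auto)
    show "bm_on {x..<y} u \<and> bm_on {x..<y} p \<and> set_integrable rho {x..<y} g \<and>
     u y - u x = slint sig {x..<y} p \<and> p y - p x = slint chi {x..<y} u - (LINT t:{x..<y}|rho. g t)"
      using 1 2 3 xy set_integrable_subset[OF g _ sy(3)] sets_rho
      by (simp add: bd_meas_bm_on[OF u] bd_meas_bm_on[OF p] ux px slint_pos_measure)
  qed
  moreover have "u s = \<alpha>" "p s = \<beta>" using ux[of s] px[of s] st by auto
  ultimately show ?thesis by blast
qed

text \<open>By the Lagrange identity with zero right-hand sides the Wronskian is constant, and the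
  data \<open>(1, 0)\<close> and \<open>(0, 1)\<close> at \<open>s\<close> make it 1.\<close>

lemma fundamental_system:
  assumes "s \<le> t" "{s..t} \<subseteq> I"
  obtains u1 q1 u2 q2 where "sol {s..t} u1 q1 (\<lambda>_. 0)" "sol {s..t} u2 q2 (\<lambda>_. 0)"
    "\<And>x. x \<in> {s..t} \<Longrightarrow> u1 x * q2 x - q1 x * u2 x = 1"
proof -
  have z: "set_integrable rho {s..<t} (\<lambda>_. 0::complex)" by (simp add: set_integrable_def)
  obtain u1 q1 where 1: "sol {s..t} u1 q1 (\<lambda>_. 0)" "u1 s = 1" "q1 s = 0"
    using sol_exists_from_left[OF assms z, of 1 0] by blast
  obtain u2 q2 where 2: "sol {s..t} u2 q2 (\<lambda>_. 0)" "u2 s = 0" "q2 s = 1"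
    using sol_exists_from_left[OF assms z, of 0 1] by blast
  have "u1 x * q2 x - q1 x * u2 x = 1" if x: "x \<in> {s..t}" for x
  proof -
    have "{s..x} \<subseteq> {s..t}" "s \<le> x" "{s..x} \<subseteq> I" using x assms by auto
    then show ?thesis
      using lagrange_identity(1)[OF 1(1) 2(1), of s x] assms 1 2 by (auto simp: set_lebesgue_integral_def)
  qed
  with 1 2 that show ?thesis by blast
qed

text \<open>Since \<open>g\<close> vanishes between \<open>d\<close> and \<open>x\<close>, the
  Wronskians of \<open>f\<close> with a fundamental system are constant there and vanish at
  \<open>d\<close>, hence at \<open>x\<close>. The argument works in both directions, unlike an
  estimate tied to the left-closed integrals.\<close>

lemma sol_vanishes:
  assumes f: "sol J f p g" and d: "f d = 0" "p d = 0"
    and J: "{min x d..max x d} \<subseteq> J \<inter> I" and g: "\<And>t. t \<in> {min x d..<max x d} \<Longrightarrow> g t = 0"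
  shows "f x = 0" "p x = 0"
proof -
  define s t where "s = min x d" and "t = max x d"
  have st: "s \<le> t" "{s..t} \<subseteq> I" "{s..t} \<subseteq> J" "d \<in> {s..t}" "x \<in> {s..t}" using J by (auto simp: s_def t_def)
  obtain u1 q1 u2 q2 where u: "sol {s..t} u1 q1 (\<lambda>_. 0)" "sol {s..t} u2 q2 (\<lambda>_. 0)"
    "\<And>y. y \<in> {s..t} \<Longrightarrow> u1 y * q2 y - q1 y * u2 y = 1"
    by (rule fundamental_system[OF st(1,2)]) blast
  have W: "f x * q x - p x * w x = 0" if w: "sol {s..t} w q (\<lambda>_. 0)" for w q
  proof -
    have "(LINT r:{s..<t}|rho. g r * w r - f r * 0) = (LINT r:{s..<t}|rho. 0)"
      by (rule set_lebesgue_integral_cong) (use g sets_rho in \<open>auto simp: s_def t_def\<close>)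
    then have "(f t * q t - p t * w t) - (f s * q s - p s * w s) = 0"
      using lagrange_identity(1)[OF sol_subset[OF f st(3)] w st(1,2) order.refl] by simp
    moreover have "s = d \<and> t = x \<or> s = x \<and> t = d" by (auto simp: s_def t_def)
    ultimately show ?thesis using d by auto
  qed
  show "f x = 0" "p x = 0"
    using zero_if_wronskians_zero[OF u(3)[OF st(5)] W[OF u(1)] W[OF u(2)]] by simp_all
qed

lemma sol_unique:
  assumes J: "\<And>x y. x \<in> J \<Longrightarrow> y \<in> J \<Longrightarrow> {x..y} \<subseteq> J \<inter> I"
    and f: "sol J f p g" and u: "sol J u q g" and d: "d \<in> J" "f d = u d" "p d = q d" and x: "x \<in> J"
  shows "f x = u x" "p x = q x"
proof -
  have J': "\<And>x y. x \<in> J \<Longrightarrow> y \<in> J \<Longrightarrow> {x..y} \<subseteq> I" using J by blast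
  have "sol J (\<lambda>x. f x + - 1 * u x) (\<lambda>x. p x + - 1 * q x) (\<lambda>x. g x + - 1 * g x)"
    by (rule sol_add[OF J' f sol_cmult[OF J' u]])
  moreover have "{min x d..max x d} \<subseteq> J \<inter> I" using J[OF x d(1)] J[OF d(1) x] by (auto simp: min_def max_def)
  ultimately have "f x + - 1 * u x = 0" "p x + - 1 * q x = 0"
    using d sol_vanishes[of J "\<lambda>x. f x + - 1 * u x" "\<lambda>x. p x + - 1 * q x" "\<lambda>x. g x + - 1 * g x" d x] by auto
  then show "f x = u x" "p x = q x" by auto
qed

text \<open>Any solution can be corrected at \<open>d\<close> by a combination of the fundamental
  system, whose value vectors there form a basis.\<close>

lemma sol_exists_compact:
  assumes st: "s \<le> t" "{s..t} \<subseteq> I" "d \<in> {s..t}" and g: "set_integrable rho {s..<t} g"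
  shows "\<exists>f p. sol {s..t} f p g \<and> f d = \<alpha> \<and> p d = \<beta>"
proof -
  obtain u1 q1 u2 q2 where u: "sol {s..t} u1 q1 (\<lambda>_. 0)" "sol {s..t} u2 q2 (\<lambda>_. 0)"
    "\<And>y. y \<in> {s..t} \<Longrightarrow> u1 y * q2 y - q1 y * u2 y = 1"
    by (rule fundamental_system[OF st(1,2)]) blast
  obtain w r where w: "sol {s..t} w r g" using sol_exists_from_left[OF st(1,2) g, of 0 0] by blast
  \<comment> \<open>Cramer's rule with determinant 1 for the missing data
    \<open>\<alpha> - w d\<close> and \<open>\<beta> - r d\<close>.\<close>
  define A B where "A = (\<alpha> - w d) * q2 d - (\<beta> - r d) * u2 d" and "B = (\<beta> - r d) * u1 d - (\<alpha> - w d) * q1 d"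
  have J: "\<And>x y. x \<in> {s..t} \<Longrightarrow> y \<in> {s..t} \<Longrightarrow> {x..y} \<subseteq> I" using st by auto
  have "sol {s..t} (\<lambda>x. (w x + A * u1 x) + B * u2 x) (\<lambda>x. (r x + A * q1 x) + B * q2 x) (\<lambda>x. (g x + A * 0) + B * 0)"
    by (intro sol_add sol_cmult u w J) auto
  then have "sol {s..t} (\<lambda>x. (w x + A * u1 x) + B * u2 x) (\<lambda>x. (r x + A * q1 x) + B * q2 x) g" by simp
  moreover have "(w d + A * u1 d) + B * u2 d = w d + (\<alpha> - w d) * (u1 d * q2 d - q1 d * u2 d)"
    by (simp add: A_def B_def algebra_simps)
  moreover have "(r d + A * q1 d) + B * q2 d = r d + (\<beta> - r d) * (u1 d * q2 d - q1 d * u2 d)"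
    by (simp add: A_def B_def algebra_simps)
  ultimately show ?thesis using u(3)[OF st(3)] by auto
qed

text \<open>Solutions on compact intervals with common data at \<open>d\<close> agree on overlaps by
  uniqueness, so they patch together.\<close>

lemma sol_exists:
  assumes d: "d \<in> I" and g: "\<And>s t. s \<le> t \<Longrightarrow> {s..t} \<subseteq> I \<Longrightarrow> set_integrable rho {s..<t} g"
  shows "\<exists>f p. sol I f p g \<and> f d = \<alpha> \<and> p d = \<beta>"
proof -
  \<comment> \<open>Every compact piece is enlarged so that it contains \<open>d\<close>, the point
    at which all pieces can be compared.\<close>
  define lo hi where "lo = (\<lambda>x. min x d)" and "hi = (\<lambda>x. max x d)"
  have K: "lo x \<le> hi y" "{lo x..hi y} \<subseteq> I" "d \<in> {lo x..hi y}" if "x \<in> I" "y \<in> I" for x y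
    using ivl_subset[of "min x d" a b "max y d"] that d by (auto simp: lo_def hi_def min_def max_def)
  have "\<forall>x\<in>I. \<forall>y\<in>I. \<exists>F. sol {lo x..hi y} (fst F) (snd F) g \<and> fst F d = \<alpha> \<and> snd F d = \<beta>"
  proof (intro ballI)
    fix x y assume xy: "x \<in> I" "y \<in> I"
    obtain f p where "sol {lo x..hi y} f p g" "f d = \<alpha>" "p d = \<beta>"
      using sol_exists_compact[OF K[OF xy] g[OF K(1,2)[OF xy]], of \<alpha> \<beta>] by blast
    then show "\<exists>F. sol {lo x..hi y} (fst F) (snd F) g \<and> fst F d = \<alpha> \<and> snd F d = \<beta>"
      by (intro exI[of _ "(f, p)"]) simp
  qed
  then obtain \<Phi> where \<Phi>: "\<And>x y. x \<in> I \<Longrightarrow> y \<in> I \<Longrightarrow> sol {lo x..hi y} (fst (\<Phi> x y)) (snd (\<Phi> x y)) g"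
    "\<And>x y. x \<in> I \<Longrightarrow> y \<in> I \<Longrightarrow> fst (\<Phi> x y) d = \<alpha> \<and> snd (\<Phi> x y) d = \<beta>"
    by metis
  define f p where "f = (\<lambda>x. fst (\<Phi> x x) x)" and "p = (\<lambda>x. snd (\<Phi> x x) x)"
  have agree: "f z = fst (\<Phi> x y) z" "p z = snd (\<Phi> x y) z" if xy: "x \<in> I" "y \<in> I" and z: "z \<in> {lo x..hi y}" for x y z
  proof -
    have zI: "z \<in> I" using K(2)[OF xy] z by auto
    have sub: "{lo z..hi z} \<subseteq> {lo x..hi y}" using z by (auto simp: lo_def hi_def)
    have J: "\<And>r r'. r \<in> {lo z..hi z} \<Longrightarrow> r' \<in> {lo z..hi z} \<Longrightarrow> {r..r'} \<subseteq> {lo z..hi z} \<inter> I"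
      using K(2)[OF zI zI] by auto
    have "z \<in> {lo z..hi z}" by (auto simp: lo_def hi_def)
    note * = sol_unique[OF J \<Phi>(1)[OF zI zI] sol_subset[OF \<Phi>(1)[OF xy] sub] K(3)[OF zI zI] _ _ this]
    show "f z = fst (\<Phi> x y) z" "p z = snd (\<Phi> x y) z"
      using * \<Phi>(2)[OF zI zI] \<Phi>(2)[OF xy] by (auto simp: f_def p_def)
  qed
  have "sol I f p g"
    unfolding sol_def
  proof (intro ballI impI)
    fix x y assume xy: "x \<in> I" "y \<in> I" "x < y"
    have J: "\<And>r r'. r \<in> {lo x..hi y} \<Longrightarrow> r' \<in> {lo x..hi y} \<Longrightarrow> {r..r'} \<subseteq> {lo x..hi y} \<inter> I"
      using K(2)[OF xy(1,2)] by auto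
    have "sol {lo x..hi y} f p g"
      by (rule sol_cong[OF J _ _ \<Phi>(1)[OF xy(1,2)]]) (use agree[OF xy(1,2)] in auto)
    moreover have "x \<in> {lo x..hi y}" "y \<in> {lo x..hi y}" using xy by (auto simp: lo_def hi_def)
    ultimately show "bm_on {x..<y} f \<and> bm_on {x..<y} p \<and> set_integrable rho {x..<y} g \<and>
      f y - f x = slint sig {x..<y} p \<and> p y - p x = slint chi {x..<y} f - (LINT t:{x..<y}|rho. g t)"
      using xy(3) unfolding sol_def by blast
  qed
  moreover have "f d = \<alpha>" "p d = \<beta>" using \<Phi>(2)[OF d d] by (auto simp: f_def p_def)
  ultimately show ?thesis by blast
qed


section \<open>Uniqueness of the quasi-derivative\<close>

text \<open>The sets over which the integral vanishes form a Dynkin system that contains the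
  intersection-stable family of rays \<open>{..<r}\<close>, and these generate the Borel
  sets.\<close>

lemma slint_zero_on_borel:
  fixes D :: "real \<Rightarrow> complex"
  assumes fin: "fin_on {s..<t} \<mu>" and D: "bm_on {s..<t} D" and st: "s \<le> t"
    and z: "\<And>x y. s \<le> x \<Longrightarrow> x \<le> y \<Longrightarrow> y \<le> t \<Longrightarrow> slint \<mu> {x..<y} D = 0"
    and B: "B \<in> sets borel"
  shows "slint \<mu> (B \<inter> {s..<t}) D = 0"
proof -
  have sets[measurable_cong]: "sets (fst \<mu>) = sets borel" "sets (snd \<mu>) = sets borel"
    using fin by (auto simp: fin_on_def)
  have Bs: "{s..<t} \<in> sets borel" by simp
  have i: "sintg \<mu> {s..<t} D" by (rule sintg_bm[OF fin Bs D])
  have iB: "sintg \<mu> (B \<inter> {s..<t}) D" if "B \<in> sets borel" for B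
    by (rule sintg_subset[OF i fin]) (use that in auto)
  have gen: "(borel :: real measure) = sigma UNIV (range lessThan)" by (rule borel_Iio)
  have st_int: "Int_stable (range (lessThan :: real \<Rightarrow> _))"
  proof -
    have "{..<x} \<inter> {..<y} = {..<min x y}" for x y :: real by auto
    then show ?thesis unfolding Int_stable_def by auto
  qed
  have pw: "range (lessThan :: real \<Rightarrow> _) \<subseteq> Pow UNIV" by auto
  have sb: "sets (borel :: real measure) = sigma_sets UNIV (range lessThan)"
    unfolding gen by (rule sets_measure_of) auto
  have "B \<in> sigma_sets UNIV (range lessThan)" using B unfolding sb .
  then show ?thesis
  proof (induction B rule: sigma_sets_induct_disjoint[OF st_int pw, consumes 1, case_names basic empty compl union])
    case (basic A)
    then obtain r where A: "A = {..<r}" by auto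
    show ?case
    proof (cases "s \<le> r")
      case True
      have "A \<inter> {s..<t} = {s..<min r t}" unfolding A by auto
      then show ?thesis using z[of s "min r t"] True st by simp
    next
      case False
      then have "A \<inter> {s..<t} = {}" unfolding A by auto
      then show ?thesis by simp
    qed
  next
    case empty
    then show ?case by simp
  next
    case (compl A)
    then have A: "A \<in> sets borel" "UNIV - A \<in> sets borel" by (auto simp: sb intro: sigma_sets.Compl)
    have e: "{s..<t} = (A \<inter> {s..<t}) \<union> ((UNIV - A) \<inter> {s..<t})" by auto
    have "(LINT x:{s..<t}|M. D x) = (LINT x:A \<inter> {s..<t}|M. D x) + (LINT x:(UNIV - A) \<inter> {s..<t}|M. D x)"
      if "M \<in> {fst \<mu>, snd \<mu>}" for M
      by (subst e, rule set_integral_Un) (use iB[OF A(1)] iB[OF A(2)] that in \<open>auto simp: sintg_def\<close>)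
    then have "slint \<mu> {s..<t} D = slint \<mu> (A \<inter> {s..<t}) D + slint \<mu> ((UNIV - A) \<inter> {s..<t}) D"
      unfolding slint_def by simp
    then show ?case using compl(2) z[of s t] st by simp
  next
    case (union A)
    have A: "A n \<in> sets borel" for n using union(2) by (auto simp: sb)
    have U: "(\<Union>i. A i) \<inter> {s..<t} = (\<Union>i. A i \<inter> {s..<t})" by auto
    have AU: "(\<Union>i. A i) \<in> sets borel" using A by auto
    have dj: "\<And>i j. i \<noteq> j \<Longrightarrow> (A i \<inter> {s..<t}) \<inter> (A j \<inter> {s..<t}) = {}"
      using union(1) by (auto simp: disjoint_family_on_def)
    have sm: "(LINT x:(\<Union>i. A i) \<inter> {s..<t}|M. D x) = (\<Sum>i. (LINT x:A i \<inter> {s..<t}|M. D x))"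
      if M: "M \<in> {fst \<mu>, snd \<mu>}" for M
      unfolding U
    proof (rule lebesgue_integral_countable_add)
      have "sets M = sets borel" using M sets by blast
      then show "A i \<inter> {s..<t} \<in> sets M" for i using A[of i] by simp
      show "set_integrable M (\<Union>i. A i \<inter> {s..<t}) D"
        using iB[OF AU] M unfolding U sintg_def by blast
      show "(A i \<inter> {s..<t}) \<inter> (A j \<inter> {s..<t}) = {}" if "i \<noteq> j" for i j
        by (rule dj[OF that])
    qed
    have eq: "(LINT x:A i \<inter> {s..<t}|fst \<mu>. D x) = (LINT x:A i \<inter> {s..<t}|snd \<mu>. D x)" for i
      using union(3)[of i] by (simp add: slint_def)
    show ?case
      unfolding slint_def using sm[of "fst \<mu>"] sm[of "snd \<mu>"] eq by simp
  qed
qed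

text \<open>A function with vanishing integrals over all Borel sets is zero almost everywhere. If it
  had no zero in \<open>(s, t)\<close>, that interval would be null for both parts of
  \<open>sig\<close>, against the full support.\<close>

lemma zero_if_slint_zero:
  assumes st: "s < t" "{s..t} \<subseteq> I" and D: "bm_on {s..<t} D"
    and z: "\<And>x y. s \<le> x \<Longrightarrow> x \<le> y \<Longrightarrow> y \<le> t \<Longrightarrow> slint sig {x..<y} D = 0"
  shows "\<exists>r\<in>{s<..<t}. D r = 0"
proof (rule ccontr)
  assume ne: "\<not> (\<exists>r\<in>{s<..<t}. D r = 0)"
  note fin = fin_on_sig[OF st(2)]
  have sets[measurable_cong]: "sets (fst sig) = sets borel" "sets (snd sig) = sets borel"
    using fin by (auto simp: fin_on_def)
  obtain A where A: "A \<in> sets borel" "emeasure (fst sig) (I - A) = 0" "emeasure (snd sig) (I \<inter> A) = 0"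
    using sig_lf by (auto simp: real_lf_measure_def)
  \<comment> \<open>On a set that the other part does not charge, the signed integral is one against
    the single positive measure \<open>M\<close>. Vanishing integrals over all Borel sets then force
    \<open>D\<close> to be zero almost everywhere on \<open>E\<close>.\<close>
  have null: "emeasure M (E \<inter> {s<..<t}) = 0"
    if M: "M \<in> {fst sig, snd sig}" and E: "E \<in> sets borel"
      and other: "\<And>B. B \<in> sets borel \<Longrightarrow> slint sig (B \<inter> E \<inter> {s..<t}) D = 0 \<Longrightarrow> (LINT x:B \<inter> E \<inter> {s..<t}|M. D x) = 0" for M E
  proof -
    define f where "f = (\<lambda>x. indicat_real (E \<inter> {s..<t}) x *\<^sub>R D x)"
    have sM[measurable_cong]: "sets M = sets borel" using M sets by auto
    have i: "set_integrable M {s..<t} D"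
      using sintg_bm[OF fin _ D] M by (auto simp: sintg_def)
    have f: "integrable M f"
      unfolding f_def using set_integrable_subset[OF i, of "E \<inter> {s..<t}"] E sM by (auto simp: set_integrable_def)
    define M' where "M' = density M (\<lambda>x. ennreal (indicator {s..<t} x))"
    have "emeasure M {s..<t} < \<infinity>" using fin M by (auto simp: fin_on_def)
    then interpret M': finite_measure M'
      unfolding M'_def using sM by (intro finite_measure_density_indicator) auto
    have fm: "set_borel_measurable borel {s..<t} f"
      using borel_measurable_integrable[OF f] unfolding set_borel_measurable_def
      by (simp add: measurable_cong_sets[OF sM refl])
    have cut: "(\<lambda>x. indicat_real C x *\<^sub>R f x) = (\<lambda>x. indicat_real (C \<inter> {s..<t}) x *\<^sub>R f x)" for C
      by (auto simp: f_def indicator_def fun_eq_iff)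
    have cut1: "(\<lambda>x. indicat_real {s..<t} x *\<^sub>R f x) = f"
      by (auto simp: f_def indicator_def fun_eq_iff)
    have "AE x in M'. f x = 0"
    proof (rule M'.density_zero)
      have "set_integrable M {s..<t} f"
        unfolding set_integrable_def cut1 by (rule f)
      then have "set_integrable M' {s..<t} f"
        unfolding M'_def using set_integral_density_indicator(2)[OF sM _ _ fm, of "{s..<t}"] by simp
      then show "integrable M' f" unfolding set_integrable_def cut1 .
      fix B assume "B \<in> sets M'"
      then have B: "B \<in> sets borel" using sM by (simp add: M'_def)
      have "(LINT x:B|M'. f x) = (LINT x:B \<inter> {s..<t}|M'. f x)"
        unfolding set_lebesgue_integral_def cut[of B] ..
      also have "\<dots> = (LINT x:B \<inter> {s..<t}|M. f x)"
        unfolding M'_def by (rule set_integral_density_indicator(1)[OF sM _ _ fm]) (use B in auto)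
      also have "\<dots> = (LINT x:B \<inter> E \<inter> {s..<t}|M. D x)"
        unfolding set_lebesgue_integral_def f_def
        by (intro Bochner_Integration.integral_cong) (auto simp: indicator_def)
      also have "\<dots> = 0"
        by (rule other[OF B]) (use slint_zero_on_borel[OF fin D _ z, of "B \<inter> E"] B E st in auto)
      finally show "(LINT x:B|M'. f x) = 0" .
    qed
    then have "AE x in M. 0 < ennreal (indicator {s..<t} x) \<longrightarrow> f x = 0"
      unfolding M'_def by (subst (asm) AE_density) auto
    then have "AE x in M. x \<notin> E \<inter> {s<..<t}"
      by eventually_elim (use ne in \<open>auto simp: f_def\<close>)
    then show ?thesis
      by (subst (asm) AE_iff_measurable[of "E \<inter> {s<..<t}"]) (use sM E sets_eq_imp_space_eq[OF sM] in auto)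
  qed
  have I_st: "{s..<t} \<subseteq> I" using st by auto
  have I_st': "x \<in> I" if "s < x" "x < t" for x using st that by auto
  have z0: "(LINT x:C|M. D x) = 0" if "emeasure M N = 0" "C \<subseteq> N" "sets M = sets borel" "N \<in> sets borel" for M C N
  proof -
    have "N \<in> null_sets M" using that by auto
    then have "AE x in M. x \<notin> N" by (rule AE_not_in)
    then have "AE x in M. indicat_real C x *\<^sub>R D x = 0"
      by eventually_elim (use that in \<open>auto simp: indicator_def\<close>)
    then show ?thesis unfolding set_lebesgue_integral_def by (rule integral_eq_zero_AE)
  qed
  \<comment> \<open>On \<open>A\<close> only the positive part has mass, on its complement only the
    negative part.\<close>
  have 1: "emeasure (fst sig) (A \<inter> {s<..<t}) = 0"
  proof (rule null)
    fix B assume B: "B \<in> sets borel" "slint sig (B \<inter> A \<inter> {s..<t}) D = 0"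
    have "(LINT x:B \<inter> A \<inter> {s..<t}|snd sig. D x) = 0"
      by (rule z0[OF A(3)]) (use I_st A sets in auto)
    then show "(LINT x:B \<inter> A \<inter> {s..<t}|fst sig. D x) = 0" using B by (simp add: slint_def)
  qed (use A in auto)
  have 2: "emeasure (snd sig) ((UNIV - A) \<inter> {s<..<t}) = 0"
  proof (rule null)
    fix B assume B: "B \<in> sets borel" "slint sig (B \<inter> (UNIV - A) \<inter> {s..<t}) D = 0"
    have "(LINT x:B \<inter> (UNIV - A) \<inter> {s..<t}|fst sig. D x) = 0"
      by (rule z0[OF A(2)]) (use I_st A sets in auto)
    then show "(LINT x:B \<inter> (UNIV - A) \<inter> {s..<t}|snd sig. D x) = 0" using B by (simp add: slint_def)
  qed (use A in auto)
  have le0: "emeasure M X = 0" if "emeasure M Y = 0" "emeasure M Z = 0" "X \<subseteq> Y \<union> Z" "sets M = sets borel" "Y \<in> sets borel" "Z \<in> sets borel" for M X Y Z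
  proof -
    have "Y \<union> Z \<in> null_sets M" using that by auto
    then have "emeasure M (Y \<union> Z) = 0" by auto
    moreover have "emeasure M X \<le> emeasure M (Y \<union> Z)" by (rule emeasure_mono) (use that in auto)
    ultimately show ?thesis by simp
  qed
  have f0: "emeasure (fst sig) {s<..<t} = 0"
    by (rule le0[OF 1 A(2)]) (use A sets in \<open>auto simp: I_st'\<close>)
  have s0: "emeasure (snd sig) {s<..<t} = 0"
    by (rule le0[OF 2 A(3)]) (use A sets in \<open>auto simp: I_st'\<close>)
  \<comment> \<open>The support is defined through balls, and this is the ball that fills
    \<open>(s, t)\<close>.\<close>
  define m e where "m = (s + t) / 2" and "e = (t - s) / 2"
  have "m - e = s" "m + e = t" by (simp_all add: m_def e_def field_simps)
  then have be: "ball m e = {s<..<t}" by (simp add: ball_eq_greaterThanLessThan)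
  have e: "e > 0" using st by (simp add: e_def)
  have "m \<in> {s..t}" using st by (simp add: m_def)
  then have mI: "m \<in> I" using st by blast
  have "emeasure (fst sig) (ball m e \<inter> I) + emeasure (snd sig) (ball m e \<inter> I) \<noteq> 0"
    using supp_sig mI e unfolding ssupp_def by blast
  moreover have "ball m e \<inter> I = {s<..<t}" using be I_st by auto
  ultimately show False using f0 s0 by simp
qed

text \<open>The increment of \<open>D\<close> up to \<open>y\<close> is an integral over
  \<open>[x, y)\<close>, a set that shrinks to the empty one. So \<open>D\<close> is left-continuous
  at \<open>y\<close>, and zeros that accumulate there from the left determine its value.\<close>

lemma left_continuous_zero:
  assumes s: "s < y" "{s..y} \<subseteq> I" and k: "set_integrable rho {s..<y} k"
    and D: "\<And>x. s \<le> x \<Longrightarrow> x < y \<Longrightarrow> D y - D x = (LINT t:{x..<y}|rho. k t)"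
    and dense: "\<And>x. s \<le> x \<Longrightarrow> x < y \<Longrightarrow> \<exists>r\<in>{x<..<y}. D r = (0::complex)"
  shows "D y = 0"
proof -
  define x where "x = (\<lambda>n::nat. y - (y - s) / real (Suc n))"
  have x: "s \<le> x n" "x n < y" for n
  proof -
    have "(y - s) / real (Suc n) \<le> (y - s) / 1"
      using s by (intro divide_left_mono) auto
    then show "s \<le> x n" by (simp add: x_def)
    show "x n < y" using s by (simp add: x_def)
  qed
  define r where "r = (\<lambda>n. SOME r. r \<in> {x n<..<y} \<and> D r = 0)"
  have "r n \<in> {x n<..<y} \<and> D (r n) = 0" for n
    unfolding r_def by (rule someI_ex) (use dense[OF x] in blast)
  then have r: "\<And>n. x n < r n" "\<And>n. r n < y" "\<And>n. D (r n) = 0" by auto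
  have "(\<lambda>n. (y - s) * inverse (real (Suc n))) \<longlonglongrightarrow> (y - s) * 0"
    by (intro tendsto_mult tendsto_const LIMSEQ_inverse_real_of_nat)
  then have "(\<lambda>n. y - (y - s) * inverse (real (Suc n))) \<longlonglongrightarrow> y - (y - s) * 0"
    by (intro tendsto_diff tendsto_const)
  then have xl: "x \<longlonglongrightarrow> y" by (simp add: x_def divide_inverse)
  have rl: "r \<longlonglongrightarrow> y"
    by (rule tendsto_sandwich[OF _ _ xl tendsto_const]) (use r in \<open>auto intro!: always_eventually less_imp_le\<close>)
  have "(\<lambda>n. LINT t:{r n..<y}|rho. k t) \<longlonglongrightarrow> (LINT t|rho. 0)"
    unfolding set_lebesgue_integral_def
  proof (rule integral_dominated_convergence[where w = "\<lambda>t. norm (indicat_real {s..<y} t *\<^sub>R k t)"])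
    show "integrable rho (\<lambda>t. norm (indicat_real {s..<y} t *\<^sub>R k t))"
      using k unfolding set_integrable_def by (rule integrable_norm)
    show "(\<lambda>t. indicat_real {r n..<y} t *\<^sub>R k t) \<in> borel_measurable rho" for n
    proof -
      have "s \<le> r n" using x(1)[of n] r(1)[of n] by simp
      then have "set_integrable rho {r n..<y} k" by (intro set_integrable_subset[OF k]) (auto simp: sets_rho)
      then show ?thesis unfolding set_integrable_def by (rule borel_measurable_integrable)
    qed
    show "AE t in rho. norm (indicat_real {r n..<y} t *\<^sub>R k t) \<le> norm (indicat_real {s..<y} t *\<^sub>R k t)" for n
      using x(1)[of n] r(1)[of n] by (intro AE_I2) (auto simp: indicator_def)
    show "AE t in rho. (\<lambda>n. indicat_real {r n..<y} t *\<^sub>R k t) \<longlonglongrightarrow> 0"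
    proof (intro AE_I2)
      fix t
      show "(\<lambda>n. indicat_real {r n..<y} t *\<^sub>R k t) \<longlonglongrightarrow> 0"
      proof (cases "t < y")
        case True
        then have "eventually (\<lambda>n. t < r n) sequentially" by (rule order_tendstoD(1)[OF rl])
        then have "eventually (\<lambda>n. indicat_real {r n..<y} t *\<^sub>R k t = 0) sequentially"
          by eventually_elim auto
        then show ?thesis by (rule tendsto_eventually)
      qed simp
    qed
  qed simp
  moreover have "(LINT t:{r n..<y}|rho. k t) = D y" for n
    using D[of "r n"] r(2,3)[of n] less_imp_le[OF less_le_trans[OF le_less_trans[OF x(1)[of n] r(1)[of n]] order.refl]] by simp
  ultimately have "(\<lambda>n::nat. D y) \<longlonglongrightarrow> 0" by simp
  then show "D y = 0" by (simp add: LIMSEQ_const_iff)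
qed

text \<open>\<open>p\<close> is determined \<open>|\<sigma>|\<close>-almost everywhere by \<open>f\<close>, and it is left-continuous, so the
full support of \<open>\<sigma>\<close> determines it everywhere.\<close>
lemma quasi_derivative_unique:
  assumes f: "sol I f p g" and f': "sol I f p' g'" and y: "y \<in> I"
  shows "p y = p' y"
proof -
  define D where "D = (\<lambda>x. p x - p' x)"
  obtain s where s: "s \<in> I" "s < y"
  proof -
    obtain z where "a < ereal z" "ereal z < ereal y" using y ereal_dense2[of a "ereal y"] by (auto simp: ivl_def)
    then show ?thesis using y that[of z] by (simp add: ivl_def) (use less_trans[of "ereal z" "ereal y" b] in simp)
  qed
  have sub: "{s..y} \<subseteq> I" by (rule ivl_subset[OF s(1) y])
  have xI: "x \<in> I" if "s \<le> x" "x \<le> y" for x using sub that by auto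
  have z: "slint sig {x..<x'} D = 0" if "s \<le> x" "x \<le> x'" "x' \<le> y" for x x'
  proof (cases "x = x'")
    case False
    then have l: "x < x'" using that by simp
    have i: "x \<in> I" "x' \<in> I" using that xI by auto
    have si: "sintg sig {x..<x'} p" "sintg sig {x..<x'} p'"
      using solD(2)[OF f i l] solD(2)[OF f' i l] fin_on_sig[OF ivl_subset[OF i]] by (auto intro: sintg_bm)
    show ?thesis unfolding D_def slint_diff[OF si] using solD(4)[OF f i l] solD(4)[OF f' i l] by simp
  qed simp
  \<comment> \<open>Both systems share \<open>f\<close>, so the \<open>chi\<close> terms cancel and
    the difference of the quasi-derivatives is a primitive of \<open>g' - g\<close> for
    \<open>rho\<close> alone.\<close>
  have k: "set_integrable rho {s..<y} (\<lambda>t. g' t - g t)"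
    using solD(3)[OF f s(1) y s(2)] solD(3)[OF f' s(1) y s(2)] by simp
  have "D y = 0"
  proof (rule left_continuous_zero[OF s(2) sub k])
    fix x assume x: "s \<le> x" "x < y"
    note i = xI[OF x(1) less_imp_le[OF x(2)]]
    show "D y - D x = (LINT t:{x..<y}|rho. g' t - g t)"
      using solD(3,5)[OF f i y x(2)] solD(3,5)[OF f' i y x(2)]
      by (simp add: D_def slint_pos_measure algebra_simps)
    have "bm_on {x..<y} D" unfolding D_def
      using solD(2)[OF f i y x(2)] solD(2)[OF f' i y x(2)] by (rule bm_on_diff)
    then show "\<exists>r\<in>{x<..<y}. D r = 0"
      by (rule zero_if_slint_zero[OF x(2) ivl_subset[OF i y]]) (use z x in auto)
  qed
  then show ?thesis by (simp add: D_def)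
qed


section \<open>The first-order system and the relation \<open>tau_rel\<close>\<close>

lemma in_I_above: assumes "x \<in> I" obtains y where "x < y" "y \<in> I"
proof -
  obtain z where "ereal x < ereal z" "ereal z < b" using assms ereal_dense2[of "ereal x" b] by (auto simp: ivl_def)
  then show ?thesis using assms that[of z] less_trans[of a "ereal x" "ereal z"] by (simp add: ivl_def)
qed

lemma sint_alt: "sint \<mu> c x h = (if c \<le> x then slint \<mu> {c..<x} h else - slint \<mu> {x..<c} h)"
  by (auto simp: sint_def)

lemma sint_diff:
  assumes fin: "\<And>x y. {x..y} \<subseteq> I \<Longrightarrow> fin_on {x..<y} \<mu>"
    and h: "\<And>x y. {x..y} \<subseteq> I \<Longrightarrow> sintg \<mu> {x..<y} h"
    and xy: "x \<in> I" "y \<in> I" "x \<le> y"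
  shows "sint \<mu> c y h - sint \<mu> c x h = slint \<mu> {x..<y} h"
proof -
  have app: "slint \<mu> {r..<t} h = slint \<mu> {r..<s} h + slint \<mu> {s..<t} h" if "r \<in> I" "t \<in> I" "r \<le> s" "s \<le> t" for r s t
    using ivl_subset[OF that(1,2)] that by (intro slint_append h fin) auto
  consider "c \<le> x" | "x < c" "c \<le> y" | "y < c" by linarith
  then show ?thesis
  proof cases
    case 1
    then show ?thesis using app[of c y x] c_in xy by (simp add: sint_alt)
  next
    case 2
    then show ?thesis using app[of x y c] xy by (simp add: sint_alt)
  next
    case 3
    then show ?thesis using app[of x c y] c_in xy by (simp add: sint_alt)
  qed
qed

lemma loc_int_sintg:
  assumes "loc_int I \<mu> h" "{x..y} \<subseteq> I" "sets (fst \<mu>) = sets borel" "sets (snd \<mu>) = sets borel"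
  shows "sintg \<mu> {x..<y} h"
proof (cases "x \<le> y")
  case True
  then have "x \<in> I" "y \<in> I" using assms by auto
  then have "set_integrable (fst \<mu>) {x..y} h" "set_integrable (snd \<mu>) {x..y} h"
    using assms(1) by (auto simp: loc_int_def)
  then show ?thesis unfolding sintg_def using assms(3,4) by (auto intro: set_integrable_subset)
next
  case False
  then show ?thesis by (simp add: sintg_def)
qed

text \<open>Local integrability is phrased with closed intervals, the system with half-open ones. As
  the interval is open, there is room to move the right end slightly up.\<close>

lemma sintg_loc_int:
  assumes "\<And>x y. x \<in> I \<Longrightarrow> y \<in> I \<Longrightarrow> x < y \<Longrightarrow> sintg \<mu> {x..<y} h" "sets (fst \<mu>) = sets borel" "sets (snd \<mu>) = sets borel"
  shows "loc_int I \<mu> h"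
  unfolding loc_int_def
proof (intro ballI)
  fix s t assume st: "s \<in> I" "t \<in> I"
  show "set_integrable (fst \<mu>) {s..t} h \<and> set_integrable (snd \<mu>) {s..t} h"
  proof (cases "s \<le> t")
    case True
    obtain t' where t': "t < t'" "t' \<in> I" using in_I_above[OF st(2)] .
    have "sintg \<mu> {s..<t'} h" using assms(1)[OF st(1) t'(2)] True t' by simp
    then show ?thesis using assms(2,3) t' unfolding sintg_def by (auto intro: set_integrable_subset)
  qed simp
qed

lemma sets_sig: "sets (fst sig) = sets borel" "sets (snd sig) = sets borel"
  and sets_chi: "sets (fst chi) = sets borel" "sets (snd chi) = sets borel"
  and sets_pos: "sets (fst (pos_measure rho)) = sets borel" "sets (snd (pos_measure rho)) = sets borel"
  using sig_lf chi_lf by (auto simp: real_lf_measure_def loc_finite_def pos_measure_def sets_rho)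

text \<open>The density \<open>h\<close> is known only almost everywhere, but it enters through
  integrals alone and may be exchanged for the function \<open>sint chi c x f - F x\<close>, which
  is defined everywhere.\<close>

lemma datum_sol:
  assumes f: "AC_dens I sig c f h" and F: "AC_dens I (pos_measure rho) c F g"
    and ae: "sAE I sig (\<lambda>x. F x = - h x + sint chi c x f)"
  shows "sol I f (\<lambda>x. sint chi c x f - F x) g"
proof -
  define p where "p = (\<lambda>x. sint chi c x f - F x)"
  have ih: "sintg sig {x..<y} h" if "{x..y} \<subseteq> I" for x y
    using f that by (intro loc_int_sintg sets_sig) (auto simp: AC_dens_def)
  have ig: "sintg (pos_measure rho) {x..<y} g" if "{x..y} \<subseteq> I" for x y
    using F that by (intro loc_int_sintg sets_pos) (auto simp: AC_dens_def)
  have df: "f y - f x = slint sig {x..<y} h" if "x \<in> I" "y \<in> I" "x \<le> y" for x y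
    using f sint_diff[OF fin_on_sig ih that] that by (simp add: AC_dens_def)
  have dF: "F y - F x = slint (pos_measure rho) {x..<y} g" if "x \<in> I" "y \<in> I" "x \<le> y" for x y
  proof -
    have "F y = F c + sint (pos_measure rho) c y g" "F x = F c + sint (pos_measure rho) c x g"
      using F that by (auto simp: AC_dens_def)
    then show ?thesis using sint_diff[OF fin_on_rho ig that] by simp
  qed
  have bf: "bm_on {x..<y} f" if xy: "x \<in> I" "y \<in> I" for x y
  proof -
    have sub: "{x..y} \<subseteq> I" by (rule ivl_subset[OF xy])
    have "bm_on {x..y} (\<lambda>t. f x + slint sig {x..<t} h)"
      by (intro bm_on_add bm_on_const slint_primitive_bm ih fin_on_sig sub) simp
    then have "bm_on {x..<y} (\<lambda>t. f x + slint sig {x..<t} h)" by (rule bm_on_subset) auto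
    moreover have "f t = f x + slint sig {x..<t} h" if "t \<in> {x..<y}" for t
    proof -
      have "t \<in> I" "x \<le> t" using that sub by auto
      then show ?thesis using df[of x t] xy by (simp add: algebra_simps)
    qed
    ultimately show ?thesis using bm_on_cong[of "{x..<y}" f "\<lambda>t. f x + slint sig {x..<t} h"] by blast
  qed
  have if': "sintg chi {x..<y} f" if "{x..y} \<subseteq> I" for x y
  proof (cases "x \<le> y")
    case True
    then show ?thesis using that by (intro sintg_bm fin_on_chi bf) auto
  qed (simp add: sintg_def)
  have dp: "p y - p x = slint chi {x..<y} f - slint (pos_measure rho) {x..<y} g" if "x \<in> I" "y \<in> I" "x \<le> y" for x y
    using sint_diff[OF fin_on_chi if' that] dF[OF that] by (simp add: p_def algebra_simps)
  have bp: "bm_on {x..<y} p" if xy: "x \<in> I" "y \<in> I" for x y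
  proof -
    have sub: "{x..y} \<subseteq> I" by (rule ivl_subset[OF xy])
    let ?P = "\<lambda>t. p x + (slint chi {x..<t} f - slint (pos_measure rho) {x..<t} g)"
    have "bm_on {x..y} ?P"
      by (intro bm_on_add bm_on_diff bm_on_const slint_primitive_bm if' ig fin_on_chi fin_on_rho sub) simp
    then have "bm_on {x..<y} ?P" by (rule bm_on_subset) auto
    moreover have "p t = ?P t" if "t \<in> {x..<y}" for t
    proof -
      have "t \<in> I" "x \<le> t" using that sub by auto
      then show ?thesis using dp[of x t] xy by (simp add: algebra_simps)
    qed
    ultimately show ?thesis using bm_on_cong[of "{x..<y}" p ?P] by blast
  qed
  have hp: "slint sig {x..<y} h = slint sig {x..<y} p" if xy: "x \<in> I" "y \<in> I" for x y
  proof -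
    have sub: "{x..y} \<subseteq> I" by (rule ivl_subset[OF xy])
    have "(LINT t:{x..<y}|M. h t) = (LINT t:{x..<y}|M. p t)" if M: "M \<in> {fst sig, snd sig}" for M
      unfolding set_lebesgue_integral_def
    proof (rule Bochner_Integration.integral_cong_AE)
      show "(\<lambda>t. indicat_real {x..<y} t *\<^sub>R h t) \<in> borel_measurable M"
        using ih[OF sub] M by (auto simp: sintg_def set_integrable_def dest!: borel_measurable_integrable)
      have "sintg sig {x..<y} p" by (rule sintg_bm[OF fin_on_sig[OF sub] _ bp[OF xy]]) simp
      then show "(\<lambda>t. indicat_real {x..<y} t *\<^sub>R p t) \<in> borel_measurable M"
        using M by (auto simp: sintg_def set_integrable_def dest!: borel_measurable_integrable)
      have "AE t in M. t \<in> I \<longrightarrow> F t = - h t + sint chi c t f" using ae M by (auto simp: sAE_def)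
      then show "AE t in M. indicat_real {x..<y} t *\<^sub>R h t = indicat_real {x..<y} t *\<^sub>R p t"
      proof eventually_elim
        case (elim t)
        have "t \<in> I" if "t \<in> {x..<y}" using that sub by auto
        then show ?case using elim by (auto simp: p_def indicator_def)
      qed
    qed
    then show ?thesis by (simp add: slint_def)
  qed
  have "sol I f p g" unfolding sol_def
  proof (intro ballI impI)
    fix x y assume xy: "x \<in> I" "y \<in> I" "x < y"
    show "bm_on {x..<y} f \<and> bm_on {x..<y} p \<and> set_integrable rho {x..<y} g \<and>
      f y - f x = slint sig {x..<y} p \<and> p y - p x = slint chi {x..<y} f - (LINT t:{x..<y}|rho. g t)"
      using bf[OF xy(1,2)] bp[OF xy(1,2)] ig[OF ivl_subset[OF xy(1,2)]] df[OF xy(1,2)] dp[OF xy(1,2)] hp[OF xy(1,2)] xy(3)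
      by (simp add: sintg_pos_measure slint_pos_measure)
  qed
  then show ?thesis by (simp add: p_def)
qed

lemma sol_datum:
  assumes s: "sol I f p g"
  shows "AC_dens I sig c f p" "AC_dens I (pos_measure rho) c (\<lambda>x. sint chi c x f - p x) g"
    "sAE I sig (\<lambda>x. sint chi c x f - p x = - p x + sint chi c x f)"
proof -
  have ip: "sintg sig {x..<y} p" if "x \<in> I" "y \<in> I" "x < y" for x y
    by (rule sintg_bm[OF fin_on_sig[OF ivl_subset[OF that(1,2)]] _ solD(2)[OF s that]]) simp
  have lp: "loc_int I sig p" by (rule sintg_loc_int[OF ip sets_sig])
  have ig: "sintg (pos_measure rho) {x..<y} g" if "x \<in> I" "y \<in> I" "x < y" for x y
    using solD(3)[OF s that] by (simp add: sintg_pos_measure)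
  have lg: "loc_int I (pos_measure rho) g" by (rule sintg_loc_int[OF ig sets_pos])
  show "AC_dens I sig c f p"
    unfolding AC_dens_def
  proof (intro conjI ballI lp)
    fix x assume x: "x \<in> I"
    show "f x = f c + sint sig c x p"
      using solD_le(1)[OF s c_in x] solD_le(1)[OF s x c_in] by (auto simp: sint_alt algebra_simps)
  qed
  show "AC_dens I (pos_measure rho) c (\<lambda>x. sint chi c x f - p x) g"
    unfolding AC_dens_def
  proof (intro conjI ballI lg)
    fix x assume x: "x \<in> I"
    show "sint chi c x f - p x = sint chi c c f - p c + sint (pos_measure rho) c x g"
      using solD_le(2)[OF s c_in x] solD_le(2)[OF s x c_in] by (auto simp: sint_alt algebra_simps)
  qed
  show "sAE I sig (\<lambda>x. sint chi c x f - p x = - p x + sint chi c x f)" by (simp add: sAE_def)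
qed

abbreviation "\<tau> \<equiv> tau_rel I rho sig chi c"
abbreviation "qd \<equiv> qderiv I rho sig chi c"
abbreviation "W \<equiv> wronsk I rho sig chi c"

lemma sol_tau: "sol I f p g \<Longrightarrow> \<tau> f g"
  unfolding tau_rel_def qd_datum_def using sol_datum by blast

text \<open>The datum that the choice operator selects for \<open>qd\<close> need not be the witness
  of \<open>\<tau> f g\<close>; \<open>quasi_derivative_unique\<close> identifies the resulting
  quasi-derivatives on the interval.\<close>

lemma tau_sol:
  assumes "\<tau> f g"
  shows "sol I f (qd f) g"
proof -
  obtain F h where F: "AC_dens I (pos_measure rho) c F g" "AC_dens I sig c f h"
      "sAE I sig (\<lambda>x. F x = - h x + sint chi c x f)" "qd_datum I rho sig chi c f F"
    using assms unfolding tau_rel_def qd_datum_def by blast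
  define F' where "F' = (SOME F. qd_datum I rho sig chi c f F)"
  have "qd_datum I rho sig chi c f F'" unfolding F'_def by (rule someI[of _ F]) (rule F(4))
  then obtain h' g' where F': "AC_dens I (pos_measure rho) c F' g'" "AC_dens I sig c f h'"
      "sAE I sig (\<lambda>x. F' x = - h' x + sint chi c x f)"
    unfolding qd_datum_def by blast
  have q: "qd f = (\<lambda>x. sint chi c x f - F' x)" unfolding qderiv_def F'_def ..
  note s = datum_sol[OF F(2,1,3)] and s' = datum_sol[OF F'(2,1,3)]
  have J: "{x..y} \<subseteq> I \<inter> I" if "x \<in> I" "y \<in> I" for x y using ivl_subset[OF that] by simp
  show ?thesis
  proof (rule sol_cong[OF J _ _ s])
    fix x assume "x \<in> I"
    then show "sint chi c x f - F x = qd f x" unfolding q by (rule quasi_derivative_unique[OF s s'])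
  qed auto
qed

lemma W_eq: "W f u x = f x * qd u x - qd f x * u x"
  by (simp add: wronsk_def)

lemma tau_add: "\<tau> f g \<Longrightarrow> \<tau> u v \<Longrightarrow> \<tau> (\<lambda>x. f x + u x) (\<lambda>x. g x + v x)"
  using sol_tau[OF sol_add[OF ivl_subset tau_sol tau_sol]] .

lemma tau_cmult: "\<tau> f g \<Longrightarrow> \<tau> (\<lambda>x. k * f x) (\<lambda>x. k * g x)"
  using sol_tau[OF sol_cmult[OF ivl_subset tau_sol]] .

lemma tau_cnj: "\<tau> f g \<Longrightarrow> \<tau> (\<lambda>x. cnj (f x)) (\<lambda>x. cnj (g x))"
  using sol_tau[OF sol_cnj[OF ivl_subset tau_sol]] .

lemma W_lagrange:
  assumes "\<tau> f g" "\<tau> u v" "x \<le> y" "x \<in> I" "y \<in> I"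
  shows "W f u y - W f u x = (LINT t:{x..<y}|rho. g t * u t - f t * v t)"
  unfolding W_eq
  by (rule lagrange_identity(1)[OF tau_sol[OF assms(1)] tau_sol[OF assms(2)] assms(3)]) (use ivl_subset[OF assms(4,5)] in auto)

subsection \<open>Square-integrable functions\<close>

abbreviation "LL \<equiv> L2 I rho"

lemma set_borel_mult:
  assumes "set_borel_measurable rho I f" "set_borel_measurable rho I (u :: real \<Rightarrow> complex)"
  shows "set_borel_measurable rho I (\<lambda>x. f x * u x)"
proof -
  have "(\<lambda>x. indicat_real I x *\<^sub>R (f x * u x)) = (\<lambda>x. (indicat_real I x *\<^sub>R f x) * (indicat_real I x *\<^sub>R u x))"
    by (auto simp: indicator_def fun_eq_iff)
  then show ?thesis using assms unfolding set_borel_measurable_def by (simp only: borel_measurable_times)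
qed

lemma set_borel_measurable_cmod_square:
  assumes "set_borel_measurable M A (f :: real \<Rightarrow> complex)"
  shows "set_borel_measurable M A (\<lambda>x. (cmod (f x))\<^sup>2)"
proof -
  have "(\<lambda>x. indicat_real A x *\<^sub>R (cmod (f x))\<^sup>2) = (\<lambda>x. (cmod (indicat_real A x *\<^sub>R f x))\<^sup>2)"
    by (auto simp: indicator_def fun_eq_iff)
  then show ?thesis
    using borel_measurable_power[OF measurable_compose[OF assms[unfolded set_borel_measurable_def] borel_measurable_norm], of 2]
    unfolding set_borel_measurable_def by (simp only:)
qed

lemma L2_mult_integrable:
  assumes f: "LL f" and u: "LL u"
  shows "set_integrable rho I (\<lambda>x. f x * u x)"
proof (rule set_integrable_bound)
  show "set_integrable rho I (\<lambda>x. (cmod (f x))\<^sup>2 + (cmod (u x))\<^sup>2)"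
    using f u unfolding L2_def by (intro set_integral_add) auto
  show "set_borel_measurable rho I (\<lambda>x. f x * u x)"
    using f u unfolding L2_def by (intro set_borel_mult) auto
  have "norm (f x * u x) \<le> norm ((cmod (f x))\<^sup>2 + (cmod (u x))\<^sup>2)" for x
  proof -
    have "cmod (f x) * cmod (u x) \<le> (cmod (f x))\<^sup>2 + (cmod (u x))\<^sup>2"
    proof -
      have "2 * (cmod (f x) * cmod (u x)) \<le> (cmod (f x))\<^sup>2 + (cmod (u x))\<^sup>2"
        using sum_squares_bound[of "cmod (f x)" "cmod (u x)"] by (simp add: mult.assoc)
      moreover have "0 \<le> cmod (f x) * cmod (u x)" by simp
      ultimately show ?thesis by linarith
    qed
    then show ?thesis by (simp add: norm_mult)
  qed
  then show "AE x in rho. x \<in> I \<longrightarrow> norm (f x * u x) \<le> norm ((cmod (f x))\<^sup>2 + (cmod (u x))\<^sup>2)" by blast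
qed

lemma L2_add:
  assumes f: "LL f" and u: "LL u"
  shows "LL (\<lambda>x. f x + u x)"
  unfolding L2_def
proof
  have "(\<lambda>x. indicat_real I x *\<^sub>R (f x + u x)) = (\<lambda>x. (indicat_real I x *\<^sub>R f x) + (indicat_real I x *\<^sub>R u x))"
    by (auto simp: scaleR_add_right)
  then show m: "set_borel_measurable rho I (\<lambda>x. f x + u x)"
    using f u unfolding L2_def set_borel_measurable_def by (simp only: borel_measurable_add)
  show "set_integrable rho I (\<lambda>x. (cmod (f x + u x))\<^sup>2)"
  proof (rule set_integrable_bound)
    show "set_integrable rho I (\<lambda>x. 2 * (cmod (f x))\<^sup>2 + 2 * (cmod (u x))\<^sup>2)"
      using f u unfolding L2_def by (intro set_integral_add set_integrable_mult_right) auto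
    show "set_borel_measurable rho I (\<lambda>x. (cmod (f x + u x))\<^sup>2)"
      by (rule set_borel_measurable_cmod_square[OF m])
    have "norm ((cmod (f x + u x))\<^sup>2) \<le> norm (2 * (cmod (f x))\<^sup>2 + 2 * (cmod (u x))\<^sup>2)" for x
    proof -
      have "(cmod (f x + u x))\<^sup>2 \<le> (cmod (f x) + cmod (u x))\<^sup>2" by (intro power_mono norm_triangle_ineq) auto
      also have "\<dots> \<le> 2 * (cmod (f x))\<^sup>2 + 2 * (cmod (u x))\<^sup>2"
        using sum_squares_bound[of "cmod (f x)" "cmod (u x)"] by (simp add: power2_sum)
      finally show ?thesis by simp
    qed
    then show "AE x in rho. x \<in> I \<longrightarrow> norm ((cmod (f x + u x))\<^sup>2) \<le> norm (2 * (cmod (f x))\<^sup>2 + 2 * (cmod (u x))\<^sup>2)" by blast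
  qed
qed

lemma L2_cmult:
  assumes f: "LL f"
  shows "LL (\<lambda>x. k * f x)"
proof -
  have "(\<lambda>x. indicat_real I x *\<^sub>R (k * f x)) = (\<lambda>x. k * (indicat_real I x *\<^sub>R f x))" by auto
  then have "set_borel_measurable rho I (\<lambda>x. k * f x)"
    using f unfolding L2_def set_borel_measurable_def by (simp only: borel_measurable_times borel_measurable_const)
  then show ?thesis using f unfolding L2_def by (simp add: norm_mult power_mult_distrib)
qed

lemma L2_cnj:
  assumes f: "LL f"
  shows "LL (\<lambda>x. cnj (f x))"
proof -
  have "(\<lambda>x. indicat_real I x *\<^sub>R cnj (f x)) = (\<lambda>x. cnj (indicat_real I x *\<^sub>R f x))" by auto
  moreover have "(\<lambda>x. cnj (indicat_real I x *\<^sub>R f x)) \<in> borel_measurable rho"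
    by (rule borel_measurable_continuous_on[of cnj]) (use f in \<open>auto simp: L2_def set_borel_measurable_def intro!: continuous_intros\<close>)
  ultimately have "set_borel_measurable rho I (\<lambda>x. cnj (f x))" unfolding set_borel_measurable_def by simp
  then show ?thesis using f unfolding L2_def by simp
qed

lemma L2_cmod:
  assumes f: "LL f"
  shows "LL (\<lambda>x. complex_of_real (cmod (f x)))"
proof -
  have "(\<lambda>x. indicat_real I x *\<^sub>R complex_of_real (cmod (f x))) = (\<lambda>x. complex_of_real (cmod (indicat_real I x *\<^sub>R f x)))"
    by (auto simp: indicator_def fun_eq_iff)
  moreover have "(\<lambda>x. complex_of_real (cmod (indicat_real I x *\<^sub>R f x))) \<in> borel_measurable rho"
    by (rule borel_measurable_continuous_on[of "\<lambda>z. complex_of_real (cmod z)"]) (use f in \<open>auto simp: L2_def set_borel_measurable_def intro!: continuous_intros\<close>)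
  ultimately have "set_borel_measurable rho I (\<lambda>x. complex_of_real (cmod (f x)))" unfolding set_borel_measurable_def by simp
  then show ?thesis using f unfolding L2_def by simp
qed

lemma L2_loc_integrable:
  assumes f: "LL f" and xy: "{x..y} \<subseteq> I"
  shows "set_integrable rho {x..<y} f"
proof (rule set_integrable_bound)
  have fin: "emeasure rho {x..<y} < \<infinity>" using fin_on_rho[OF xy] by (simp add: fin_on_def pos_measure_def)
  have sub: "{x..<y} \<subseteq> I" using xy by auto
  have "set_integrable rho {x..<y} (\<lambda>x. (cmod (f x))\<^sup>2)"
    using f set_integrable_subset[of rho I _ "{x..<y}"] sub sets_rho by (auto simp: L2_def)
  moreover have "set_integrable rho {x..<y} (\<lambda>x. 1::real)"
    unfolding set_integrable_def using fin sets_rho by simp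
  ultimately show "set_integrable rho {x..<y} (\<lambda>x. (cmod (f x))\<^sup>2 + 1)" by (rule set_integral_add)
  show "set_borel_measurable rho {x..<y} f"
    by (rule set_borel_measurable_subset[of _ I]) (use f sub sets_rho in \<open>auto simp: L2_def\<close>)
  have "norm (f t) \<le> norm ((cmod (f t))\<^sup>2 + 1)" for t
  proof -
    have "2 * cmod (f t) \<le> (cmod (f t))\<^sup>2 + 1" using sum_squares_bound[of "cmod (f t)" 1] by simp
    then have "cmod (f t) \<le> (cmod (f t))\<^sup>2 + 1" using norm_ge_zero[of "f t"] by linarith
    then show ?thesis by simp
  qed
  then show "AE t in rho. t \<in> {x..<y} \<longrightarrow> norm (f t) \<le> norm ((cmod (f t))\<^sup>2 + 1)" by blast
qed

lemma exhausting_sequences: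
  obtains u l :: "nat \<Rightarrow> real" where "I = (\<Union>i. {l i .. u i})" "incseq u" "decseq l"
    "\<And>i. l i < u i" "\<And>i. l i \<in> I" "\<And>i. u i \<in> I"
proof (rule einterval_Icc_approximation[OF a_less_b])
  fix u l :: "nat \<Rightarrow> real"
  assume ul: "einterval a b = (\<Union>i. {l i .. u i})" "incseq u" "decseq l" "\<And>i. l i < u i"
  have I: "I = (\<Union>i. {l i .. u i})" using ul(1) by (simp add: ivl_def einterval_def)
  have "l i \<in> {l i..u i}" "u i \<in> {l i..u i}" for i using ul(4)[of i] by auto
  then have "l i \<in> I" "u i \<in> I" for i unfolding I by blast+
  then show thesis using that I ul by blast
qed

lemma sol_borel_measurable:
  assumes s: "sol I f p g"
  shows "set_borel_measurable rho I f"
proof -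
  obtain u l :: "nat \<Rightarrow> real" where ul: "I = (\<Union>i. {l i .. u i})" "incseq u" "decseq l"
      "\<And>i. l i < u i" "\<And>i. l i \<in> I" "\<And>i. u i \<in> I"
    by (rule exhausting_sequences) blast
  have m: "(\<lambda>x. indicat_real {l i..<u i} x *\<^sub>R f x) \<in> borel_measurable rho" for i
    using solD(1)[OF s ul(5,6,4)] by (simp add: bm_on_def bd_meas_def measurable_cong_sets[OF sets_rho refl])
  show ?thesis unfolding set_borel_measurable_def
  proof (rule borel_measurable_LIMSEQ_metric[OF m])
    fix x
    show "(\<lambda>i. indicat_real {l i..<u i} x *\<^sub>R f x) \<longlonglongrightarrow> indicat_real I x *\<^sub>R f x"
    proof (cases "x \<in> I")
      case True
      \<comment> \<open>A point above \<open>x\<close> is needed because the approximating pieces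
        omit their right end.\<close>
      then obtain x' where x': "x < x'" "x' \<in> I" by (rule in_I_above)
      obtain i j where i: "x \<in> {l i..u i}" and j: "x' \<in> {l j..u j}" using True x'(2) ul(1) by blast
      have "x \<in> {l n..<u n}" if "n \<ge> max i j" for n
        using decseqD[OF ul(3), of i n] incseqD[OF ul(2), of j n] i j x'(1) that by auto
      then have "eventually (\<lambda>n. indicat_real {l n..<u n} x *\<^sub>R f x = indicat_real I x *\<^sub>R f x) sequentially"
        unfolding eventually_sequentially using True by (intro exI[of _ "max i j"]) auto
      then show ?thesis by (rule tendsto_eventually)
    next
      case False
      then have "x \<notin> {l n..<u n}" for n using ul(1) by auto
      then show ?thesis using False by simp
    qed
  qed
qed


subsection \<open>Boundary limits of the Wronskian\<close>

abbreviation "Fa \<equiv> left_end a"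
abbreviation "Fb \<equiv> right_end b"

lemma left_end_nontrivial: "Fa \<noteq> bot" and right_end_nontrivial: "Fb \<noteq> bot"
  by (auto simp: left_end_def right_end_def)

lemma eventually_left_end: assumes "x0 \<in> I" shows "eventually (\<lambda>x. x \<in> I \<and> x < x0) Fa"
proof (cases a)
  case (real r)
  have r: "r < x0" using assms real by (simp add: ivl_def)
  have "eventually (\<lambda>x. x \<in> {r<..<x0}) (at_right r)" by (rule eventually_at_right_real[OF r])
  then have "eventually (\<lambda>x. x \<in> I \<and> x < x0) (at_right r)"
  proof eventually_elim
    case (elim x)
    then have "ereal x < ereal x0" "ereal x0 < b" using assms by (auto simp: ivl_def)
    then have "ereal x < b" by (rule less_trans)
    then show ?case using elim real by (simp add: ivl_def)
  qed
  then show ?thesis using real by (simp add: left_end_def)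
next
  case PInf
  then show ?thesis using a_less_b by simp
next
  case MInf
  have "eventually (\<lambda>x. x < x0) (at_bot :: real filter)" by (rule eventually_gt_at_bot)
  then have "eventually (\<lambda>x. x \<in> I \<and> x < x0) at_bot"
  proof eventually_elim
    case (elim x)
    then have "ereal x < ereal x0" "ereal x0 < b" using assms by (auto simp: ivl_def)
    then have "ereal x < b" by (rule less_trans)
    then show ?case using elim MInf by (simp add: ivl_def)
  qed
  then show ?thesis using MInf by (simp add: left_end_def)
qed

lemma eventually_right_end: assumes "x0 \<in> I" shows "eventually (\<lambda>x. x \<in> I \<and> x0 < x) Fb"
proof (cases b)
  case (real r)
  have r: "x0 < r" using assms real by (simp add: ivl_def)
  have "eventually (\<lambda>x. x \<in> {x0<..<r}) (at_left r)" by (rule eventually_at_left_real[OF r])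
  then have "eventually (\<lambda>x. x \<in> I \<and> x0 < x) (at_left r)"
  proof eventually_elim
    case (elim x)
    then have "ereal x0 < ereal x" "a < ereal x0" using assms by (auto simp: ivl_def)
    then have "a < ereal x" by (meson less_trans)
    then show ?case using elim real by (simp add: ivl_def)
  qed
  then show ?thesis using real by (simp add: right_end_def)
next
  case MInf
  then show ?thesis using a_less_b by simp
next
  case PInf
  have "eventually (\<lambda>x. x0 < x) (at_top :: real filter)" by (rule eventually_gt_at_top)
  then have "eventually (\<lambda>x. x \<in> I \<and> x0 < x) at_top"
  proof eventually_elim
    case (elim x)
    then have "ereal x0 < ereal x" "a < ereal x0" using assms by (auto simp: ivl_def)
    then have "a < ereal x" by (meson less_trans)
    then show ?case using elim PInf by (simp add: ivl_def)
  qed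
  then show ?thesis using PInf by (simp add: right_end_def)
qed

lemma vanishing_tail:
  fixes A :: "nat \<Rightarrow> real set" and K :: "real \<Rightarrow> real"
  assumes K: "set_integrable rho I K" and A: "\<And>n. A n \<in> sets borel" "\<And>n. A n \<subseteq> I"
    and ev: "\<And>t. t \<in> I \<Longrightarrow> eventually (\<lambda>n. t \<notin> A n) sequentially"
  shows "(\<lambda>n. LINT t:A n|rho. K t) \<longlonglongrightarrow> 0"
proof -
  have "(\<lambda>n. LINT t:A n|rho. K t) \<longlonglongrightarrow> (LINT t|rho. 0)"
    unfolding set_lebesgue_integral_def
  proof (rule integral_dominated_convergence[where w = "\<lambda>t. norm (indicat_real I t *\<^sub>R K t)"])
    show "integrable rho (\<lambda>t. norm (indicat_real I t *\<^sub>R K t))"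
      using K unfolding set_integrable_def by (rule integrable_norm)
    show "(\<lambda>t. indicat_real (A n) t *\<^sub>R K t) \<in> borel_measurable rho" for n
    proof -
      have "set_integrable rho (A n) K" by (rule set_integrable_subset[OF K]) (use A sets_rho in auto)
      then show ?thesis unfolding set_integrable_def by (rule borel_measurable_integrable)
    qed
    show "AE t in rho. norm (indicat_real (A n) t *\<^sub>R K t) \<le> norm (indicat_real I t *\<^sub>R K t)" for n
      using A(2)[of n] by (intro AE_I2) (auto simp: indicator_def)
    show "AE t in rho. (\<lambda>n. indicat_real (A n) t *\<^sub>R K t) \<longlonglongrightarrow> 0"
    proof (intro AE_I2)
      fix t
      have "eventually (\<lambda>n. t \<notin> A n) sequentially"
      proof (cases "t \<in> I")
        case False
        then have "t \<notin> A n" for n using A(2)[of n] by blast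
        then show ?thesis by simp
      qed (rule ev)
      then have "eventually (\<lambda>n. indicat_real (A n) t *\<^sub>R K t = 0) sequentially"
        by eventually_elim auto
      then show "(\<lambda>n. indicat_real (A n) t *\<^sub>R K t) \<longlonglongrightarrow> 0" by (rule tendsto_eventually)
    qed
  qed simp
  then show ?thesis by simp
qed

lemma set_integral_mono_set:
  fixes K :: "real \<Rightarrow> real"
  assumes "set_integrable rho B K" "A \<subseteq> B" "A \<in> sets borel" "\<And>t. 0 \<le> K t"
  shows "(LINT t:A|rho. K t) \<le> (LINT t:B|rho. K t)"
proof -
  have "set_integrable rho A K" by (rule set_integrable_subset[OF assms(1)]) (use assms sets_rho in auto)
  then show ?thesis
    using assms unfolding set_lebesgue_integral_def set_integrable_def
    by (intro integral_mono) (auto simp: indicator_def)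
qed

lemma tail_sets: "{t \<in> I. t < x} \<in> sets borel" "{t \<in> I. x \<le> t} \<in> sets borel" "{t \<in> I. x < t} \<in> sets borel"
proof -
  have "{t \<in> I. t < x} = I \<inter> {..<x}" "{t \<in> I. x \<le> t} = I \<inter> {x..}" "{t \<in> I. x < t} = I \<inter> {x<..}" by auto
  then show "{t \<in> I. t < x} \<in> sets borel" "{t \<in> I. x \<le> t} \<in> sets borel" "{t \<in> I. x < t} \<in> sets borel"
    using ivl_borel by auto
qed

lemma tail_left:
  assumes K: "set_integrable rho I K" "\<And>t. 0 \<le> (K t :: real)" and e: "e > 0"
  shows "eventually (\<lambda>x. x \<in> I \<and> (LINT t:{t \<in> I. t < x}|rho. K t) < e) Fa"
proof -
  obtain u l :: "nat \<Rightarrow> real" where ul: "I = (\<Union>i. {l i .. u i})" "incseq u" "decseq l"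
      "\<And>i. l i < u i" "\<And>i. l i \<in> I" "\<And>i. u i \<in> I"
    by (rule exhausting_sequences) blast
  have "(\<lambda>n. LINT t:{t \<in> I. t < l n}|rho. K t) \<longlonglongrightarrow> 0"
  proof (rule vanishing_tail[OF K(1) tail_sets(1)])
    fix t assume "t \<in> I"
    then obtain i where "t \<in> {l i..u i}" using ul(1) by blast
    then have "t \<notin> {t \<in> I. t < l n}" if "n \<ge> i" for n using decseqD[OF ul(3) that] by auto
    then show "eventually (\<lambda>n. t \<notin> {t \<in> I. t < l n}) sequentially" unfolding eventually_sequentially by blast
  qed auto
  then have "eventually (\<lambda>n. (LINT t:{t \<in> I. t < l n}|rho. K t) < e) sequentially" using e by (rule order_tendstoD(2))
  then obtain n where n: "(LINT t:{t \<in> I. t < l n}|rho. K t) < e" unfolding eventually_sequentially by blast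
  show ?thesis
    using eventually_left_end[OF ul(5)[of n]]
  proof eventually_elim
    case (elim x)
    have "(LINT t:{t \<in> I. t < x}|rho. K t) \<le> (LINT t:{t \<in> I. t < l n}|rho. K t)"
      by (rule set_integral_mono_set[OF set_integrable_subset[OF K(1)] _ tail_sets(1) K(2)])
         (use elim tail_sets(1)[of "l n"] sets_rho in auto)
    then show ?case using n elim by simp
  qed
qed

lemma tail_right:
  assumes K: "set_integrable rho I K" "\<And>t. 0 \<le> (K t :: real)" and e: "e > 0"
  shows "eventually (\<lambda>x. x \<in> I \<and> (LINT t:{t \<in> I. x \<le> t}|rho. K t) < e) Fb"
proof -
  obtain u l :: "nat \<Rightarrow> real" where ul: "I = (\<Union>i. {l i .. u i})" "incseq u" "decseq l"
      "\<And>i. l i < u i" "\<And>i. l i \<in> I" "\<And>i. u i \<in> I"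
    by (rule exhausting_sequences) blast
  have "(\<lambda>n. LINT t:{t \<in> I. u n < t}|rho. K t) \<longlonglongrightarrow> 0"
  proof (rule vanishing_tail[OF K(1) tail_sets(3)])
    fix t assume "t \<in> I"
    then obtain i where "t \<in> {l i..u i}" using ul(1) by blast
    then have "t \<notin> {t \<in> I. u n < t}" if "n \<ge> i" for n using incseqD[OF ul(2) that] by auto
    then show "eventually (\<lambda>n. t \<notin> {t \<in> I. u n < t}) sequentially" unfolding eventually_sequentially by blast
  qed auto
  then have "eventually (\<lambda>n. (LINT t:{t \<in> I. u n < t}|rho. K t) < e) sequentially" using e by (rule order_tendstoD(2))
  then obtain n where n: "(LINT t:{t \<in> I. u n < t}|rho. K t) < e" unfolding eventually_sequentially by blast
  show ?thesis
    using eventually_right_end[OF ul(6)[of n]]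
  proof eventually_elim
    case (elim x)
    have "(LINT t:{t \<in> I. x \<le> t}|rho. K t) \<le> (LINT t:{t \<in> I. u n < t}|rho. K t)"
      by (rule set_integral_mono_set[OF set_integrable_subset[OF K(1)] _ tail_sets(2) K(2)])
         (use elim tail_sets(3)[of "u n"] sets_rho in auto)
    then show ?case using n elim by simp
  qed
qed

abbreviation "raw f g \<equiv> (f, g) \<in> Tmax_raw I rho sig chi c"
abbreviation "V Fe f u \<equiv> wr_end I rho sig chi c Fe f u"

lemma rawD: assumes "raw f g" shows "LL f" "LL g" "\<tau> f g"
  using assms by (auto simp: Tmax_raw_def)

lemma rawI: "LL f \<Longrightarrow> LL g \<Longrightarrow> \<tau> f g \<Longrightarrow> raw f g"
  by (auto simp: Tmax_raw_def)

lemma raw_cnj: "raw f g \<Longrightarrow> raw (\<lambda>x. cnj (f x)) (\<lambda>x. cnj (g x))"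
  by (intro rawI L2_cnj tau_cnj) (auto dest: rawD)

lemma raw_add: "raw f g \<Longrightarrow> raw u v \<Longrightarrow> raw (\<lambda>x. f x + u x) (\<lambda>x. g x + v x)"
  by (intro rawI L2_add tau_add) (auto dest: rawD)

lemma raw_cmult: "raw f g \<Longrightarrow> raw (\<lambda>x. k * f x) (\<lambda>x. k * g x)"
  by (intro rawI L2_cmult tau_cmult) (auto dest: rawD)

lemma lagrange_integrable:
  assumes "raw f g" "raw u v"
  shows "set_integrable rho I (\<lambda>t. g t * u t - f t * v t)"
  by (intro set_integral_diff L2_mult_integrable) (use assms rawD in auto)

text \<open>By the Lagrange identity the Wronskian at \<open>x\<close> differs from the claimed
  limit by the integral of \<open>g u - f v\<close> below \<open>x\<close>, the tail of an
  integrable function.\<close>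

lemma W_left:
  assumes f: "raw f g" and u: "raw u v"
  shows "(W f u \<longlongrightarrow> W f u c - (LINT t:{t \<in> I. t < c}|rho. g t * u t - f t * v t)) Fa"
proof -
  define k where "k = (\<lambda>t. g t * u t - f t * v t)"
  have k: "set_integrable rho I k" unfolding k_def by (rule lagrange_integrable[OF f u])
  have ks: "set_integrable rho A k" if "A \<subseteq> I" "A \<in> sets borel" for A
    by (rule set_integrable_subset[OF k]) (use that sets_rho in auto)
  have kn: "set_integrable rho I (\<lambda>t. norm (k t))" by (rule set_integrable_norm[OF k])
  have "(W f u \<longlongrightarrow> W f u c - (LINT t:{t \<in> I. t < c}|rho. k t)) Fa"
  proof (rule tendstoI)
    fix e :: real assume e: "e > 0"
    show "eventually (\<lambda>x. dist (W f u x) (W f u c - (LINT t:{t \<in> I. t < c}|rho. k t)) < e) Fa"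
      using tail_left[OF kn norm_ge_zero e] eventually_left_end[OF c_in]
    proof eventually_elim
      case (elim x)
      then have x: "x \<in> I" "x < c" by auto
      have s: "{t \<in> I. t < c} = {t \<in> I. t < x} \<union> {x..<c}" using ivl_subset[OF x(1) c_in] x(2) by auto
      have sub: "{x..<c} \<subseteq> I" using ivl_subset[OF x(1) c_in] by auto
      have "(LINT t:{t \<in> I. t < c}|rho. k t) = (LINT t:{t \<in> I. t < x}|rho. k t) + (LINT t:{x..<c}|rho. k t)"
        unfolding s by (rule set_integral_Un) (use ks tail_sets(1)[of x] sub in auto)
      moreover have "W f u c - W f u x = (LINT t:{x..<c}|rho. k t)"
        unfolding k_def by (rule W_lagrange) (use f u x c_in rawD in auto)
      ultimately have "W f u x - (W f u c - (LINT t:{t \<in> I. t < c}|rho. k t)) = (LINT t:{t \<in> I. t < x}|rho. k t)"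
        by (simp add: algebra_simps)
      moreover have "norm (LINT t:{t \<in> I. t < x}|rho. k t) \<le> (LINT t:{t \<in> I. t < x}|rho. norm (k t))"
        using ks[of "{t \<in> I. t < x}"] tail_sets(1)[of x] set_integral_norm_bound[of rho "{t \<in> I. t < x}" k] by auto
      ultimately show ?case using elim by (simp add: dist_norm)
    qed
  qed
  then show ?thesis by (simp add: k_def)
qed

lemma W_right:
  assumes f: "raw f g" and u: "raw u v"
  shows "(W f u \<longlongrightarrow> W f u c + (LINT t:{t \<in> I. c \<le> t}|rho. g t * u t - f t * v t)) Fb"
proof -
  define k where "k = (\<lambda>t. g t * u t - f t * v t)"
  have k: "set_integrable rho I k" unfolding k_def by (rule lagrange_integrable[OF f u])
  have ks: "set_integrable rho A k" if "A \<subseteq> I" "A \<in> sets borel" for A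
    by (rule set_integrable_subset[OF k]) (use that sets_rho in auto)
  have kn: "set_integrable rho I (\<lambda>t. norm (k t))" by (rule set_integrable_norm[OF k])
  have "(W f u \<longlongrightarrow> W f u c + (LINT t:{t \<in> I. c \<le> t}|rho. k t)) Fb"
  proof (rule tendstoI)
    fix e :: real assume e: "e > 0"
    show "eventually (\<lambda>x. dist (W f u x) (W f u c + (LINT t:{t \<in> I. c \<le> t}|rho. k t)) < e) Fb"
      using tail_right[OF kn norm_ge_zero e] eventually_right_end[OF c_in]
    proof eventually_elim
      case (elim x)
      then have x: "x \<in> I" "c < x" by auto
      have s: "{t \<in> I. c \<le> t} = {c..<x} \<union> {t \<in> I. x \<le> t}" using ivl_subset[OF c_in x(1)] x(2) by auto
      have sub: "{c..<x} \<subseteq> I" using ivl_subset[OF c_in x(1)] by auto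
      have "(LINT t:{t \<in> I. c \<le> t}|rho. k t) = (LINT t:{c..<x}|rho. k t) + (LINT t:{t \<in> I. x \<le> t}|rho. k t)"
        unfolding s by (rule set_integral_Un) (use ks tail_sets(2)[of x] sub in auto)
      moreover have "W f u x - W f u c = (LINT t:{c..<x}|rho. k t)"
        unfolding k_def by (rule W_lagrange) (use f u x c_in rawD in auto)
      ultimately have "(W f u c + (LINT t:{t \<in> I. c \<le> t}|rho. k t)) - W f u x = (LINT t:{t \<in> I. x \<le> t}|rho. k t)"
        by (simp add: algebra_simps)
      moreover have "norm (LINT t:{t \<in> I. x \<le> t}|rho. k t) \<le> (LINT t:{t \<in> I. x \<le> t}|rho. norm (k t))"
        using ks[of "{t \<in> I. x \<le> t}"] tail_sets(2)[of x] set_integral_norm_bound[of rho "{t \<in> I. x \<le> t}" k] by auto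
      ultimately show ?case using elim by (subst dist_commute) (simp add: dist_norm)
    qed
  qed
  then show ?thesis by (simp add: k_def)
qed

lemma V_left:
  assumes "raw f g" "raw u v"
  shows "V Fa f u = W f u c - (LINT t:{t \<in> I. t < c}|rho. g t * u t - f t * v t)"
  unfolding wr_end_def by (rule tendsto_Lim[OF left_end_nontrivial W_left[OF assms]])

lemma V_right:
  assumes "raw f g" "raw u v"
  shows "V Fb f u = W f u c + (LINT t:{t \<in> I. c \<le> t}|rho. g t * u t - f t * v t)"
  unfolding wr_end_def by (rule tendsto_Lim[OF right_end_nontrivial W_right[OF assms]])

lemma V_tendsto_left: "raw f g \<Longrightarrow> raw u v \<Longrightarrow> (W f u \<longlongrightarrow> V Fa f u) Fa"
  using W_left V_left by simp

lemma V_tendsto_right: "raw f g \<Longrightarrow> raw u v \<Longrightarrow> (W f u \<longlongrightarrow> V Fb f u) Fb"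
  using W_right V_right by simp

text \<open>Both boundary values are expressed from the common base point \<open>c\<close>, so the
  Wronskians there cancel and the two half-line integrals join.\<close>

lemma green:
  assumes f: "raw f g" and u: "raw u v"
  shows "linner I rho g u - linner I rho f v = V Fb f (\<lambda>x. cnj (u x)) - V Fa f (\<lambda>x. cnj (u x))"
proof -
  note u' = raw_cnj[OF u]
  let ?k = "\<lambda>t. g t * cnj (u t) - f t * cnj (v t)"
  have "V Fb f (\<lambda>x. cnj (u x)) - V Fa f (\<lambda>x. cnj (u x)) =
     (LINT t:{t \<in> I. t < c}|rho. ?k t) + (LINT t:{t \<in> I. c \<le> t}|rho. ?k t)"
    unfolding V_left[OF f u'] V_right[OF f u'] by simp
  also have "\<dots> = (LINT t:{t \<in> I. t < c} \<union> {t \<in> I. c \<le> t}|rho. ?k t)"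
    by (rule set_integral_Un[symmetric]; (rule set_integrable_subset[OF lagrange_integrable[OF f u']])?)
       (use tail_sets(1,2)[of c] sets_rho in auto)
  also have "{t \<in> I. t < c} \<union> {t \<in> I. c \<le> t} = I" by auto
  also have "(LINT t:I|rho. ?k t) = linner I rho g u - linner I rho f v"
    unfolding linner_def using rawD[OF f] rawD[OF u']
    by (intro set_integral_diff L2_mult_integrable)
  finally show ?thesis ..
qed

subsection \<open>The limit-point case\<close>

text \<open>For \<open>\<tau> w = z w\<close> the Lagrange integrands are \<open>w (z u - v)\<close>
  against \<open>u\<close> and \<open>w (z f - g)\<close> against \<open>f\<close>. The weight
  \<open>k\<close> dominates the factor of \<open>w\<close> in both, so that one integral controls
  the two Wronskians.\<close>

lemma gronwall_weights:
  assumes f: "raw f g" and u: "raw u v"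
    and h: "h = (\<lambda>t. cmod (f t) + cmod (u t))"
    and k: "k = (\<lambda>t. (cmod (z * u t) + cmod (v t)) + (cmod (z * f t) + cmod (g t)))"
  shows "LL (\<lambda>t. complex_of_real (h t))" "LL (\<lambda>t. complex_of_real (k t))" "set_integrable rho I (\<lambda>t. h t * k t)"
proof -
  show L: "LL (\<lambda>t. complex_of_real (h t))" "LL (\<lambda>t. complex_of_real (k t))"
    unfolding h k of_real_add
    by (intro L2_add L2_cmod L2_cmult rawD(1,2)[OF f] rawD(1,2)[OF u])+
  have "0 \<le> h t" "0 \<le> k t" for t by (simp_all add: h k)
  then show "set_integrable rho I (\<lambda>t. h t * k t)"
    using set_integrable_norm[OF L2_mult_integrable[OF L]] by (simp add: norm_mult)
qed

text \<open>The identity \<open>w W(f,u) = f W(w,u) - u W(w,f)\<close> and the Lagrange identity bound every solution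
\<open>w\<close> by \<open>h (C + \<integral>|w| k d\<rho>)\<close> with square-integrable \<open>h\<close>, \<open>k\<close>, once \<open>W(f,u)\<close> stays away from 0.\<close>
lemma solution_square_integrable:
  assumes w: "\<tau> w (\<lambda>x. z * w x)" and f: "raw f g" and u: "raw u v"
    and h: "h = (\<lambda>t. cmod (f t) + cmod (u t))"
    and k: "k = (\<lambda>t. (cmod (z * u t) + cmod (v t)) + (cmod (z * f t) + cmod (g t)))"
    and d: "0 < d" "\<And>x. x \<in> H \<Longrightarrow> d \<le> cmod (W f u x)"
    and H: "H \<subseteq> I" "H \<in> sets borel" and x0: "x0 \<in> I"
    and seg: "\<And>x. x \<in> H \<Longrightarrow> {min x x0..<max x x0} \<subseteq> H"
      "\<And>x t. x \<in> H \<Longrightarrow> t \<in> {min x x0..<max x x0} \<Longrightarrow> {min t x0..<max t x0} \<subseteq> {min x x0..<max x x0}"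
    and small: "(LINT t:H|rho. h t * k t) \<le> d / 2"
  shows "set_integrable rho H (\<lambda>x. (cmod (w x))\<^sup>2)"
proof -
  \<comment> \<open>The segment between \<open>x0\<close> and \<open>x\<close>, whichever lies to
    the left, so that one argument serves both ends of the interval.\<close>
  define S where "S = (\<lambda>x. {min x x0..<max x x0})"
  define A where "A = (\<lambda>x. LINT t:S x|rho. cmod (w t) * k t)"
  define C where "C = max (cmod (W w u x0)) (cmod (W w f x0))"
  note ws = tau_sol[OF w]
  note Lh = gronwall_weights(1)[OF f u h k] and Lk = gronwall_weights(2)[OF f u h k] and hk = gronwall_weights(3)[OF f u h k]
  have h0: "0 \<le> h t" and k0: "0 \<le> k t" for t by (simp_all add: h k)
  have xI: "x \<in> I" if "x \<in> H" for x using that H by auto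
  have mI: "min x x0 \<in> I" "max x x0 \<in> I" if "x \<in> H" for x using xI[OF that] x0 by (auto simp: min_def max_def)
  have SI: "{min x x0..max x x0} \<subseteq> I" if "x \<in> H" for x using ivl_subset[OF mI[OF that]] .
  have SH: "S x \<subseteq> H" if "x \<in> H" for x using seg(1)[OF that] by (simp add: S_def)
  have Sb: "S x \<in> sets borel" for x by (simp add: S_def)
  have wk: "set_integrable rho (S x) (\<lambda>t. cmod (w t) * k t)" if x: "x \<in> H" for x
  proof (cases "x = x0")
    case True
    then show ?thesis by (simp add: S_def)
  next
    case False
    then have "bm_on (S x) w" unfolding S_def by (intro solD(1)[OF ws mI[OF x]]) auto
    then have "set_integrable rho (S x) (\<lambda>t. complex_of_real (k t) * w t)"
      using L2_loc_integrable[OF Lk SI[OF x]] unfolding S_def by (intro set_integrable_mult_bm sets_rho)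
    from set_integrable_norm[OF this] show ?thesis using k0 by (simp add: norm_mult mult.commute)
  qed
  have A0: "0 \<le> A x" for x
    unfolding A_def set_lebesgue_integral_def by (rule Bochner_Integration.integral_nonneg) (simp add: k0)
  have C0: "0 \<le> C" unfolding C_def by (meson max.coboundedI1 norm_ge_zero)
  \<comment> \<open>The Lagrange identity from \<open>x0\<close> to \<open>x\<close>: away from
    \<open>x0\<close> a Wronskian with \<open>w\<close> grows by at most the integral of
    \<open>|w| k\<close>.\<close>
  have Wb: "cmod (W w q x) \<le> C + A x"
    if x: "x \<in> H" and q: "raw q r" and Cq: "cmod (W w q x0) \<le> C" and kq: "\<And>t. cmod (z * q t) + cmod (r t) \<le> k t" for x q r
  proof -
    let ?l = "\<lambda>t. z * w t * q t - w t * r t"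
    have e: "W w q (max x x0) - W w q (min x x0) = (LINT t:S x|rho. ?l t)"
      unfolding S_def by (rule W_lagrange[OF w rawD(3)[OF q] _ mI[OF x]]) simp
    have il: "set_integrable rho (S x) ?l"
      unfolding S_def by (rule lagrange_identity(2)[OF ws tau_sol[OF rawD(3)[OF q]] _ SI[OF x] SI[OF x]]) simp
    have pt: "norm (?l t) \<le> cmod (w t) * k t" for t
    proof -
      have "norm (?l t) \<le> cmod (z * w t * q t) + cmod (w t * r t)" by (rule norm_triangle_ineq4)
      also have "\<dots> = cmod (w t) * (cmod (z * q t) + cmod (r t))" by (simp add: norm_mult algebra_simps)
      also have "\<dots> \<le> cmod (w t) * k t" by (intro mult_left_mono kq) simp
      finally show ?thesis .
    qed
    have "cmod (LINT t:S x|rho. ?l t) \<le> (LINT t:S x|rho. norm (?l t))"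
      using set_integral_norm_bound[OF il] .
    also have "\<dots> \<le> A x" unfolding A_def
      by (rule set_integral_mono[OF set_integrable_norm[OF il] wk[OF x] pt])
    finally have "cmod (W w q (max x x0) - W w q (min x x0)) \<le> A x" unfolding e .
    then have "cmod (W w q x - W w q x0) \<le> A x" by (auto simp: max_def min_def norm_minus_commute split: if_splits)
    then show ?thesis using Cq norm_triangle_ineq2[of "W w q x" "W w q x0"] by linarith
  qed
  have pw: "d * cmod (w x) \<le> h x * (C + A x)" if x: "x \<in> H" for x
  proof -
    have 1: "cmod (W w u x) \<le> C + A x" by (rule Wb[OF x u]) (auto simp: C_def k)
    have 2: "cmod (W w f x) \<le> C + A x" by (rule Wb[OF x f]) (auto simp: C_def k)
    have "d * cmod (w x) \<le> cmod (W f u x) * cmod (w x)" using d(2)[OF x] by (intro mult_right_mono) auto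
    also have "\<dots> = cmod (f x * W w u x - u x * W w f x)"
      unfolding norm_mult[symmetric] W_eq by (simp add: algebra_simps)
    also have "\<dots> \<le> cmod (f x) * cmod (W w u x) + cmod (u x) * cmod (W w f x)"
      unfolding norm_mult[symmetric] by (rule norm_triangle_ineq4)
    also have "\<dots> \<le> cmod (f x) * (C + A x) + cmod (u x) * (C + A x)"
      by (intro add_mono mult_left_mono 1 2) auto
    finally show ?thesis by (simp add: h distrib_right)
  qed
  \<comment> \<open>Along the segment \<open>A t \<le> A x\<close>, so the pointwise bound on
    \<open>w\<close> may use \<open>A x\<close> throughout. As the integral of \<open>h k\<close> is
    at most \<open>d / 2\<close>, this gives \<open>A x \<le> (C + A x) / 2\<close>, which can be
    solved for \<open>A x\<close>.\<close>
  have AC: "A x \<le> C" if x: "x \<in> H" for x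
  proof -
    have hkS: "set_integrable rho (S x) (\<lambda>t. h t * k t)"
      by (rule set_integrable_subset[OF hk]) (use SH[OF x] H Sb sets_rho in auto)
    have "A x = (LINT t:S x|rho. cmod (w t) * k t)" by (simp add: A_def)
    also have "\<dots> \<le> (LINT t:S x|rho. (h t * k t) * ((C + A x) / d))"
    proof (rule set_integral_mono[OF wk[OF x]])
      show "set_integrable rho (S x) (\<lambda>t. (h t * k t) * ((C + A x) / d))"
        by (intro set_integrable_mult_left hkS)
      fix t assume t: "t \<in> S x"
      then have tH: "t \<in> H" using SH[OF x] by auto
      have "S t \<subseteq> S x" using seg(2)[OF x, of t] t by (simp add: S_def)
      then have "A t \<le> A x" unfolding A_def
        by (rule set_integral_mono_set[OF wk[OF x] _ Sb]) (simp add: k0)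
      then have "h t * (C + A t) \<le> h t * (C + A x)" by (intro mult_left_mono) (auto simp: h0)
      then have "d * cmod (w t) \<le> h t * (C + A x)" using pw[OF tH] by simp
      then have "cmod (w t) \<le> h t * (C + A x) / d" using d(1) by (simp add: field_simps)
      then have "cmod (w t) * k t \<le> h t * (C + A x) / d * k t" by (intro mult_right_mono k0)
      then show "cmod (w t) * k t \<le> (h t * k t) * ((C + A x) / d)" by (simp add: algebra_simps)
    qed
    also have "\<dots> = (LINT t:S x|rho. h t * k t) * ((C + A x) / d)" by simp
    also have "\<dots> \<le> (d / 2) * ((C + A x) / d)"
    proof (rule mult_right_mono)
      have "set_integrable rho H (\<lambda>t. h t * k t)" by (rule set_integrable_subset[OF hk]) (use H sets_rho in auto)
      then have "(LINT t:S x|rho. h t * k t) \<le> (LINT t:H|rho. h t * k t)"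
        by (rule set_integral_mono_set[OF _ SH[OF x] Sb]) (simp add: h0 k0)
      then show "(LINT t:S x|rho. h t * k t) \<le> d / 2" using small by simp
      show "0 \<le> (C + A x) / d" using C0 A0[of x] d(1) by simp
    qed
    also have "\<dots> = (C + A x) / 2" using d(1) by simp
    finally show ?thesis by simp
  qed
  \<comment> \<open>Now \<open>w\<close> is bounded by a multiple of \<open>h\<close>, and
    \<open>h\<close> is square-integrable.\<close>
  have fin: "cmod (w x) \<le> (2 * C / d) * h x" if x: "x \<in> H" for x
  proof -
    have "h x * (C + A x) \<le> h x * (2 * C)" using AC[OF x] by (intro mult_left_mono h0) simp
    then have "d * cmod (w x) \<le> h x * (2 * C)" using pw[OF x] by simp
    then show ?thesis using d(1) by (simp add: field_simps)
  qed
  have mw: "set_borel_measurable rho H w"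
    by (rule set_borel_measurable_subset[OF sol_borel_measurable[OF ws]]) (use H sets_rho in auto)
  show ?thesis
  proof (rule set_integrable_bound)
    have "set_integrable rho I (\<lambda>x. (h x)\<^sup>2)" using Lh unfolding L2_def by simp
    then have "set_integrable rho H (\<lambda>x. (h x)\<^sup>2)" by (rule set_integrable_subset) (use H sets_rho in auto)
    then show "set_integrable rho H (\<lambda>x. (2 * C / d)\<^sup>2 * (h x)\<^sup>2)" by simp
    show "set_borel_measurable rho H (\<lambda>x. (cmod (w x))\<^sup>2)"
      by (rule set_borel_measurable_cmod_square[OF mw])
    have "norm ((cmod (w x))\<^sup>2) \<le> norm ((2 * C / d)\<^sup>2 * (h x)\<^sup>2)" if "x \<in> H" for x
    proof -
      have "(cmod (w x))\<^sup>2 \<le> ((2 * C / d) * h x)\<^sup>2" by (rule power_mono[OF fin[OF that]]) simp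
      also have "\<dots> = (2 * C / d)\<^sup>2 * (h x)\<^sup>2" by (rule power_mult_distrib)
      finally have le: "(cmod (w x))\<^sup>2 \<le> (2 * C / d)\<^sup>2 * (h x)\<^sup>2" .
      have n: "norm (X\<^sup>2) = X\<^sup>2" "norm (X\<^sup>2 * Y\<^sup>2) = X\<^sup>2 * Y\<^sup>2" for X Y :: real by simp_all
      show ?thesis unfolding n by (rule le)
    qed
    then show "AE x in rho. x \<in> H \<longrightarrow> norm ((cmod (w x))\<^sup>2) \<le> norm ((2 * C / d)\<^sup>2 * (h x)\<^sup>2)" by blast
  qed
qed

lemma eventually_left_endD:
  assumes "eventually P Fa" shows "\<exists>x0\<in>I. \<forall>x\<in>I. x \<le> x0 \<longrightarrow> P x"
proof (cases a)
  case (real r)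
  have r: "r < c" using c_in real by (simp add: ivl_def)
  obtain y where y: "r < y" "\<And>x. r < x \<Longrightarrow> x < y \<Longrightarrow> P x"
    using assms real unfolding left_end_def by (auto simp: eventually_at_right[OF r])
  define m where "m = (r + min y c) / 2"
  have m: "r < m" "m < y" "m < c" using y(1) r by (auto simp: m_def min_def)
  have "m \<in> I" using m c_in real by (auto simp: ivl_def intro: less_trans[of _ "ereal c"])
  then show ?thesis using y(2) m real by (intro bexI[of _ m]) (auto simp: ivl_def)
next
  case PInf
  then show ?thesis using a_less_b by simp
next
  case MInf
  then obtain N where N: "\<And>x. x \<le> N \<Longrightarrow> P x"
    using assms unfolding left_end_def by (auto simp: eventually_at_bot_linorder)
  have "min N c \<in> I" using c_in MInf by (auto simp: ivl_def min_def intro: le_less_trans[of _ "ereal c"])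
  then show ?thesis using N by (intro bexI[of _ "min N c"]) auto
qed

lemma eventually_right_endD:
  assumes "eventually P Fb" shows "\<exists>x0\<in>I. \<forall>x\<in>I. x0 \<le> x \<longrightarrow> P x"
proof (cases b)
  case (real r)
  have r: "c < r" using c_in real by (simp add: ivl_def)
  obtain y where y: "y < r" "\<And>x. y < x \<Longrightarrow> x < r \<Longrightarrow> P x"
    using assms real unfolding right_end_def by (auto simp: eventually_at_left[OF r])
  define m where "m = (r + max y c) / 2"
  have m: "m < r" "y < m" "c < m" using y(1) r by (auto simp: m_def max_def)
  have "m \<in> I" using m c_in real by (auto simp: ivl_def intro: less_trans[of _ "ereal c"])
  then show ?thesis using y(2) m real by (intro bexI[of _ m]) (auto simp: ivl_def)
next
  case MInf
  then show ?thesis using a_less_b by simp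
next
  case PInf
  then obtain N where N: "\<And>x. N \<le> x \<Longrightarrow> P x"
    using assms unfolding right_end_def by (auto simp: eventually_at_top_linorder)
  have "max N c \<in> I" using c_in PInf by (auto simp: ivl_def max_def intro: less_le_trans[of _ "ereal c"])
  then show ?thesis using N by (intro bexI[of _ "max N c"]) auto
qed

lemma eventually_away_from_zero:
  fixes R :: complex
  assumes "(X \<longlongrightarrow> R) F" "R \<noteq> 0"
  shows "eventually (\<lambda>x. cmod R / 2 \<le> cmod (X x)) F"
proof -
  have "((\<lambda>x. cmod (X x)) \<longlongrightarrow> cmod R) F" by (rule tendsto_norm[OF assms(1)])
  then have "eventually (\<lambda>x. cmod R / 2 < cmod (X x)) F" by (rule order_tendstoD(1)) (use assms in simp)
  then show ?thesis by eventually_elim simp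
qed

text \<open>A nonzero limit keeps the Wronskian above half of its modulus near the end, and the tail
  of \<open>h k\<close> is small there. The point \<open>x0\<close> beyond which both hold depends
  on \<open>z\<close>, as the definition of the limit-circle case permits.\<close>

lemma limit_point_right:
  assumes lp: "\<not> lc_right I rho sig chi c" and f: "raw f g" and u: "raw u v"
  shows "V Fb f u = 0"
proof (rule ccontr)
  assume R: "V Fb f u \<noteq> 0"
  define d where "d = cmod (V Fb f u) / 2"
  have d: "0 < d" using R by (simp add: d_def)
  have "lc_right I rho sig chi c" unfolding lc_right_def
  proof (intro allI impI)
    fix z w assume w: "\<tau> w (\<lambda>x. z * w x)"
    define h where "h = (\<lambda>t. cmod (f t) + cmod (u t))"
    define k where "k = (\<lambda>t. (cmod (z * u t) + cmod (v t)) + (cmod (z * f t) + cmod (g t)))"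
    have hk0: "0 \<le> h t * k t" for t by (simp add: h_def k_def)
    have d2: "0 < d / 2" using d by simp
    have "eventually (\<lambda>x. d \<le> cmod (W f u x)) Fb"
      unfolding d_def by (rule eventually_away_from_zero[OF V_tendsto_right[OF f u] R])
    then have "eventually (\<lambda>x. d \<le> cmod (W f u x) \<and> (LINT t:{t \<in> I. x \<le> t}|rho. h t * k t) < d / 2) Fb"
      using tail_right[OF gronwall_weights(3)[OF f u h_def k_def] hk0 d2] by eventually_elim auto
    then obtain x0 where x0: "x0 \<in> I" "\<And>x. x \<in> I \<Longrightarrow> x0 \<le> x \<Longrightarrow> d \<le> cmod (W f u x) \<and> (LINT t:{t \<in> I. x \<le> t}|rho. h t * k t) < d / 2"
      using eventually_right_endD by blast
    have "set_integrable rho {t \<in> I. x0 \<le> t} (\<lambda>x. (cmod (w x))\<^sup>2)"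
    proof (rule solution_square_integrable[OF w f u h_def k_def d _ _ tail_sets(2) x0(1)])
      fix x assume x: "x \<in> {t \<in> I. x0 \<le> t}"
      then show "{min x x0..<max x x0} \<subseteq> {t \<in> I. x0 \<le> t}" using ivl_subset[OF x0(1), of x] by auto
    qed (use x0 in \<open>auto simp: less_imp_le\<close>)
    then have "set_integrable rho {x \<in> I. x0 < x} (\<lambda>x. (cmod (w x))\<^sup>2)"
      by (rule set_integrable_subset) (use tail_sets(3)[of x0] sets_rho in auto)
    then show "\<exists>d\<in>I. set_integrable rho {x \<in> I. d < x} (\<lambda>x. (cmod (w x))\<^sup>2)" using x0(1) by blast
  qed
  then show False using lp by simp
qed

lemma limit_point_left:
  assumes lp: "\<not> lc_left I rho sig chi c" and f: "raw f g" and u: "raw u v"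
  shows "V Fa f u = 0"
proof (rule ccontr)
  assume R: "V Fa f u \<noteq> 0"
  define d where "d = cmod (V Fa f u) / 2"
  have d: "0 < d" using R by (simp add: d_def)
  have "lc_left I rho sig chi c" unfolding lc_left_def
  proof (intro allI impI)
    fix z w assume w: "\<tau> w (\<lambda>x. z * w x)"
    define h where "h = (\<lambda>t. cmod (f t) + cmod (u t))"
    define k where "k = (\<lambda>t. (cmod (z * u t) + cmod (v t)) + (cmod (z * f t) + cmod (g t)))"
    have hk0: "0 \<le> h t * k t" for t by (simp add: h_def k_def)
    have d2: "0 < d / 2" using d by simp
    have "eventually (\<lambda>x. d \<le> cmod (W f u x)) Fa"
      unfolding d_def by (rule eventually_away_from_zero[OF V_tendsto_left[OF f u] R])
    then have "eventually (\<lambda>x. d \<le> cmod (W f u x) \<and> (LINT t:{t \<in> I. t < x}|rho. h t * k t) < d / 2) Fa"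
      using tail_left[OF gronwall_weights(3)[OF f u h_def k_def] hk0 d2] by eventually_elim auto
    then obtain x0 where x0: "x0 \<in> I" "\<And>x. x \<in> I \<Longrightarrow> x \<le> x0 \<Longrightarrow> d \<le> cmod (W f u x) \<and> (LINT t:{t \<in> I. t < x}|rho. h t * k t) < d / 2"
      using eventually_left_endD by blast
    \<comment> \<open>At this end the segments are \<open>[x, x0)\<close>, so the tail may omit
      \<open>x0\<close>; at the right end they start at \<open>x0\<close> and the tail has to
      contain it.\<close>
    have "set_integrable rho {t \<in> I. t < x0} (\<lambda>x. (cmod (w x))\<^sup>2)"
    proof (rule solution_square_integrable[OF w f u h_def k_def d _ _ tail_sets(1) x0(1)])
      fix x assume x: "x \<in> {t \<in> I. t < x0}"
      then show "{min x x0..<max x x0} \<subseteq> {t \<in> I. t < x0}" using ivl_subset[OF _ x0(1), of x] by auto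
    qed (use x0 in \<open>auto simp: less_imp_le\<close>)
    then show "\<exists>d\<in>I. set_integrable rho {x \<in> I. x < d} (\<lambda>x. (cmod (w x))\<^sup>2)" using x0(1) by blast
  qed
  then show False using lp by simp
qed

end

section \<open>The adjoint of a restriction of the maximal relation\<close>

text \<open>Subtracting from \<open>x\<close> a suitable multiple of one vector on which
  \<open>m\<close> does not vanish lands in the kernel of \<open>m\<close>, where \<open>l\<close>
  vanishes too.\<close>

lemma functional_multiple:
  fixes l m :: "(real \<Rightarrow> complex) \<Rightarrow> complex"
  assumes comb: "\<And>x y k. x \<in> K \<Longrightarrow> y \<in> K \<Longrightarrow> (\<lambda>t. x t + k * y t) \<in> K"
    and l: "\<And>x y k. x \<in> K \<Longrightarrow> y \<in> K \<Longrightarrow> l (\<lambda>t. x t + k * y t) = l x + k * l y"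
    and m: "\<And>x y k. x \<in> K \<Longrightarrow> y \<in> K \<Longrightarrow> m (\<lambda>t. x t + k * y t) = m x + k * m y"
    and ker: "\<And>x. x \<in> K \<Longrightarrow> m x = 0 \<Longrightarrow> l x = 0"
  shows "\<exists>c. \<forall>x\<in>K. l x = c * m x"
proof (cases "\<exists>y\<in>K. m y \<noteq> 0")
  case True
  then obtain y where y: "y \<in> K" "m y \<noteq> 0" by blast
  have "l x = (l y / m y) * m x" if x: "x \<in> K" for x
  proof -
    have "m (\<lambda>t. x t + - (m x / m y) * y t) = 0" using y unfolding m[OF x y(1)] by simp
    then have "l (\<lambda>t. x t + - (m x / m y) * y t) = 0" by (rule ker[OF comb[OF x y(1)]])
    then have "l x + - (m x / m y) * l y = 0" unfolding l[OF x y(1)] .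
    then show ?thesis by simp
  qed
  then show ?thesis by blast
next
  case False
  then show ?thesis using ker by (intro exI[of _ 0]) auto
qed

context measure_sl
begin

lemma qd_eq: "sol I f p g \<Longrightarrow> x \<in> I \<Longrightarrow> qd f x = p x"
  using quasi_derivative_unique[OF tau_sol[OF sol_tau]] by blast

lemma W_lincomb:
  assumes "\<tau> f g" "\<tau> u v" "x \<in> I"
  shows "W (\<lambda>x. k * f x + l * u x) w x = k * W f w x + l * W u w x"
    and "W w (\<lambda>x. k * f x + l * u x) x = k * W w f x + l * W w u x"
proof -
  have "sol I (\<lambda>x. k * f x + l * u x) (\<lambda>x. k * qd f x + l * qd u x) (\<lambda>x. k * g x + l * v x)"
    using sol_add[OF ivl_subset sol_cmult[OF ivl_subset tau_sol[OF assms(1)]] sol_cmult[OF ivl_subset tau_sol[OF assms(2)]]] .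
  from qd_eq[OF this assms(3)]
  show "W (\<lambda>x. k * f x + l * u x) w x = k * W f w x + l * W u w x"
    and "W w (\<lambda>x. k * f x + l * u x) x = k * W w f x + l * W w u x"
    by (simp_all add: W_eq algebra_simps)
qed

lemma W_cnj:
  assumes "\<tau> f g" "\<tau> u v" "x \<in> I"
  shows "W (\<lambda>x. cnj (f x)) (\<lambda>x. cnj (u x)) x = cnj (W f u x)"
  using qd_eq[OF sol_cnj[OF ivl_subset tau_sol[OF assms(1)]] assms(3)]
    qd_eq[OF sol_cnj[OF ivl_subset tau_sol[OF assms(2)]] assms(3)]
  by (simp add: W_eq)

lemma integral_cut:
  fixes \<phi> :: "real \<Rightarrow> complex"
  assumes "s \<in> I" "t \<in> I" "\<And>x. x \<in> I \<Longrightarrow> x \<notin> {s..<t} \<Longrightarrow> \<phi> x = 0"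
  shows "(LINT x:I|rho. \<phi> x) = (LINT x:{s..<t}|rho. \<phi> x)"
    and "set_integrable rho I \<phi> = set_integrable rho {s..<t} \<phi>"
proof -
  have "x \<in> I" if "x \<in> {s..<t}" for x using ivl_subset[OF assms(1,2)] that by auto
  then have "(\<lambda>x. indicat_real I x *\<^sub>R \<phi> x) = (\<lambda>x. indicat_real {s..<t} x *\<^sub>R \<phi> x)"
    using assms(3) by (auto simp: indicator_def fun_eq_iff)
  then show "(LINT x:I|rho. \<phi> x) = (LINT x:{s..<t}|rho. \<phi> x)"
    and "set_integrable rho I \<phi> = set_integrable rho {s..<t} \<phi>"
    by (simp_all only: set_lebesgue_integral_def set_integrable_def)
qed

lemma bm_on_L2_cut:
  assumes st: "s \<in> I" "t \<in> I" and f: "bm_on {s..<t} \<phi>"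
  shows "LL (\<lambda>x. indicat_real {s..<t} x *\<^sub>R \<phi> x)"
  unfolding L2_def
proof
  have sub: "{s..<t} \<subseteq> I" using ivl_subset[OF st] by auto
  have "(\<lambda>x. indicat_real I x *\<^sub>R (indicat_real {s..<t} x *\<^sub>R \<phi> x)) = (\<lambda>x. indicat_real {s..<t} x *\<^sub>R \<phi> x)"
    using sub by (auto simp: indicator_def fun_eq_iff)
  then show "set_borel_measurable rho I (\<lambda>x. indicat_real {s..<t} x *\<^sub>R \<phi> x)"
    using f unfolding set_borel_measurable_def bm_on_def bd_meas_def
    by (simp add: measurable_cong_sets[OF sets_rho refl])
  have fin: "emeasure rho {s..<t} < \<infinity>" using fin_on_rho[OF ivl_subset[OF st]] by (simp add: fin_on_def pos_measure_def)
  have "set_integrable rho {s..<t} (\<lambda>x. \<phi> x * \<phi> x)"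
    by (rule bm_on_set_integrable[OF sets_rho fin _ bm_on_mult[OF f f]]) simp
  from set_integrable_norm[OF this]
  have "set_integrable rho {s..<t} (\<lambda>x. (cmod (\<phi> x))\<^sup>2)" by (simp add: norm_mult power2_eq_square)
  moreover have "(\<lambda>x. indicat_real I x *\<^sub>R (cmod (indicat_real {s..<t} x *\<^sub>R \<phi> x))\<^sup>2) = (\<lambda>x. indicat_real {s..<t} x *\<^sub>R (cmod (\<phi> x))\<^sup>2)"
    using sub by (auto simp: indicator_def fun_eq_iff)
  ultimately show "set_integrable rho I (\<lambda>x. (cmod (indicat_real {s..<t} x *\<^sub>R \<phi> x))\<^sup>2)"
    by (simp only: set_integrable_def)
qed

lemma L2_cut:
  assumes st: "s \<in> I" "t \<in> I" and f: "LL f"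
  shows "LL (\<lambda>x. indicat_real {s..<t} x *\<^sub>R f x)"
  unfolding L2_def
proof
  have sub: "{s..<t} \<subseteq> I" using ivl_subset[OF st] by auto
  have B: "{s..<t} \<in> sets rho" using sets_rho by simp
  have e: "(\<lambda>x. indicat_real I x *\<^sub>R (indicat_real {s..<t} x *\<^sub>R f x)) = (\<lambda>x. indicat_real {s..<t} x *\<^sub>R f x)"
    using sub by (auto simp: indicator_def fun_eq_iff)
  have "set_borel_measurable rho {s..<t} f"
    by (rule set_borel_measurable_subset[OF _ B sub]) (use f in \<open>simp add: L2_def\<close>)
  then show "set_borel_measurable rho I (\<lambda>x. indicat_real {s..<t} x *\<^sub>R f x)"
    unfolding set_borel_measurable_def by (simp only: e)
  have "set_integrable rho {s..<t} (\<lambda>x. (cmod (f x))\<^sup>2)"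
    by (rule set_integrable_subset[OF _ B sub]) (use f in \<open>simp add: L2_def\<close>)
  moreover have "(\<lambda>x. indicat_real I x *\<^sub>R (cmod (indicat_real {s..<t} x *\<^sub>R f x))\<^sup>2) = (\<lambda>x. indicat_real {s..<t} x *\<^sub>R (cmod (f x))\<^sup>2)"
    using sub by (auto simp: indicator_def fun_eq_iff)
  ultimately show "set_integrable rho I (\<lambda>x. (cmod (indicat_real {s..<t} x *\<^sub>R f x))\<^sup>2)"
    by (simp only: set_integrable_def)
qed

lemma AE_zero_from_local:
  fixes e :: "real \<Rightarrow> complex"
  assumes "\<And>s t. s \<in> I \<Longrightarrow> t \<in> I \<Longrightarrow> s < t \<Longrightarrow> AE x in rho. x \<in> {s..<t} \<longrightarrow> e x = 0"
  shows "AE x in rho. x \<in> I \<longrightarrow> e x = 0"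
proof -
  obtain u l :: "nat \<Rightarrow> real" where ul: "I = (\<Union>i. {l i .. u i})" "incseq u" "decseq l"
      "\<And>i. l i < u i" "\<And>i. l i \<in> I" "\<And>i. u i \<in> I"
    by (rule exhausting_sequences) blast
  have "AE x in rho. x \<in> {l i..<u i} \<longrightarrow> e x = 0" for i
    by (rule assms[OF ul(5,6,4)])
  then have "AE x in rho. \<forall>i. x \<in> {l i..<u i} \<longrightarrow> e x = 0" unfolding AE_all_countable by blast
  then show ?thesis
  proof eventually_elim
    case (elim x)
    show ?case
    proof
      assume "x \<in> I"
      then obtain x' where x': "x < x'" "x' \<in> I" by (rule in_I_above)
      obtain i j where i: "x \<in> {l i..u i}" and j: "x' \<in> {l j..u j}" using \<open>x \<in> I\<close> x'(2) ul(1) by blast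
      have "x \<in> {l (max i j)..<u (max i j)}"
        using decseqD[OF ul(3), of i "max i j"] incseqD[OF ul(2), of j "max i j"] i j x'(1) by auto
      then show "e x = 0" using elim by blast
    qed
  qed
qed

text \<open>The solution is started with zero data at \<open>s\<close>. By the Lagrange identity,
  orthogonality of \<open>k\<close> to \<open>u1\<close> and \<open>u2\<close> makes its Wronskians
  with both vanish at \<open>t\<close>. So the data at \<open>t\<close> are zero again, and the
  solution remains zero beyond.\<close>

lemma compactly_supported_solution:
  assumes u1: "sol I u1 q1 (\<lambda>_. 0)" and u2: "sol I u2 q2 (\<lambda>_. 0)"
    and det: "\<And>x. x \<in> I \<Longrightarrow> u1 x * q2 x - q1 x * u2 x = 1"
    and st: "s \<in> I" "t \<in> I" "s \<le> t" and k: "LL k" "\<And>x. x \<in> I \<Longrightarrow> x \<notin> {s..<t} \<Longrightarrow> k x = 0"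
    and orth: "(LINT x:I|rho. k x * u1 x) = 0" "(LINT x:I|rho. k x * u2 x) = 0"
  obtains u where "raw u k" "\<And>x. x \<in> I \<Longrightarrow> x \<notin> {s..<t} \<Longrightarrow> u x = 0 \<and> qd u x = 0"
    "\<And>x. x \<in> {s, t} \<Longrightarrow> u x = 0 \<and> qd u x = 0"
proof -
  obtain u q where u: "sol I u q k" "u s = 0" "q s = 0"
    using sol_exists[OF st(1) L2_loc_integrable[OF k(1)], of 0 0] by blast
  have sub: "{s..t} \<subseteq> I" by (rule ivl_subset[OF st(1,2)])
  have L: "u t * r t - q t * w t = 0" if w: "sol I w r (\<lambda>_. 0)" and o: "(LINT x:I|rho. k x * w x) = 0" for w r
  proof -
    have "(LINT x:{s..<t}|rho. k x * w x) = 0"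
      using integral_cut(1)[OF st(1,2), of "\<lambda>x. k x * w x"] o k(2) by simp
    then show ?thesis using lagrange_identity(1)[OF u(1) w st(3) sub sub] u(2,3) by simp
  qed
  have ut: "u t = 0" and qt: "q t = 0"
    using zero_if_wronskians_zero[OF det[OF st(2)] L[OF u1 orth(1)] L[OF u2 orth(2)]] by simp_all
  have van: "u x = 0 \<and> q x = 0" if x: "x \<in> I" "x \<notin> {s..<t}" for x
  proof (cases "x < s")
    case True
    then have "{min x s..max x s} \<subseteq> I \<inter> I" using ivl_subset[OF x(1) st(1)] by auto
    moreover have "k r = 0" if "r \<in> {min x s..<max x s}" for r
    proof -
      have r: "r \<in> {x..s}" "r < s" using that True by auto
      have "r \<in> I" by (rule subsetD[OF ivl_subset[OF x(1) st(1)] r(1)])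
      then show ?thesis using k(2)[of r] r by auto
    qed
    ultimately show ?thesis using sol_vanishes[OF u(1-3)] by blast
  next
    case False
    then have xt: "t \<le> x" using x by auto
    then have "{min x t..max x t} \<subseteq> I \<inter> I" using ivl_subset[OF st(2) x(1)] by auto
    moreover have "k r = 0" if "r \<in> {min x t..<max x t}" for r
    proof -
      have r: "r \<in> {t..x}" using that xt by auto
      have "r \<in> I" by (rule subsetD[OF ivl_subset[OF st(2) x(1)] r])
      then show ?thesis using k(2)[of r] r by auto
    qed
    ultimately show ?thesis using sol_vanishes[OF u(1) ut qt] by blast
  qed
  have "LL u"
  proof (cases "s < t")
    case True
    have "LL (\<lambda>x. indicat_real {s..<t} x *\<^sub>R u x)"
      by (rule bm_on_L2_cut[OF st(1,2) solD(1)[OF u(1) st(1,2) True]])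
    moreover have "(\<lambda>x. indicat_real I x *\<^sub>R (indicat_real {s..<t} x *\<^sub>R u x)) = (\<lambda>x. indicat_real I x *\<^sub>R u x)"
      "(\<lambda>x. indicat_real I x *\<^sub>R (cmod (indicat_real {s..<t} x *\<^sub>R u x))\<^sup>2) = (\<lambda>x. indicat_real I x *\<^sub>R (cmod (u x))\<^sup>2)"
      using van by (auto simp: indicator_def fun_eq_iff)
    ultimately show ?thesis unfolding L2_def set_borel_measurable_def set_integrable_def by simp
  next
    case False
    then have "(\<lambda>x. indicat_real I x *\<^sub>R u x) = (\<lambda>x. 0)" "(\<lambda>x. indicat_real I x *\<^sub>R (cmod (u x))\<^sup>2) = (\<lambda>x. 0)"
      using van by (auto simp: indicator_def fun_eq_iff)
    then show ?thesis unfolding L2_def set_borel_measurable_def set_integrable_def by simp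
  qed
  then have "raw u k" using k(1) sol_tau[OF u(1)] by (intro rawI)
  then show thesis
  proof (rule that)
    note q = qd_eq[OF u(1)]
    show "u x = 0 \<and> qd u x = 0" if "x \<in> I" "x \<notin> {s..<t}" for x
      using van[OF that] q[OF that(1)] by simp
    \<comment> \<open>The previous clause leaves out \<open>s\<close>, but the boundary terms of the
      Lagrange identity on \<open>[s, t)\<close> include the values there.\<close>
    show "u x = 0 \<and> qd u x = 0" if "x \<in> {s, t}" for x
      using that q[OF st(1)] q[OF st(2)] u(2,3) ut qt by auto
  qed
qed

text \<open>An adjoint pair and a particular solution \<open>ft\<close> of
  \<open>\<tau> ft = g\<close> have the same pairing with every compactly supported \<open>k\<close>
  that is orthogonal to \<open>u1\<close> and \<open>u2\<close>. Hence pairing with their difference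
  is a combination of the pairings with \<open>u1\<close> and \<open>u2\<close>, and compactly
  supported functions are rich enough to read this as an equality almost everywhere.\<close>

lemma adjoint_in_maximal:
  assumes S: "\<And>u k s t. raw u k \<Longrightarrow> s \<in> I \<Longrightarrow> t \<in> I \<Longrightarrow>
      (\<And>x. x \<in> I \<Longrightarrow> x \<notin> {s..<t} \<Longrightarrow> u x = 0 \<and> qd u x = 0) \<Longrightarrow> (u, k) \<in> S"
    and fg: "(f, g) \<in> adj I rho S"
  obtains f' where "raw f' g" "aeq I rho f f'"
proof -
  have Lf: "LL f" and Lg: "LL g" and ad: "\<And>u v. (u, v) \<in> S \<Longrightarrow> linner I rho g u = linner I rho f v"
    using fg by (auto simp: adj_def)
  obtain ft pt where ft: "sol I ft pt g" using sol_exists[OF c_in L2_loc_integrable[OF Lg], of 0 0] by blast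
  have z: "set_integrable rho {s..<t} (\<lambda>_. 0::complex)" for s t by (simp add: set_integrable_def)
  obtain u1 q1 where u1: "sol I u1 q1 (\<lambda>_. 0)" "u1 c = 1" "q1 c = 0" using sol_exists[OF c_in z, of 1 0] by blast
  obtain u2 q2 where u2: "sol I u2 q2 (\<lambda>_. 0)" "u2 c = 0" "q2 c = 1" using sol_exists[OF c_in z, of 0 1] by blast
  have det: "u1 x * q2 x - q1 x * u2 x = 1" if x: "x \<in> I" for x
  proof (cases "c \<le> x")
    case True
    show ?thesis
      using lagrange_identity(1)[OF u1(1) u2(1) True ivl_subset[OF c_in x] ivl_subset[OF c_in x]] u1 u2
      by (simp add: set_lebesgue_integral_def)
  next
    case False
    then have "x \<le> c" by simp
    then show ?thesis
      using lagrange_identity(1)[OF u1(1) u2(1) _ ivl_subset[OF x c_in] ivl_subset[OF x c_in]] u1 u2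
      by (simp add: set_lebesgue_integral_def)
  qed
  \<comment> \<open>Compact support makes the pairings with \<open>ft\<close>, \<open>u1\<close> and
    \<open>u2\<close> finite, of which only local boundedness is known.\<close>
  define K where "K = {k. LL k \<and> (\<exists>s t. s \<in> I \<and> t \<in> I \<and> s < t \<and> (\<forall>x. x \<notin> {s..<t} \<longrightarrow> k x = 0))}"
  have Kbm: "set_integrable rho I (\<lambda>x. k x * w x)" if k: "k \<in> K" and w: "\<And>s t. s \<in> I \<Longrightarrow> t \<in> I \<Longrightarrow> s < t \<Longrightarrow> bm_on {s..<t} w" for k w
  proof -
    obtain s t where st: "s \<in> I" "t \<in> I" "s < t" "\<And>x. x \<notin> {s..<t} \<Longrightarrow> k x = 0" and Lk: "LL k"
      using k by (auto simp: K_def)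
    have "set_integrable rho {s..<t} (\<lambda>x. k x * w x)"
      by (rule set_integrable_mult_bm[OF sets_rho L2_loc_integrable[OF Lk ivl_subset[OF st(1,2)]] w[OF st(1-3)]])
    then show ?thesis using integral_cut(2)[OF st(1,2), of "\<lambda>x. k x * w x"] st(4) by simp
  qed
  \<comment> \<open>The conjugation is built into \<open>e\<close>, so that all three functionals
    are complex linear in \<open>k\<close>.\<close>
  define e where "e = (\<lambda>x. cnj (f x) - cnj (ft x))"
  have i1: "set_integrable rho I (\<lambda>x. k x * u1 x)" and i2: "set_integrable rho I (\<lambda>x. k x * u2 x)"
    and ie: "set_integrable rho I (\<lambda>x. k x * e x)" if k: "k \<in> K" for k
  proof -
    show "set_integrable rho I (\<lambda>x. k x * u1 x)" by (rule Kbm[OF k solD(1)[OF u1(1)]])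
    show "set_integrable rho I (\<lambda>x. k x * u2 x)" by (rule Kbm[OF k solD(1)[OF u2(1)]])
    have "set_integrable rho I (\<lambda>x. k x * cnj (f x))"
      using k by (intro L2_mult_integrable L2_cnj Lf) (simp add: K_def)
    moreover have "set_integrable rho I (\<lambda>x. k x * cnj (ft x))"
      by (rule Kbm[OF k bm_on_cnj[OF solD(1)[OF ft]]])
    ultimately have "set_integrable rho I (\<lambda>x. k x * cnj (f x) - k x * cnj (ft x))" by (rule set_integral_diff)
    then show "set_integrable rho I (\<lambda>x. k x * e x)" by (simp add: e_def right_diff_distrib)
  qed
  define l l1 l2 where "l = (\<lambda>k. LINT x:I|rho. k x * e x)" and "l1 = (\<lambda>k. LINT x:I|rho. k x * u1 x)"
    and "l2 = (\<lambda>k. LINT x:I|rho. k x * u2 x)"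
  have lin: "(LINT t:I|rho. (x t + m * y t) * w t) = (LINT t:I|rho. x t * w t) + m * (LINT t:I|rho. y t * w t)"
    if "set_integrable rho I (\<lambda>t. x t * w t)" "set_integrable rho I (\<lambda>t. y t * w t)" for x y w and m :: complex
  proof -
    have "(\<lambda>t. (x t + m * y t) * w t) = (\<lambda>t. x t * w t + m * (y t * w t))" by (simp add: algebra_simps fun_eq_iff)
    then show ?thesis using that by simp
  qed
  have comb: "(\<lambda>t. x t + m * y t) \<in> K" if x: "x \<in> K" and y: "y \<in> K" for x y m
  proof -
    obtain s t where st: "s \<in> I" "t \<in> I" "s < t" "\<And>r. r \<notin> {s..<t} \<Longrightarrow> x r = 0" using x by (auto simp: K_def)
    obtain s' t' where st': "s' \<in> I" "t' \<in> I" "s' < t'" "\<And>r. r \<notin> {s'..<t'} \<Longrightarrow> y r = 0" using y by (auto simp: K_def)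
    have "LL (\<lambda>t. x t + m * y t)" using x y by (intro L2_add L2_cmult) (auto simp: K_def)
    moreover have "min s s' \<in> I" "max t t' \<in> I" "min s s' < max t t'" using st st' by (auto simp: min_def max_def)
    moreover have "x r + m * y r = 0" if "r \<notin> {min s s'..<max t t'}" for r
    proof -
      have "r \<notin> {s..<t}" "r \<notin> {s'..<t'}" using that by auto
      then show ?thesis using st(4) st'(4) by simp
    qed
    ultimately show ?thesis unfolding K_def by blast
  qed
  have ker: "l k = 0" if k: "k \<in> K" and o: "l1 k = 0" "l2 k = 0" for k
  proof -
    obtain s t where st: "s \<in> I" "t \<in> I" "s < t" and k0: "\<And>x. x \<notin> {s..<t} \<Longrightarrow> k x = 0" and Lk: "LL k"
      using k by (auto simp: K_def)
    obtain u where u: "raw u k" "\<And>x. x \<in> I \<Longrightarrow> x \<notin> {s..<t} \<Longrightarrow> u x = 0 \<and> qd u x = 0"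
      "\<And>x. x \<in> {s, t} \<Longrightarrow> u x = 0 \<and> qd u x = 0"
      by (rule compactly_supported_solution[OF u1(1) u2(1) det st(1,2) less_imp_le[OF st(3)] Lk k0 o[unfolded l1_def l2_def]]) auto
    have "(u, k) \<in> S" by (rule S[OF u(1) st(1,2) u(2)])
    then have "linner I rho g u = linner I rho f k" by (rule ad)
    then have 1: "(LINT x:{s..<t}|rho. g x * cnj (u x)) = (LINT x:{s..<t}|rho. f x * cnj (k x))"
      unfolding linner_def using integral_cut(1)[OF st(1,2), of "\<lambda>x. g x * cnj (u x)"]
        integral_cut(1)[OF st(1,2), of "\<lambda>x. f x * cnj (k x)"] u(2) k0 by simp
    note uc = sol_cnj[OF ivl_subset tau_sol[OF rawD(3)[OF u(1)]]]
    have sub: "{s..t} \<subseteq> I" by (rule ivl_subset[OF st(1,2)])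
    have "(LINT x:{s..<t}|rho. g x * cnj (u x) - ft x * cnj (k x)) = 0"
      using lagrange_identity(1)[OF ft uc less_imp_le[OF st(3)] sub sub] u(3) by simp
    moreover have ig: "set_integrable rho {s..<t} (\<lambda>x. g x * cnj (u x))"
      using integral_cut(2)[OF st(1,2), of "\<lambda>x. g x * cnj (u x)"] u(2)
        L2_mult_integrable[OF Lg L2_cnj[OF rawD(1)[OF u(1)]]] by simp
    moreover have ift: "set_integrable rho {s..<t} (\<lambda>x. ft x * cnj (k x))"
      using set_integrable_mult_bm[OF sets_rho L2_loc_integrable[OF L2_cnj[OF Lk] sub] solD(1)[OF ft st]]
      by (simp add: mult.commute)
    ultimately have 2: "(LINT x:{s..<t}|rho. g x * cnj (u x)) = (LINT x:{s..<t}|rho. ft x * cnj (k x))" by simp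
    have iff: "set_integrable rho {s..<t} (\<lambda>x. f x * cnj (k x))"
      using integral_cut(2)[OF st(1,2), of "\<lambda>x. f x * cnj (k x)"] k0
        L2_mult_integrable[OF Lf L2_cnj[OF Lk]] by simp
    have "(LINT x:{s..<t}|rho. f x * cnj (k x) - ft x * cnj (k x)) = 0"
      using 1 2 iff ift by simp
    moreover have "slint (pos_measure rho) {s..<t} (\<lambda>x. cnj (f x * cnj (k x) - ft x * cnj (k x)))
       = cnj (slint (pos_measure rho) {s..<t} (\<lambda>x. f x * cnj (k x) - ft x * cnj (k x)))" by (rule slint_cnj)
    ultimately have "(LINT x:{s..<t}|rho. cnj (f x * cnj (k x) - ft x * cnj (k x))) = 0" by (simp add: slint_pos_measure)
    moreover have "(\<lambda>x. cnj (f x * cnj (k x) - ft x * cnj (k x))) = (\<lambda>x. k x * e x)" by (simp add: e_def algebra_simps fun_eq_iff)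
    ultimately have "(LINT x:{s..<t}|rho. k x * e x) = 0" by simp
    then show ?thesis unfolding l_def using integral_cut(1)[OF st(1,2), of "\<lambda>x. k x * e x"] k0 by simp
  qed
  \<comment> \<open>One functional at a time: on the kernel of \<open>l2\<close> the functional
    \<open>l\<close> is a multiple of \<open>l1\<close>. After subtraction of that multiple the rest
    vanishes on the whole kernel of \<open>l2\<close>.\<close>
  have "\<exists>c1. \<forall>x\<in>{k\<in>K. l2 k = 0}. l x = c1 * l1 x"
  proof (rule functional_multiple)
    fix x y :: "real \<Rightarrow> complex" and k :: complex assume "x \<in> {k\<in>K. l2 k = 0}" "y \<in> {k\<in>K. l2 k = 0}"
    then have xy: "x \<in> K" "y \<in> K" "l2 x = 0" "l2 y = 0" by auto
    have "l2 (\<lambda>t. x t + k * y t) = l2 x + k * l2 y" unfolding l2_def by (rule lin[OF i2[OF xy(1)] i2[OF xy(2)]])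
    then show "(\<lambda>t. x t + k * y t) \<in> {k\<in>K. l2 k = 0}" using comb[OF xy(1,2)] xy by simp
    show "l (\<lambda>t. x t + k * y t) = l x + k * l y" unfolding l_def by (rule lin[OF ie[OF xy(1)] ie[OF xy(2)]])
    show "l1 (\<lambda>t. x t + k * y t) = l1 x + k * l1 y" unfolding l1_def by (rule lin[OF i1[OF xy(1)] i1[OF xy(2)]])
  qed (use ker in auto)
  then obtain c1 where c1: "\<And>x. x \<in> K \<Longrightarrow> l2 x = 0 \<Longrightarrow> l x = c1 * l1 x" by auto
  have "\<exists>c2. \<forall>x\<in>K. l x - c1 * l1 x = c2 * l2 x"
  proof (rule functional_multiple)
    fix x y :: "real \<Rightarrow> complex" and k :: complex assume xy: "x \<in> K" "y \<in> K"
    show "(\<lambda>t. x t + k * y t) \<in> K" by (rule comb[OF xy])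
    have "l (\<lambda>t. x t + k * y t) = l x + k * l y" unfolding l_def by (rule lin[OF ie[OF xy(1)] ie[OF xy(2)]])
    moreover have "l1 (\<lambda>t. x t + k * y t) = l1 x + k * l1 y" unfolding l1_def by (rule lin[OF i1[OF xy(1)] i1[OF xy(2)]])
    ultimately show "l (\<lambda>t. x t + k * y t) - c1 * l1 (\<lambda>t. x t + k * y t) = l x - c1 * l1 x + k * (l y - c1 * l1 y)"
      by (simp add: algebra_simps)
    show "l2 (\<lambda>t. x t + k * y t) = l2 x + k * l2 y" unfolding l2_def by (rule lin[OF i2[OF xy(1)] i2[OF xy(2)]])
  qed (use c1 in auto)
  then obtain c2 where c2: "\<And>x. x \<in> K \<Longrightarrow> l x - c1 * l1 x = c2 * l2 x" by auto
  define E where "E = (\<lambda>x. e x - c1 * u1 x - c2 * u2 x)"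
  have E0: "(LINT x:I|rho. k x * E x) = 0" if k: "k \<in> K" for k
  proof -
    have "(LINT x:I|rho. k x * E x) = (LINT x:I|rho. k x * e x - c1 * (k x * u1 x) - c2 * (k x * u2 x))"
      by (simp add: E_def algebra_simps)
    also have "\<dots> = l k - c1 * l1 k - c2 * l2 k"
      unfolding l_def l1_def l2_def using ie[OF k] i1[OF k] i2[OF k] by simp
    finally show ?thesis using c2[OF k] by (simp add: algebra_simps)
  qed
  have AE0: "AE x in rho. x \<in> {s..<t} \<longrightarrow> E x = 0" if st: "s \<in> I" "t \<in> I" "s < t" for s t
  proof -
    \<comment> \<open>Testing with the truncated conjugate of \<open>E\<close> itself produces the
      integral of its squared modulus.\<close>
    let ?k = "\<lambda>x. cnj (indicat_real {s..<t} x *\<^sub>R E x)"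
    have "LL (\<lambda>x. indicat_real {s..<t} x *\<^sub>R cnj (f x) + - 1 * (indicat_real {s..<t} x *\<^sub>R (cnj (ft x) + c1 * u1 x + c2 * u2 x)))"
      by (intro L2_add L2_cmult L2_cut[OF st(1,2)] L2_cnj Lf bm_on_L2_cut[OF st(1,2)] bm_on_add bm_on_mult bm_on_const
          bm_on_cnj solD(1)[OF ft st] solD(1)[OF u1(1) st] solD(1)[OF u2(1) st]) simp_all
    moreover have "(\<lambda>x. indicat_real {s..<t} x *\<^sub>R cnj (f x) + - 1 * (indicat_real {s..<t} x *\<^sub>R (cnj (ft x) + c1 * u1 x + c2 * u2 x)))
       = (\<lambda>x. indicat_real {s..<t} x *\<^sub>R E x)"
      by (auto simp: E_def e_def indicator_def fun_eq_iff)
    ultimately have LE: "LL (\<lambda>x. indicat_real {s..<t} x *\<^sub>R E x)" by simp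
    have "\<forall>x. x \<notin> {s..<t} \<longrightarrow> ?k x = 0" by simp
    then have "?k \<in> K" unfolding K_def using L2_cnj[OF LE] st by blast
    from E0[OF this] have 0: "(LINT x:I|rho. ?k x * E x) = 0" .
    have sub: "{s..<t} \<subseteq> I" using ivl_subset[OF st(1,2)] by auto
    define n where "n = (\<lambda>x. indicat_real I x *\<^sub>R (cmod (indicat_real {s..<t} x *\<^sub>R E x))\<^sup>2)"
    have n: "integrable rho n" using LE by (simp add: n_def L2_def set_integrable_def)
    have "(LINT x:I|rho. ?k x * E x) = (LINT x|rho. complex_of_real (n x))"
      unfolding set_lebesgue_integral_def
    proof (rule Bochner_Integration.integral_cong[OF refl])
      fix x
      have "cnj (E x) * E x = complex_of_real ((cmod (E x))\<^sup>2)" by (metis complex_norm_square mult.commute)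
      then show "indicat_real I x *\<^sub>R (?k x * E x) = complex_of_real (n x)"
        by (cases "x \<in> {s..<t}") (auto simp: n_def indicator_def)
    qed
    also have "\<dots> = complex_of_real (LINT x|rho. n x)" by (rule integral_complex_of_real)
    finally have "(LINT x|rho. n x) = 0" using 0 by simp
    then have "AE x in rho. n x = 0"
      using integral_nonneg_eq_0_iff_AE[OF n] by (simp add: n_def)
    then show ?thesis
    proof eventually_elim
      case (elim x)
      then show ?case using sub by (auto simp: n_def indicator_def split: if_splits)
    qed
  qed
  have AE_E: "AE x in rho. x \<in> I \<longrightarrow> E x = 0" by (rule AE_zero_from_local[OF AE0])
  \<comment> \<open>Undoes the conjugation. The coefficients of the system are real, so conjugates
    of homogeneous solutions are again homogeneous solutions.\<close>
  define f' where "f' = (\<lambda>x. (ft x + cnj c1 * cnj (u1 x)) + cnj c2 * cnj (u2 x))"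
  have "sol I f' (\<lambda>x. (pt x + cnj c1 * cnj (q1 x)) + cnj c2 * cnj (q2 x)) (\<lambda>x. (g x + cnj c1 * cnj 0) + cnj c2 * cnj 0)"
    unfolding f'_def
    by (intro sol_add sol_cmult sol_cnj ft u1 u2 ivl_subset)
  then have sf': "sol I f' (\<lambda>x. (pt x + cnj c1 * cnj (q1 x)) + cnj c2 * cnj (q2 x)) g" by simp
  have ff': "aeq I rho f f'" unfolding aeq_def
    using AE_E
  proof eventually_elim
    case (elim x)
    show ?case
    proof
      assume "x \<in> I"
      then have "cnj (f x) = cnj (ft x) + c1 * u1 x + c2 * u2 x" using elim by (simp add: E_def e_def algebra_simps)
      then have "cnj (cnj (f x)) = cnj (cnj (ft x) + c1 * u1 x + c2 * u2 x)" by (rule arg_cong)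
      then show "f x = f' x" by (simp add: f'_def)
    qed
  qed
  have mf': "set_borel_measurable rho I f'" by (rule sol_borel_measurable[OF sf'])
  have "set_integrable rho I (\<lambda>x. (cmod (f' x))\<^sup>2)"
  proof (rule set_integrable_bound)
    show "set_integrable rho I (\<lambda>x. (cmod (f x))\<^sup>2)" using Lf by (simp add: L2_def)
    show "set_borel_measurable rho I (\<lambda>x. (cmod (f' x))\<^sup>2)"
      by (rule set_borel_measurable_cmod_square[OF mf'])
    show "AE x in rho. x \<in> I \<longrightarrow> norm ((cmod (f' x))\<^sup>2) \<le> norm ((cmod (f x))\<^sup>2)"
      using ff' unfolding aeq_def by eventually_elim auto
  qed
  then have "LL f'" using mf' by (simp add: L2_def)
  then have "raw f' g" using Lg sol_tau[OF sf'] by (intro rawI)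
  then show thesis using that ff' by blast
qed

end

section \<open>Self-adjoint boundary conditions at one endpoint\<close>

text \<open>For nonzero \<open>q\<close> the second assumption says that \<open>p / q\<close> is
  real. The complex line through \<open>(p, q)\<close> then has a real slope, and a slope determines
  an angle modulo \<open>pi\<close>.\<close>

lemma real_direction_angle:
  fixes p q :: complex
  assumes "(p, q) \<noteq> (0, 0)" "p * cnj q = q * cnj p"
  shows "\<exists>\<phi>. 0 \<le> \<phi> \<and> \<phi> < pi \<and> p * complex_of_real (cos \<phi>) = q * complex_of_real (sin \<phi>)"
proof (cases "q = 0")
  case True
  then show ?thesis by (intro exI[of _ "pi / 2"]) simp
next
  case False
  define r where "r = Re (p / q)"
  have "p / q = cnj (p / q)" using assms(2) False by (simp add: field_simps)
  then have "Im (p / q) = 0" by (metis complex_cnj_cancel_iff complex_cnj complex.sel(2) neg_equal_zero cnj.sel(2))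
  then have r: "p = complex_of_real r * q"
    using False complex_eq_iff[of "p / q" "complex_of_real r"] by (simp add: r_def field_simps)
  have key: "\<exists>\<phi>. 0 \<le> \<phi> \<and> \<phi> < pi \<and> r * cos \<phi> = sin \<phi>"
  proof (cases "0 \<le> r")
    case True
    have "r * cos (arctan r) = sin (arctan r)"
      using tan_arctan[of r] cos_arctan_not_zero[of r] by (simp add: tan_def field_simps)
    moreover have "0 \<le> arctan r" "arctan r < pi" using True arctan_ubound[of r] pi_gt_zero by (auto simp del: pi_gt_zero)
    ultimately show ?thesis by blast
  next
    case False
    \<comment> \<open>For a negative slope the arctangent is shifted into range; a shift by
      \<open>pi\<close> changes the signs of sine and cosine together.\<close>
    have "r * cos (arctan r + pi) = sin (arctan r + pi)"
      using tan_arctan[of r] cos_arctan_not_zero[of r] by (simp add: tan_def field_simps)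
    moreover have "0 \<le> arctan r + pi" "arctan r + pi < pi"
      using False arctan_lbound[of r] pi_gt_zero by (auto simp del: pi_gt_zero)
    ultimately show ?thesis by blast
  qed
  then obtain \<phi> where \<phi>: "0 \<le> \<phi>" "\<phi> < pi" "r * cos \<phi> = sin \<phi>" by blast
  have "p * complex_of_real (cos \<phi>) = q * complex_of_real (sin \<phi>)"
    unfolding r \<phi>(3)[symmetric] of_real_mult by (simp add: ac_simps)
  then show ?thesis using \<phi> by blast
qed

text \<open>Both pairs are complex multiples of the real vector
  \<open>(sin \<phi>, cos \<phi>)\<close>, so the determinant of one with the conjugate of the other
  vanishes.\<close>

lemma isotropic_pair:
  fixes p q p' q' :: complex and \<phi> :: real
  assumes "p * complex_of_real (cos \<phi>) = q * complex_of_real (sin \<phi>)"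
    and "p' * complex_of_real (cos \<phi>) = q' * complex_of_real (sin \<phi>)"
  shows "p * cnj q' - q * cnj p' = 0"
proof -
  define s k where "s = complex_of_real (sin \<phi>)" and "k = complex_of_real (cos \<phi>)"
  have sk: "s * s + k * k = 1"
    unfolding s_def k_def by (metis of_real_1 of_real_add of_real_mult power2_eq_square sin_cos_squared_add)
  have 1: "p * k = q * s" using assms(1) by (simp add: s_def k_def)
  have "cnj (p' * k) = cnj (q' * s)" using assms(2) by (simp add: s_def k_def)
  then have 2: "cnj p' * k = cnj q' * s" by (simp add: s_def k_def)
  \<comment> \<open>The factor, which equals 1, spares a division by the sine or the cosine, either
    of which may vanish.\<close>
  have "(p * cnj q' - q * cnj p') * (s * s + k * k) = 0" using 1 2 by algebra
  then show ?thesis by (simp add: sk)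
qed

text \<open>In two dimensions the form is nondegenerate, so an isotropic line is its own
  complement.\<close>

lemma orthogonal_to_direction:
  fixes p q p' q' :: complex and \<phi> :: real
  assumes "(p', q') \<noteq> (0, 0)" "p' * complex_of_real (cos \<phi>) = q' * complex_of_real (sin \<phi>)"
    and "p * cnj q' - q * cnj p' = 0"
  shows "p * complex_of_real (cos \<phi>) = q * complex_of_real (sin \<phi>)"
proof -
  define s k where "s = complex_of_real (sin \<phi>)" and "k = complex_of_real (cos \<phi>)"
  have sk: "s * s + k * k = 1"
    unfolding s_def k_def by (metis of_real_1 of_real_add of_real_mult power2_eq_square sin_cos_squared_add)
  have "cnj (p' * k) = cnj (q' * s)" using assms(2) by (simp add: s_def k_def)
  then have 2: "cnj p' * k = cnj q' * s" by (simp add: s_def k_def)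
  \<comment> \<open>The coefficient of the conjugated pair along the unit vector
    \<open>(s, k)\<close>.\<close>
  define m where "m = cnj p' * s + cnj q' * k"
  have p': "cnj p' = m * s" and q': "cnj q' = m * k" unfolding m_def using 2 sk by algebra+
  have "m \<noteq> 0" using p' q' assms(1) by auto
  moreover have "m * (p * k - q * s) = 0" using assms(3) unfolding p' q' by algebra
  ultimately show ?thesis by (simp add: s_def k_def)
qed

context measure_sl
begin

lemma aeq_sym: "aeq I rho f g \<Longrightarrow> aeq I rho g f"
  unfolding aeq_def by (erule eventually_mono) auto

lemma aeq_refl: "aeq I rho f f"
  by (simp add: aeq_def)

lemma linner_cong:
  assumes "LL f" "LL f'" "LL u" "LL u'" and f: "aeq I rho f f'" and u: "aeq I rho u u'"
  shows "linner I rho f u = linner I rho f' u'"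
  unfolding linner_def set_lebesgue_integral_def
proof (rule Bochner_Integration.integral_cong_AE)
  have "set_integrable rho I (\<lambda>x. f x * cnj (u x))" "set_integrable rho I (\<lambda>x. f' x * cnj (u' x))"
    by (intro L2_mult_integrable L2_cnj assms)+
  then show "(\<lambda>x. indicat_real I x *\<^sub>R (f x * cnj (u x))) \<in> borel_measurable rho"
    "(\<lambda>x. indicat_real I x *\<^sub>R (f' x * cnj (u' x))) \<in> borel_measurable rho"
    unfolding set_integrable_def by auto
  show "AE x in rho. indicat_real I x *\<^sub>R (f x * cnj (u x)) = indicat_real I x *\<^sub>R (f' x * cnj (u' x))"
    using f u unfolding aeq_def by eventually_elim (auto simp: indicator_def)
qed

lemma sat_mono: "R \<subseteq> R' \<Longrightarrow> sat I rho R \<subseteq> sat I rho R'"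
  unfolding sat_def by blast

lemma subset_sat: "R \<subseteq> Tmax_raw I rho sig chi c \<Longrightarrow> R \<subseteq> sat I rho R"
  using rawD(1,2) aeq_refl unfolding sat_def by fastforce

end

text \<open>The endpoint \<open>Fe\<close> carries the boundary condition; Green's formula has no contribution from the
other one, and \<open>\<kappa>\<close> is the sign with which \<open>Fe\<close> enters.\<close>
locale one_sided_green = measure_sl +
  fixes Fe :: "real filter" and \<kappa> :: complex
  assumes nontriv: "Fe \<noteq> bot" and \<kappa>: "\<kappa> \<noteq> 0"
    and ev_I: "eventually (\<lambda>x. x \<in> I) Fe"
    and ev_away: "\<And>s t. s \<in> I \<Longrightarrow> t \<in> I \<Longrightarrow> eventually (\<lambda>x. x \<notin> {s..<t}) Fe"
    and tend: "\<And>f g u v. raw f g \<Longrightarrow> raw u v \<Longrightarrow> (W f u \<longlongrightarrow> V Fe f u) Fe"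
    and green': "\<And>f g u v. raw f g \<Longrightarrow> raw u v \<Longrightarrow>
      linner I rho g u - linner I rho f v = \<kappa> * V Fe f (\<lambda>x. cnj (u x))"
begin

abbreviation "B \<equiv> wr_end I rho sig chi c Fe"

text \<open>Carries pointwise identities between Wronskians to the endpoint, where the limit is
  unique because \<open>Fe\<close> is nontrivial.\<close>

lemma B_eqI:
  assumes "raw f g" "raw u v" "(X \<longlongrightarrow> L) Fe" "\<And>x. x \<in> I \<Longrightarrow> W f u x = X x"
  shows "B f u = L"
proof -
  have "eventually (\<lambda>x. W f u x = X x) Fe" using ev_I by eventually_elim (rule assms(4))
  then have "(X \<longlongrightarrow> B f u) Fe" using tend[OF assms(1,2)] by (rule Lim_transform_eventually[rotated])
  then show ?thesis using tendsto_unique[OF nontriv _ assms(3)] by blast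
qed

lemma B_antisym: assumes "raw f g" "raw u v" shows "B u f = - B f u"
  by (rule B_eqI[OF assms(2,1) tendsto_minus[OF tend[OF assms]]]) (simp add: W_eq)

lemma B_cnj: assumes "raw f g" "raw u v" shows "B (\<lambda>x. cnj (f x)) (\<lambda>x. cnj (u x)) = cnj (B f u)"
  by (rule B_eqI[OF raw_cnj[OF assms(1)] raw_cnj[OF assms(2)] tendsto_cnj[OF tend[OF assms]]])
     (rule W_cnj[OF rawD(3)[OF assms(1)] rawD(3)[OF assms(2)]])

lemma B_lincomb:
  assumes f: "raw f g" and u: "raw u v" and w: "raw w r"
  shows "B (\<lambda>x. k * f x + l * u x) w = k * B f w + l * B u w"
    and "B w (\<lambda>x. k * f x + l * u x) = k * B w f + l * B w u"
proof -
  note fu = raw_add[OF raw_cmult[OF f] raw_cmult[OF u], of k l]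
  show "B (\<lambda>x. k * f x + l * u x) w = k * B f w + l * B u w"
    by (rule B_eqI[OF fu w tendsto_add[OF tendsto_mult[OF tendsto_const tend[OF f w]] tendsto_mult[OF tendsto_const tend[OF u w]]]])
       (rule W_lincomb(1)[OF rawD(3)[OF f] rawD(3)[OF u]])
  show "B w (\<lambda>x. k * f x + l * u x) = k * B w f + l * B w u"
    by (rule B_eqI[OF w fu tendsto_add[OF tendsto_mult[OF tendsto_const tend[OF w f]] tendsto_mult[OF tendsto_const tend[OF w u]]]])
       (rule W_lincomb(2)[OF rawD(3)[OF f] rawD(3)[OF u]])
qed

text \<open>At each point \<open>W\<close> is a determinant of value pairs \<open>(f, qd f)\<close>
  in the plane, where the relation is algebraic; it survives in the limit.\<close>

lemma B_plucker:
  assumes "raw f1 g1" "raw f2 g2" "raw f3 g3" "raw f4 g4"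
  shows "B f1 f2 * B f3 f4 + B f1 f3 * B f4 f2 + B f1 f4 * B f2 f3 = 0"
proof -
  have "((\<lambda>x. W f1 f2 x * W f3 f4 x + W f1 f3 x * W f4 f2 x + W f1 f4 x * W f2 f3 x) \<longlongrightarrow>
     B f1 f2 * B f3 f4 + B f1 f3 * B f4 f2 + B f1 f4 * B f2 f3) Fe"
    by (intro tendsto_intros tend[OF assms(1) assms(2)] tend[OF assms(1) assms(3)] tend[OF assms(1) assms(4)]
        tend[OF assms(3) assms(4)] tend[OF assms(4) assms(2)] tend[OF assms(2) assms(3)])
  moreover have "(\<lambda>x. W f1 f2 x * W f3 f4 x + W f1 f3 x * W f4 f2 x + W f1 f4 x * W f2 f3 x) = (\<lambda>x. 0)"
    by (simp add: fun_eq_iff W_eq algebra_simps)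
  ultimately show ?thesis using tendsto_unique[OF nontriv _ tendsto_const] by metis
qed

lemma B_compact_support:
  assumes "s \<in> I" "t \<in> I" "\<And>x. x \<in> I \<Longrightarrow> x \<notin> {s..<t} \<Longrightarrow> u x = 0 \<and> qd u x = 0"
  shows "B u w = 0" "B w u = 0"
proof -
  have ev: "eventually (\<lambda>x. u x = 0 \<and> qd u x = 0) Fe"
    using ev_I ev_away[OF assms(1,2)] by eventually_elim (rule assms(3))
  have "eventually (\<lambda>x. W u w x = 0) Fe" "eventually (\<lambda>x. W w u x = 0) Fe"
    using ev by (eventually_elim; simp add: W_eq)+
  then have "(W u w \<longlongrightarrow> 0) Fe" "(W w u \<longlongrightarrow> 0) Fe" by (auto intro: tendsto_eventually)
  then show "B u w = 0" "B w u = 0" unfolding wr_end_def by (auto intro: tendsto_Lim[OF nontriv])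
qed

lemma adjoint_iff_B:
  assumes f: "raw f g" and u: "raw u v"
  shows "linner I rho g u = linner I rho f v \<longleftrightarrow> B f (\<lambda>x. cnj (u x)) = 0"
  using green'[OF f u] \<kappa> by auto

text \<open>The boundary values involve the conjugates of \<open>w1\<close> and \<open>w2\<close>,
  which need not be real. The form is expanded along the dual pair formed by the conjugate of
  \<open>w1\<close> and \<open>w2\<close> itself, and then \<open>w2\<close> is traded for its
  conjugate.\<close>

lemma boundary_form:
  assumes w1: "raw w1 v1" and w2: "raw w2 v2"
    and b12: "B w1 (\<lambda>x. cnj (w2 x)) = 1" and b11: "B w1 (\<lambda>x. cnj (w1 x)) = 0" and b22: "B w2 (\<lambda>x. cnj (w2 x)) = 0"
    and f: "raw f g" and h: "raw h k"
  shows "B f (\<lambda>x. cnj (h x)) = B f (\<lambda>x. cnj (w2 x)) * cnj (B (\<lambda>x. cnj (w1 x)) h) - B (\<lambda>x. cnj (w1 x)) f * cnj (B h (\<lambda>x. cnj (w2 x)))"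
proof -
  define w1' w2' h' where "w1' = (\<lambda>x. cnj (w1 x))" and "w2' = (\<lambda>x. cnj (w2 x))" and "h' = (\<lambda>x. cnj (h x))"
  note r = w1 w2 f h raw_cnj[OF w1, folded w1'_def] raw_cnj[OF w2, folded w2'_def] raw_cnj[OF h, folded h'_def]
  have a: "B w1 w2' = 1" "B w1 w1' = 0" "B w2 w2' = 0" using b12 b11 b22 by (simp_all add: w1'_def w2'_def)
  have "B w1' w2 = cnj (B w1 w2')" using B_cnj[OF w1 r(6)] by (simp add: w1'_def w2'_def)
  then have a2: "B w1' w2 = 1" by (simp add: a)
  have a3: "B w2' w1 = - 1" "B w2 w1' = - 1" "B w2' w2 = 0"
    using B_antisym[OF r(1) r(6)] B_antisym[OF r(5) r(2)] B_antisym[OF r(2) r(6)] a a2 by auto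
  \<comment> \<open>The normalisation leaves the value of \<open>B w1' w2'\<close> open. The
    relations \<open>e1\<close> and \<open>e2\<close> shift this factor from one Wronskian to the
    other, so that it disappears from the product in \<open>e3\<close>.\<close>
  have e1: "B f w2 * B w1' w2' = B f w2'" using B_plucker[OF r(3) r(2) r(5) r(6)] a3 by simp
  have e2: "B h' w1 * B w1' w2' = B h' w1'" using B_plucker[OF r(7) r(1) r(5) r(6)] a a3 by simp
  have e3: "B f h' + B f w1' * B w2 h' + B f w2 * B h' w1' = 0" using B_plucker[OF r(3) r(7) r(5) r(2)] a2 by simp
  have c1: "B w1 h' = cnj (B w1' h)" using B_cnj[OF r(5) r(4)] by (simp add: w1'_def h'_def)
  have c2: "B w2 h' = cnj (B w2' h)" using B_cnj[OF r(6) r(4)] by (simp add: w2'_def h'_def)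
  have m1: "B h' w1 = - cnj (B w1' h)" using B_antisym[OF r(1) r(7)] c1 by simp
  have m2: "B w2 h' = - cnj (B h w2')" using c2 B_antisym[OF r(4) r(6)] by simp
  have m3: "B f w1' = - B w1' f" using B_antisym[OF r(5) r(3)] by simp
  have "B f w2 * B h' w1' = - (B f w2 * B w1' w2') * cnj (B w1' h)" unfolding e2[symmetric] m1 by (simp add: algebra_simps)
  then have e4: "B f w2 * B h' w1' = - B f w2' * cnj (B w1' h)" unfolding e1 by simp
  have "B f h' = - (B f w1' * B w2 h') - B f w2 * B h' w1'" using e3 by algebra
  also have "\<dots> = B f w2' * cnj (B w1' h) - B w1' f * cnj (B h w2')" unfolding e4 m2 m3 by simp
  finally have "B f h' = B f w2' * cnj (B w1' h) - B w1' f * cnj (B h w2')" .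
  then show ?thesis by (simp add: w1'_def w2'_def h'_def)
qed

theorem self_adjoint_restriction_iff:
  assumes w1: "in_Tmax I rho sig chi c w1" and w2: "in_Tmax I rho sig chi c w2"
    and b12: "B w1 (\<lambda>x. cnj (w2 x)) = 1" and b11: "B w1 (\<lambda>x. cnj (w1 x)) = 0" and b22: "B w2 (\<lambda>x. cnj (w2 x)) = 0"
    and lin: "linear_rel I rho S"
  shows "(S \<subseteq> Tmax I rho sig chi c \<and> adj I rho S = S) \<longleftrightarrow>
    (\<exists>phi. 0 \<le> phi \<and> phi < pi \<and> S = bc_rel I rho sig chi c Fe w1 w2 phi)"
proof -
  obtain v1 v2 where r1: "raw w1 v1" and r2: "raw w2 v2" using w1 w2 by (auto simp: in_Tmax_def)
  define P Q where "P = (\<lambda>f. B f (\<lambda>x. cnj (w2 x)))" and "Q = (\<lambda>f. B (\<lambda>x. cnj (w1 x)) f)"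
  have form: "B f (\<lambda>x. cnj (h x)) = P f * cnj (Q h) - Q f * cnj (P h)" if "raw f g" "raw h k" for f g h k
    unfolding P_def Q_def by (rule boundary_form[OF r1 r2 b12 b11 b22 that])
  \<comment> \<open>The representatives that satisfy the condition literally, before closing under
    equality almost everywhere.\<close>
  define D where "D = (\<lambda>\<phi>. {(f, g). raw f g \<and> P f * complex_of_real (cos \<phi>) = Q f * complex_of_real (sin \<phi>)})"
  have bc: "bc_rel I rho sig chi c Fe w1 w2 \<phi> = sat I rho (D \<phi>)" for \<phi>
    unfolding bc_rel_def D_def P_def Q_def by (intro arg_cong[where f="sat I rho"]) auto
  have D_raw: "D \<phi> \<subseteq> Tmax_raw I rho sig chi c" for \<phi> by (auto simp: D_def)
  have Bc: "B (\<lambda>x. cnj (w1 x)) w2 = 1"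
    using B_cnj[OF r1 raw_cnj[OF r2]] b12 by simp
  have Bc1: "B (\<lambda>x. cnj (w1 x)) w1 = 0"
    using B_antisym[OF r1 raw_cnj[OF r1]] b11 by simp
  \<comment> \<open>The boundary values of \<open>w1\<close> and \<open>w2\<close> are the unit
    vectors, so all of \<open>\<complex>^2\<close> is attained.\<close>
  have PQ: "P w1 = 1" "Q w1 = 0" "P w2 = 0" "Q w2 = 1"
    using b12 b22 Bc Bc1 by (simp_all add: P_def Q_def)
  show ?thesis
  proof
    assume "\<exists>phi. 0 \<le> phi \<and> phi < pi \<and> S = bc_rel I rho sig chi c Fe w1 w2 phi"
    then obtain \<phi> where S: "S = sat I rho (D \<phi>)" unfolding bc by blast
    have DS: "D \<phi> \<subseteq> S" unfolding S by (rule subset_sat[OF D_raw])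
    have "S \<subseteq> Tmax I rho sig chi c" unfolding S Tmax_def by (rule sat_mono[OF D_raw])
    moreover have "S \<subseteq> adj I rho S"
    proof (rule subrelI)
      fix f g assume fg: "(f, g) \<in> S"
      then obtain f' g' where f': "LL f" "LL g" "(f', g') \<in> D \<phi>" "aeq I rho f f'" "aeq I rho g g'"
        unfolding S sat_def by blast
      have rf: "raw f' g'" using f'(3) by (simp add: D_def)
      have "linner I rho g u = linner I rho f v" if uv: "(u, v) \<in> S" for u v
      proof -
        obtain u' v' where u': "LL u" "LL v" "(u', v') \<in> D \<phi>" "aeq I rho u u'" "aeq I rho v v'"
          using uv unfolding S sat_def by blast
        have ru: "raw u' v'" using u'(3) by (simp add: D_def)
        have "B f' (\<lambda>x. cnj (u' x)) = 0"
          unfolding form[OF rf ru] by (rule isotropic_pair[of _ \<phi>]) (use f'(3) u'(3) in \<open>auto simp: D_def\<close>)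
        then have "linner I rho g' u' = linner I rho f' v'" using adjoint_iff_B[OF rf ru] by simp
        moreover have "linner I rho g u = linner I rho g' u'"
          by (rule linner_cong[OF f'(2) rawD(2)[OF rf] u'(1) rawD(1)[OF ru] f'(5) u'(4)])
        moreover have "linner I rho f v = linner I rho f' v'"
          by (rule linner_cong[OF f'(1) rawD(1)[OF rf] u'(2) rawD(2)[OF ru] f'(4) u'(5)])
        ultimately show ?thesis by simp
      qed
      then show "(f, g) \<in> adj I rho S" using f'(1,2) by (auto simp: adj_def)
    qed
    moreover have "adj I rho S \<subseteq> S"
    proof (rule subrelI)
      fix f g assume fg: "(f, g) \<in> adj I rho S"
      then have Lf: "LL f" and Lg: "LL g" and ad: "\<And>u v. (u, v) \<in> S \<Longrightarrow> linner I rho g u = linner I rho f v"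
        by (auto simp: adj_def)
      have compact: "(u, k) \<in> S" if "raw u k" "s \<in> I" "t \<in> I" "\<And>x. x \<in> I \<Longrightarrow> x \<notin> {s..<t} \<Longrightarrow> u x = 0 \<and> qd u x = 0" for u k s t
      proof -
        have "P u = 0" "Q u = 0" unfolding P_def Q_def using B_compact_support[OF that(2-4)] by auto
        then have "(u, k) \<in> D \<phi>" using that(1) by (simp add: D_def)
        then show ?thesis using DS by blast
      qed
      obtain f' where f': "raw f' g" "aeq I rho f f'"
        by (rule adjoint_in_maximal[OF compact fg])
      \<comment> \<open>An element whose boundary values \<open>(sin \<phi>, cos \<phi>)\<close>
        span the line. It lies in \<open>S\<close>, and pairing with it returns exactly the boundary
        condition for \<open>f'\<close>.\<close>
      define w v where "w = (\<lambda>x. complex_of_real (sin \<phi>) * w1 x + complex_of_real (cos \<phi>) * w2 x)"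
        and "v = (\<lambda>x. complex_of_real (sin \<phi>) * v1 x + complex_of_real (cos \<phi>) * v2 x)"
      have rw: "raw w v" unfolding w_def v_def by (rule raw_add[OF raw_cmult[OF r1] raw_cmult[OF r2]])
      have Pw: "P w = complex_of_real (sin \<phi>)" and Qw: "Q w = complex_of_real (cos \<phi>)"
        using B_lincomb(1)[OF r1 r2 raw_cnj[OF r2], of "complex_of_real (sin \<phi>)" "complex_of_real (cos \<phi>)"]
          B_lincomb(2)[OF r1 r2 raw_cnj[OF r1], of "complex_of_real (sin \<phi>)" "complex_of_real (cos \<phi>)"] PQ
        unfolding P_def Q_def w_def by simp_all
      have wS: "(w, v) \<in> S" using DS rw Pw Qw by (auto simp: D_def mult.commute)
      have "linner I rho g w = linner I rho f v" by (rule ad[OF wS])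
      also have "\<dots> = linner I rho f' v"
        by (rule linner_cong[OF Lf rawD(1)[OF f'(1)] rawD(2)[OF rw] rawD(2)[OF rw] f'(2) aeq_refl])
      finally have "B f' (\<lambda>x. cnj (w x)) = 0" using adjoint_iff_B[OF f'(1) rw] by simp
      then have "(f', g) \<in> D \<phi>" using f'(1) unfolding form[OF f'(1) rw] Pw Qw by (simp add: D_def)
      then show "(f, g) \<in> S" unfolding S sat_def using Lf Lg f'(2) aeq_refl by blast
    qed
    ultimately show "S \<subseteq> Tmax I rho sig chi c \<and> adj I rho S = S" by blast
  next
    assume "S \<subseteq> Tmax I rho sig chi c \<and> adj I rho S = S"
    then have ST: "S \<subseteq> Tmax I rho sig chi c" and ad: "adj I rho S = S" by auto
    have satS: "sat I rho S = S" using lin by (simp add: linear_rel_def)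
    \<comment> \<open>As \<open>S\<close> is saturated and contained in \<open>Tmax\<close>, each of
      its elements is equivalent to one of these representatives, so \<open>S\<close> can be
      recovered from them.\<close>
    define R where "R = {(f, g) \<in> S. raw f g}"
    have rep: "\<exists>f' g'. (f', g') \<in> R \<and> aeq I rho f f' \<and> aeq I rho g g'" if fg: "(f, g) \<in> S" for f g
    proof -
      obtain f' g' where f': "LL f" "LL g" "raw f' g'" "aeq I rho f f'" "aeq I rho g g'"
        using ST fg unfolding Tmax_def sat_def by blast
      have "(f', g') \<in> sat I rho S"
        unfolding sat_def using fg rawD(1,2)[OF f'(3)] aeq_sym[OF f'(4)] aeq_sym[OF f'(5)] by blast
      then show ?thesis using f' satS by (auto simp: R_def)
    qed
    have LS: "LL f \<and> LL g" if "(f, g) \<in> S" for f g using ad that by (auto simp: adj_def)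
    have SR: "S = sat I rho R"
    proof
      show "S \<subseteq> sat I rho R" using rep LS unfolding sat_def by blast
      have "sat I rho R \<subseteq> sat I rho S" by (rule sat_mono) (auto simp: R_def)
      then show "sat I rho R \<subseteq> S" using satS by simp
    qed
    have iso: "B f (\<lambda>x. cnj (u x)) = 0" if fg: "(f, g) \<in> R" and uv: "(u, v) \<in> R" for f g u v
    proof -
      have "(f, g) \<in> adj I rho S" "(u, v) \<in> S" "raw f g" "raw u v" using fg uv ad by (auto simp: R_def)
      then show ?thesis using adjoint_iff_B[of f g u v] by (auto simp: adj_def)
    qed
    \<comment> \<open>The inclusion of the adjoint in \<open>S\<close>, read on boundary values; the
      opposite inclusion is \<open>iso\<close>. Together they make the boundary values of
      \<open>R\<close> their own complement.\<close>
    have max: "(f, g) \<in> S" if rf: "raw f g" and z: "\<And>u v. (u, v) \<in> R \<Longrightarrow> B f (\<lambda>x. cnj (u x)) = 0" for f g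
    proof -
      have "linner I rho g u = linner I rho f v" if uv: "(u, v) \<in> S" for u v
      proof -
        obtain u' v' where u': "(u', v') \<in> R" "aeq I rho u u'" "aeq I rho v v'" using rep[OF uv] by blast
        have ru: "raw u' v'" using u'(1) by (simp add: R_def)
        have "linner I rho g u' = linner I rho f v'" using adjoint_iff_B[OF rf ru] z[OF u'(1)] by simp
        moreover have "linner I rho g u = linner I rho g u'"
          by (rule linner_cong) (use rawD[OF rf] rawD[OF ru] LS[OF uv] u' aeq_refl in auto)
        moreover have "linner I rho f v = linner I rho f v'"
          by (rule linner_cong) (use rawD[OF rf] rawD[OF ru] LS[OF uv] u' aeq_refl in auto)
        ultimately show ?thesis by simp
      qed
      then have "(f, g) \<in> adj I rho S" using rawD[OF rf] by (auto simp: adj_def)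
      then show ?thesis using ad by simp
    qed
    \<comment> \<open>If all boundary values in \<open>R\<close> vanished, the form would annihilate
      \<open>w1\<close> against \<open>R\<close>, and \<open>max\<close> would put \<open>w1\<close>
      into \<open>R\<close> although its boundary values are \<open>(1, 0)\<close>.\<close>
    have "\<exists>u v. (u, v) \<in> R \<and> (P u, Q u) \<noteq> (0, 0)"
    proof (rule ccontr)
      assume "\<not> ?thesis"
      then have z: "P u = 0" "Q u = 0" if "(u, v) \<in> R" for u v using that by auto
      have "(w1, v1) \<in> S"
      proof (rule max[OF r1])
        fix u v assume uv: "(u, v) \<in> R"
        then have "raw u v" by (simp add: R_def)
        then show "B w1 (\<lambda>x. cnj (u x)) = 0" using form[OF r1] z[OF uv] by simp
      qed
      then have "(w1, v1) \<in> R" using r1 by (simp add: R_def)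
      then show False using z(1) PQ by simp
    qed
    then obtain u v where uv: "(u, v) \<in> R" and nz: "(P u, Q u) \<noteq> (0, 0)" by blast
    have ru: "raw u v" using uv by (simp add: R_def)
    \<comment> \<open>For a single nonzero vector isotropy means a real direction, which is where
      the angle comes from.\<close>
    have "P u * cnj (Q u) = Q u * cnj (P u)" using iso[OF uv uv] unfolding form[OF ru ru] by simp
    then obtain \<phi> where \<phi>: "0 \<le> \<phi>" "\<phi> < pi" "P u * complex_of_real (cos \<phi>) = Q u * complex_of_real (sin \<phi>)"
      using real_direction_angle[OF nz] by blast
    have RD: "P f * complex_of_real (cos \<phi>) = Q f * complex_of_real (sin \<phi>)" if fg: "(f, g) \<in> R" for f g
    proof (rule orthogonal_to_direction[OF nz \<phi>(3)])
      have "raw f g" using fg by (simp add: R_def)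
      then show "P f * cnj (Q u) - Q f * cnj (P u) = 0" using iso[OF fg uv] form[OF _ ru] by simp
    qed
    have "R = D \<phi>"
    proof
      show "R \<subseteq> D \<phi>" using RD by (auto simp: R_def D_def)
      show "D \<phi> \<subseteq> R"
      proof (rule subrelI)
        fix f g assume fg: "(f, g) \<in> D \<phi>"
        then have rf: "raw f g" by (simp add: D_def)
        have "(f, g) \<in> S"
        proof (rule max[OF rf])
          fix u v assume uv: "(u, v) \<in> R"
          then have "raw u v" by (simp add: R_def)
          then show "B f (\<lambda>x. cnj (u x)) = 0"
            unfolding form[OF rf \<open>raw u v\<close>] by (intro isotropic_pair[of _ \<phi>]) (use fg RD[OF uv] in \<open>auto simp: D_def\<close>)
        qed
        then show "(f, g) \<in> R" using rf by (simp add: R_def)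
      qed
    qed
    then have "S = bc_rel I rho sig chi c Fe w1 w2 \<phi>" using SR bc by simp
    then show "\<exists>phi. 0 \<le> phi \<and> phi < pi \<and> S = bc_rel I rho sig chi c Fe w1 w2 phi" using \<phi> by blast
  qed
qed

end

section \<open>The two endpoints\<close>

theorem theorem7p3:
  fixes a b :: ereal and rho :: "real measure" and sig chi :: smeasure and c :: real
  assumes "sl_hyps a b rho sig chi c"
  shows
   "(lc_left (ivl a b) rho sig chi c \<and> \<not> lc_right (ivl a b) rho sig chi c \<longrightarrow>
      (\<forall>w1 w2. in_Tmax (ivl a b) rho sig chi c w1 \<and> in_Tmax (ivl a b) rho sig chi c w2 \<and>
         wr_end (ivl a b) rho sig chi c (left_end a) w1 (\<lambda>x. cnj (w2 x)) = 1 \<and>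
         wr_end (ivl a b) rho sig chi c (left_end a) w1 (\<lambda>x. cnj (w1 x)) = 0 \<and>
         wr_end (ivl a b) rho sig chi c (left_end a) w2 (\<lambda>x. cnj (w2 x)) = 0 \<longrightarrow>
       (\<forall>S. linear_rel (ivl a b) rho S \<longrightarrow>
          ((S \<subseteq> Tmax (ivl a b) rho sig chi c \<and> adj (ivl a b) rho S = S) \<longleftrightarrow>
           (\<exists>phi. 0 \<le> phi \<and> phi < pi \<and>
              S = bc_rel (ivl a b) rho sig chi c (left_end a) w1 w2 phi)))))
    \<and>
    (lc_right (ivl a b) rho sig chi c \<and> \<not> lc_left (ivl a b) rho sig chi c \<longrightarrow>
      (\<forall>w1 w2. in_Tmax (ivl a b) rho sig chi c w1 \<and> in_Tmax (ivl a b) rho sig chi c w2 \<and>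
         wr_end (ivl a b) rho sig chi c (right_end b) w1 (\<lambda>x. cnj (w2 x)) = 1 \<and>
         wr_end (ivl a b) rho sig chi c (right_end b) w1 (\<lambda>x. cnj (w1 x)) = 0 \<and>
         wr_end (ivl a b) rho sig chi c (right_end b) w2 (\<lambda>x. cnj (w2 x)) = 0 \<longrightarrow>
       (\<forall>S. linear_rel (ivl a b) rho S \<longrightarrow>
          ((S \<subseteq> Tmax (ivl a b) rho sig chi c \<and> adj (ivl a b) rho S = S) \<longleftrightarrow>
           (\<exists>phi. 0 \<le> phi \<and> phi < pi \<and>
              S = bc_rel (ivl a b) rho sig chi c (right_end b) w1 w2 phi)))))"
proof -
  interpret measure_sl a b rho sig chi c by unfold_locales (rule assms)
  \<comment> \<open>The sign is the one with which the left end enters Green's formula; the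
    limit-point case at the right end removes the other boundary term.\<close>
  have left: "one_sided_green a b rho sig chi c (left_end a) (- 1)" if lp: "\<not> lc_right I rho sig chi c"
  proof unfold_locales
    show "eventually (\<lambda>x. x \<in> I) Fa" using eventually_left_end[OF c_in] by eventually_elim simp
    show "eventually (\<lambda>x. x \<notin> {s..<t}) Fa" if "s \<in> I" for s t
      using eventually_left_end[OF that] by eventually_elim auto
    show "linner I rho g u - linner I rho f v = - 1 * V Fa f (\<lambda>x. cnj (u x))" if "raw f g" "raw u v" for f g u v
      using green[OF that] limit_point_right[OF lp that(1) raw_cnj[OF that(2)]] by simp
  qed (use left_end_nontrivial V_tendsto_left in auto)
  have right: "one_sided_green a b rho sig chi c (right_end b) 1" if lp: "\<not> lc_left I rho sig chi c"
  proof unfold_locales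
    show "eventually (\<lambda>x. x \<in> I) Fb" using eventually_right_end[OF c_in] by eventually_elim simp
    show "eventually (\<lambda>x. x \<notin> {s..<t}) Fb" if "t \<in> I" for s t
      using eventually_right_end[OF that] by eventually_elim auto
    show "linner I rho g u - linner I rho f v = 1 * V Fb f (\<lambda>x. cnj (u x))" if "raw f g" "raw u v" for f g u v
      using green[OF that] limit_point_left[OF lp that(1) raw_cnj[OF that(2)]] by simp
  qed (use right_end_nontrivial V_tendsto_right in auto)
  show ?thesis
  proof (intro conjI impI allI, goal_cases)
    case (1 w1 w2 S)
    then show ?case
      by (elim conjE) (rule one_sided_green.self_adjoint_restriction_iff[OF left])
  next
    case (2 w1 w2 S)
    then show ?case
      by (elim conjE) (rule one_sided_green.self_adjoint_restriction_iff[OF right])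
  qed
qed

end
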